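(* Let $l\geq 5$ be odd, and let $t_l$ be a $3$-polytope satisfying property $\mathcal{Q}_l$. Fix an integer $m\geq 14$, $m\equiv 2\pmod 4$, and let $n:=l+mk$, where $k$ is a non-negative integer. Then there exists a sequence of $3$-polytopes $$\{t_n\}_{n=l+mk,\ k\geq 1},$$ where each $t_n$ satisfies $\mathcal{Q}_n$, such that along the sequence, for all $\epsilon>0$, one has $$|V(t_n)|\leq\frac{n^2}{4}-\frac{11n}{4}+\left(\frac{5}{2m}+\epsilon\right)n$$ as $n\to\infty$. Moreover, for all $k\geq 1$, it holds that $$t_{l+m(k-1)}\prec t_{l+mk}.$$ For chosen $t_l$ and $N\geq 1$, the explicit splitting-and-replacement algorithm described in the context constructs $t_{l+mk}$ for $1\leq k\leq N$.
   Context: All graphs are without loops or multiple edges. A $3$-polytope (equivalently, $3$-polytopal graph or polyhedron) is a planar, $3$-connected graph (a graph is $k$-connected if it has at least $k+1$ vertices and removing any set of $k-1$ or fewer vertices leaves a connected graph). Such a graph has a unique embedding in the sphere; its faces are the regions of this embedding, each bounded by a cycle, and a triangular face is denoted by its set of three vertices. $V(G)$ is the vertex set of $G$. The notation $H\prec G$ means that $H$ is isomorphic to a subgraph of $G$. Property $\mathcal{Q}_n$ ($n\geq 5$ odd): the $3$-polytope has at least one vertex of degree $3$, and moreover contains among its faces the triangles $$F_{n;j}=\{v_{n;j;1},v_{n;j;2},v_{n;j;3}\},\quad 1\leq j\leq (n-3)/2,$$ where $$\{\deg(v_{n;j;1}):1\leq j\leq (n-3)/2\}\cup\{\deg(v_{n;j;2}):1\leq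 j\leq (n-3)/2\}=\{4,5,\dots,n\}$$ and $v_{n;j;3}\neq v_{n;i;1},v_{n;i;2}$ for all $i,j$. Splitting a triangle $\{a,b,c\}$ means adding a new vertex $d$ and edges $da,db,dc$. To $h$-split $\{a,b,c\}$ about $c$ ($h\geq 1$): split it, introducing a new vertex $c_1$; then split $\{a,b,c_1\}$, introducing $c_2$; and so on, until $c_h$ has been added. Auxiliary graph: $s_{m+3}$ is a suitable fixed $3$-polytope, constructed beforehand, with $\frac{(m+3)^2-7(m+3)+34}{4}$ vertices. It has vertices of degree $3$, and among its faces there are triangles $\{x_{j;1},x_{j;2},x_{j;3}\}$, $1\leq j\leq (m+2)/2$, with $\deg(x_{1;1})=\deg(x_{1;2})=m+2$, with $\{\deg(x_{j;1}):2\leq j\leq (m+2)/2\}\cup\{\deg(x_{j;2}):2\leq j\leq (m+2)/2\}=\{4,5,\dots,m+3\}$, and with $x_{j;3}\neq x_{i;1},x_{i;2}$ for all $i,j$. The algorithm. Input: a $3$-polytope $t_l$ satisfying $\mathcal{Q}_l$, an integer $m\geq 14$ with $m\equiv 2\pmod 4$, and a positive integer $N$. Output: the graphs $t_{l+mk}$, $1\leq k\leq N$. At step $k$ ($1\leq k\leq N$), starting from $t_{l+m(k-1)}$, which satisfies $\mathcal{Q}_{l+m(k-1)}$ with triangles $F_{l+m(k-1);j}$, one $m$-splits $F_{l+m(k-1);j}$ about $v_{l+m(k-1);j;3}$ for each $j=2,\dots,(l+m(k-1)-3)/2$; then one replaces the remaining triangle $F_{l+m(k-1);1}$ with a copy of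 $s_{m+3}$, identifying $v_{l+m(k-1);1;1}$ and $v_{l+m(k-1);1;2}$ with two adjacent vertices of degree $m+2$ in $s_{m+3}$ (so that $|V(s_{m+3})|-3$ new vertices are introduced by this replacement). The result is $t_{l+mk}$. *)

theory Defs
  imports "HOL-Analysis.Analysis" "HOL-Library.Infinite_Typeclass"
begin

record 'a sgraph =
  verts :: "'a set"
  edges :: "'a set set"

definition simple_graph :: "'a sgraph \<Rightarrow> bool" where
  "simple_graph G \<longleftrightarrow> finite (verts G) \<and> (\<forall>e\<in>edges G. e \<subseteq> verts G \<and> card e = 2)"

definition deg :: "'a sgraph \<Rightarrow> 'a \<Rightarrow> nat" where
  "deg G v = card {e \<in> edges G. v \<in> e}"

definition delete_verts :: "'a sgraph \<Rightarrow> 'a set \<Rightarrow> 'a sgraph" where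
  "delete_verts G X = \<lparr>verts = verts G - X, edges = {e \<in> edges G. e \<inter> X = {}}\<rparr>"

definition graph_connected :: "'a sgraph \<Rightarrow> bool" where
  "graph_connected G \<longleftrightarrow>
     (\<forall>u\<in>verts G. \<forall>v\<in>verts G. (u, v) \<in> {(x, y). {x, y} \<in> edges G}\<^sup>*)"

definition k_connected :: "nat \<Rightarrow> 'a sgraph \<Rightarrow> bool" where
  "k_connected k G \<longleftrightarrow> k + 1 \<le> card (verts G) \<and>
     (\<forall>X\<subseteq>verts G. card X \<le> k - 1 \<longrightarrow> graph_connected (delete_verts G X))"

definition subgraph :: "'a sgraph \<Rightarrow> 'a sgraph \<Rightarrow> bool" where
  "subgraph H G \<longleftrightarrow> verts H \<subseteq> verts G \<and> edges H \<subseteq> edges G"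

definition graph_image :: "('a \<Rightarrow> 'b) \<Rightarrow> 'a sgraph \<Rightarrow> 'b sgraph" where
  "graph_image f G = \<lparr>verts = f ` verts G, edges = (\<lambda>e. f ` e) ` edges G\<rparr>"

definition isomorphic_to_subgraph :: "'a sgraph \<Rightarrow> 'b sgraph \<Rightarrow> bool" where
  "isomorphic_to_subgraph H G \<longleftrightarrow>
     (\<exists>f. inj_on f (verts H) \<and> subgraph (graph_image f H) G)"

abbreviation two_sphere :: "(real ^ 3) set" where
  "two_sphere \<equiv> sphere 0 1"

text \<open>The vertex \<open>v\<close> is drawn at the point \<open>p v\<close>, and the edge \<open>e\<close> as the point set \<open>\<gamma> e\<close>,
  which is a simple arc.\<close>

definition sphere_embedding ::
  "'a sgraph \<Rightarrow> ('a \<Rightarrow> real ^ 3) \<Rightarrow> ('a set \<Rightarrow> (real ^ 3) set) \<Rightarrow> bool" where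
  "sphere_embedding G p \<gamma> \<longleftrightarrow>
     inj_on p (verts G) \<and> p ` verts G \<subseteq> two_sphere \<and>
     (\<forall>u v. {u, v} \<in> edges G \<longrightarrow>
        (\<exists>g. arc g \<and> pathstart g = p u \<and> pathfinish g = p v \<and>
             path_image g = \<gamma> {u, v} \<and> path_image g \<subseteq> two_sphere)) \<and>
     (\<forall>e\<in>edges G. \<forall>v\<in>verts G. p v \<in> \<gamma> e \<longrightarrow> v \<in> e) \<and>
     (\<forall>e\<in>edges G. \<forall>f\<in>edges G. e \<noteq> f \<longrightarrow> \<gamma> e \<inter> \<gamma> f \<subseteq> p ` (e \<inter> f))"

definition planar :: "'a sgraph \<Rightarrow> bool" where
  "planar G \<longleftrightarrow> (\<exists>p \<gamma>. sphere_embedding G p \<gamma>)"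

definition regions ::
  "'a sgraph \<Rightarrow> ('a \<Rightarrow> real ^ 3) \<Rightarrow> ('a set \<Rightarrow> (real ^ 3) set) \<Rightarrow> (real ^ 3) set set" where
  "regions G p \<gamma> = components (two_sphere - (p ` verts G \<union> \<Union> (\<gamma> ` edges G)))"

definition triangular_face ::
  "'a sgraph \<Rightarrow> ('a \<Rightarrow> real ^ 3) \<Rightarrow> ('a set \<Rightarrow> (real ^ 3) set) \<Rightarrow> 'a set \<Rightarrow> bool" where
  "triangular_face G p \<gamma> T \<longleftrightarrow> T \<subseteq> verts G \<and> card T = 3 \<and>
     {e. e \<subseteq> T \<and> card e = 2} \<subseteq> edges G \<and>
     (\<exists>R\<in>regions G p \<gamma>.
        top_of_set two_sphere frontier_of R = \<Union> (\<gamma> ` {e. e \<subseteq> T \<and> card e = 2}))"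

definition three_polytope :: "'a sgraph \<Rightarrow> bool" where
  "three_polytope G \<longleftrightarrow> simple_graph G \<and> planar G \<and> k_connected 3 G"

text \<open>The vertex written \<open>v j i\<close> is the \<open>i\<close>-th vertex of the \<open>j\<close>-th triangle. Since the embedding of a
  polytope in the sphere is essentially unique, the faces are those of any embedding; what matters
  is that all triangles are faces of one and the same embedding.\<close>

definition Q_triangles :: "nat \<Rightarrow> 'a sgraph \<Rightarrow> (nat \<Rightarrow> nat \<Rightarrow> 'a) \<Rightarrow> bool" where
  "Q_triangles n G v \<longleftrightarrow>
     (\<exists>p \<gamma>. sphere_embedding G p \<gamma> \<and>
        (\<forall>j\<in>{1..(n - 3) div 2}. triangular_face G p \<gamma> {v j 1, v j 2, v j 3})) \<and>
     (\<lambda>j. deg G (v j 1)) ` {1..(n - 3) div 2} \<union> (\<lambda>j. deg G (v j 2)) ` {1..(n - 3) div 2}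
       = {4..n} \<and>
     (\<forall>i\<in>{1..(n - 3) div 2}. \<forall>j\<in>{1..(n - 3) div 2}. v j 3 \<noteq> v i 1 \<and> v j 3 \<noteq> v i 2)"

definition property_Q :: "nat \<Rightarrow> 'a sgraph \<Rightarrow> bool" where
  "property_Q n G \<longleftrightarrow> (\<exists>w\<in>verts G. deg G w = 3) \<and> (\<exists>v. Q_triangles n G v)"

definition auxiliary_graph :: "nat \<Rightarrow> 'a sgraph \<Rightarrow> (nat \<Rightarrow> nat \<Rightarrow> 'a) \<Rightarrow> bool" where
  "auxiliary_graph m s x \<longleftrightarrow>
     three_polytope s \<and>
     real (card (verts s)) = ((real m + 3)\<^sup>2 - 7 * (real m + 3) + 34) / 4 \<and>
     (\<exists>w\<in>verts s. deg s w = 3) \<and>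
     (\<exists>p \<gamma>. sphere_embedding s p \<gamma> \<and>
        (\<forall>j\<in>{1..(m + 2) div 2}. triangular_face s p \<gamma> {x j 1, x j 2, x j 3})) \<and>
     deg s (x 1 1) = m + 2 \<and> deg s (x 1 2) = m + 2 \<and>
     (\<lambda>j. deg s (x j 1)) ` {2..(m + 2) div 2} \<union> (\<lambda>j. deg s (x j 2)) ` {2..(m + 2) div 2}
       = {4..m + 3} \<and>
     (\<forall>i\<in>{1..(m + 2) div 2}. \<forall>j\<in>{1..(m + 2) div 2}. x j 3 \<noteq> x i 1 \<and> x j 3 \<noteq> x i 2)"

definition split_triangle :: "'a sgraph \<Rightarrow> 'a \<Rightarrow> 'a \<Rightarrow> 'a \<Rightarrow> 'a \<Rightarrow> 'a sgraph" where
  "split_triangle G a b c d =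
     \<lparr>verts = insert d (verts G), edges = edges G \<union> {{d, a}, {d, b}, {d, c}}\<rparr>"

text \<open>Splitting \<open>{a, b, c}\<close> about \<open>c\<close>, the list giving the new vertices in order of introduction.\<close>

fun split_about :: "'a sgraph \<Rightarrow> 'a \<Rightarrow> 'a \<Rightarrow> 'a \<Rightarrow> 'a list \<Rightarrow> 'a sgraph" where
  "split_about G a b c [] = G"
| "split_about G a b c (d # ds) = split_about (split_triangle G a b c d) a b d ds"

definition h_split :: "nat \<Rightarrow> 'a \<Rightarrow> 'a \<Rightarrow> 'a \<Rightarrow> 'a sgraph \<Rightarrow> 'a sgraph \<Rightarrow> bool" where
  "h_split h a b c G G' \<longleftrightarrow>
     (\<exists>ds. length ds = h \<and> distinct ds \<and> set ds \<inter> verts G = {} \<and> G' = split_about G a b c ds)"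

text \<open>The triangle \<open>{a, b, c}\<close> is replaced with a copy of \<open>s\<close>, glued along a triangular face
  \<open>{y1, y2, y3}\<close> of \<open>s\<close>; \<open>f\<close> is the copying map, and every vertex of the copy other than
  \<open>a\<close>, \<open>b\<close>, \<open>c\<close> is new.\<close>

definition replace_triangle ::
  "'b sgraph \<Rightarrow> 'b \<Rightarrow> 'b \<Rightarrow> 'b \<Rightarrow> 'a \<Rightarrow> 'a \<Rightarrow> 'a \<Rightarrow> 'a sgraph \<Rightarrow> 'a sgraph \<Rightarrow> bool" where
  "replace_triangle s y1 y2 y3 a b c G G' \<longleftrightarrow>
     (\<exists>p \<gamma>. sphere_embedding s p \<gamma> \<and> triangular_face s p \<gamma> {y1, y2, y3}) \<and>
     (\<exists>f. inj_on f (verts s) \<and> f y1 = a \<and> f y2 = b \<and> f y3 = c \<and>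
        f ` verts s \<inter> verts G = {a, b, c} \<and>
        G' = \<lparr>verts = verts G \<union> verts (graph_image f s),
              edges = edges G \<union> edges (graph_image f s)\<rparr>)"

text \<open>One step, from \<open>G\<close> with its triangles \<open>v\<close> to \<open>G'\<close>. The graph \<open>H j\<close> is obtained once the triangles
  with indices \<open>2, \<dots>, j\<close> have been split.\<close>

definition algorithm_step ::
  "nat \<Rightarrow> 'b sgraph \<Rightarrow> nat \<Rightarrow> (nat \<Rightarrow> nat \<Rightarrow> 'a) \<Rightarrow> 'a sgraph \<Rightarrow> 'a sgraph \<Rightarrow> bool" where
  "algorithm_step m s n v G G' \<longleftrightarrow>
     property_Q n G \<and> Q_triangles n G v \<and>
     (\<exists>H. H 1 = G \<and>
        (\<forall>j\<in>{2..(n - 3) div 2}. h_split m (v j 1) (v j 2) (v j 3) (H (j - 1)) (H j)) \<and>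
        (\<exists>y1 y2 y3. deg s y1 = m + 2 \<and> deg s y2 = m + 2 \<and>
           replace_triangle s y1 y2 y3 (v 1 1) (v 1 2) (v 1 3) (H ((n - 3) div 2)) G'))"

definition algorithm_run ::
  "nat \<Rightarrow> 'b sgraph \<Rightarrow> nat \<Rightarrow> nat \<Rightarrow> (nat \<Rightarrow> nat \<Rightarrow> nat \<Rightarrow> 'a) \<Rightarrow> (nat \<Rightarrow> 'a sgraph) \<Rightarrow> bool" where
  "algorithm_run m s l N v t \<longleftrightarrow>
     (\<forall>k\<in>{1..N}. algorithm_step m s (l + m * (k - 1)) (v (l + m * (k - 1)))
                   (t (l + m * (k - 1))) (t (l + m * k)))"

end

(*
  Every step of the algorithm is made of splittings of single triangular faces, provided that the
  auxiliary graph s is itself a stacked triangulation, grown from the triangle along which it is glued.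
  Splitting a face keeps a graph 3-connected, and raises three degrees by one.

  That it keeps a drawing on the sphere is a statement about Jordan curves: Janiszewski's theorem
  shows that the inside of a Jordan curve is uniformly locally connected at every point of the curve,
  hence that every point of the curve is accessible from the inside; two crosscuts then give a tripod
  that divides the face into three.

  For s let q = m + 3. A core is a stacked triangulation whose vertices are the q - 1 vertices of
  prescribed degree. All its faces but three receive a further vertex, and then triangles on core edges
  are split repeatedly until the degrees are right. An edge count shows that the prescribed number of vertices
  leaves no room for more than three empty faces, and the vertices of degrees 4 and 5 require three of them.
  The cases q = 17 and q = 21 were found by a computer search, and a strip of four new core vertices leads from q to q + 4.
*)

theory Submission
  imports Defs
begin

subsection \<open>Crosscuts in the inside of a Jordan curve\<close>

text \<open>The given drawing consists of arbitrary arcs, so there are no coordinates in which a new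
  vertex could simply be put into a face. All triangles must moreover be faces of one embedding;
  hence a family of faces is carried along with each graph, and every splitting extends the drawing
  at hand.

  The edge count for an auxiliary graph with V vertices runs as follows. The core has 3q - 9 edges
  and 2q - 6 faces, the prescribed degrees sum to (q^2 + 5q - 16)/2, and there are 3V - 6 edges in
  all. With 4V = q^2 - 7q + 34, the vertices outside the core exceed the edges between them by
  exactly 2q - 9. The vertices inside one core face span a connected graph, which contributes at
  most 1 to this excess. So at least 2q - 9 core faces are nonempty, and if no more are, then all
  these graphs are trees: each further vertex in a core face must be joined to two core vertices,
  that is, it splits a triangle on a core edge.\<close>

text \<open>If \<open>K\<close> is the part of the curve away from \<open>x\<close>, then neither the curve nor \<open>K \<union> - ball x e\<close> separates
  \<open>u\<close> from \<open>v\<close>. They meet in the connected set \<open>K\<close>, so by Janiszewski their union does not separate them either.\<close>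

lemma inside_ulc:
  fixes c :: "real \<Rightarrow> complex"
  assumes c: "simple_path c" "pathfinish c = pathstart c" and x: "x \<in> path_image c" and e: "0 < e"
  obtains d where "0 < d"
    "\<And>u v. \<lbrakk>u \<in> inside (path_image c); v \<in> inside (path_image c); dist x u < d; dist x v < d\<rbrakk> \<Longrightarrow>
       \<exists>g. path g \<and> pathstart g = u \<and> pathfinish g = v \<and>
           path_image g \<subseteq> inside (path_image c) \<inter> ball x e"
proof -
  let ?J = "path_image c"
  have "\<exists>y\<in>?J. y \<noteq> x"
  proof (rule ccontr)
    assume "\<not> ?thesis"
    then have "?J \<subseteq> {x}" by auto
    moreover have "c 0 \<in> ?J" "c (1/2) \<in> ?J" by (auto simp: path_image_def)
    ultimately have "c 0 = c (1/2)" by auto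
    then have "(0::real) = 1/2 \<or> (0::real) = 0 \<and> (1/2::real) = 1 \<or> (0::real) = 1 \<and> (1/2::real) = 0"
      using c(1)[unfolded simple_path_def loop_free_def, THEN conjunct2, rule_format, of 0 "1/2"] by simp
    then show False by simp
  qed
  then obtain y where y: "y \<in> ?J" "y \<noteq> x" by blast
  obtain g1 g2 where g: "arc g1" "arc g2" "pathstart g1 = x" "pathfinish g1 = y"
       "pathstart g2 = y" "pathfinish g2 = x"
       "path_image g1 \<inter> path_image g2 = {x,y}" "path_image g1 \<union> path_image g2 = ?J"
    using exists_double_arc[OF c x y(1)] y(2) by metis
  define h2 where "h2 = reversepath g2"
  have h2: "arc h2" "pathstart h2 = x" "pathfinish h2 = y" "path_image h2 = path_image g2"
    using g by (auto simp: h2_def arc_reversepath)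
  \<comment> \<open>Removing a short initial piece of each of the two arcs from \<open>x\<close> to
    \<open>y\<close> leaves two continua that share \<open>y\<close>. Their union is the connected
    intersection which Janiszewski's theorem requires.\<close>
  have tail: "\<exists>T. compact T \<and> connected T \<and> T \<subseteq> path_image h \<and> y \<in> T \<and> x \<notin> T \<and> path_image h - T \<subseteq> ball x e"
    if h: "arc h" "pathstart h = x" "pathfinish h = y" for h
  proof -
    have cont: "continuous_on {0..1} h" using h(1) by (simp add: arc_def path_def)
    have h0: "h 0 = x" using h(2) by (simp add: pathstart_def)
    obtain s where s: "s > 0" "\<And>t. t \<in> {0..1} \<Longrightarrow> dist t 0 < s \<Longrightarrow> dist (h t) (h 0) < e"
      using cont e unfolding continuous_on_iff by (metis atLeastAtMost_iff order_refl zero_le_one)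
    define s' where "s' = min s 1"
    have s': "0 < s'" "s' \<le> 1" using s by (auto simp: s'_def)
    let ?T = "h ` {s'..1}"
    have sub: "{s'..1} \<subseteq> {0..1}" using s' by auto
    have "compact ?T" by (meson compact_Icc compact_continuous_image cont continuous_on_subset sub)
    moreover have "connected ?T" by (meson connected_Icc connected_continuous_image cont continuous_on_subset sub)
    moreover have "?T \<subseteq> path_image h" using sub by (auto simp: path_image_def)
    moreover have "y \<in> ?T" using h(3) s' by (auto simp: pathfinish_def)
    moreover have "x \<notin> ?T"
    proof
      assume "x \<in> ?T"
      then obtain t where "t \<in> {s'..1}" "h t = h 0" using h0 by auto
      then have "t = 0" using h(1) s' unfolding arc_def inj_on_def by auto
      then show False using s' \<open>t \<in> {s'..1}\<close> by auto
    qed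
    moreover have "path_image h - ?T \<subseteq> ball x e"
    proof
      fix z assume "z \<in> path_image h - ?T"
      then obtain t where t: "t \<in> {0..1}" "z = h t" "z \<notin> ?T" by (auto simp: path_image_def)
      then have "t \<notin> {s'..1}" by blast
      then have "dist t 0 < s" using t(1) by (auto simp: s'_def)
      then show "z \<in> ball x e" using s(2) t h0 by (auto simp: dist_commute)
    qed
    ultimately show ?thesis by blast
  qed
  obtain T1 T2 where T1: "compact T1" "connected T1" "T1 \<subseteq> path_image g1" "y \<in> T1" "x \<notin> T1" "path_image g1 - T1 \<subseteq> ball x e"
    and T2: "compact T2" "connected T2" "T2 \<subseteq> path_image h2" "y \<in> T2" "x \<notin> T2" "path_image h2 - T2 \<subseteq> ball x e"
    using tail[OF g(1,3,4)] tail[OF h2(1,2,3)] by blast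
  define K where "K = T1 \<union> T2"
  have K: "compact K" "connected K" "K \<subseteq> ?J" "x \<notin> K" "?J - K \<subseteq> ball x e"
    using T1 T2 g(8) h2(4) by (auto simp: K_def intro!: connected_Un)
  define T where "T = K \<union> - ball x e"
  have "closed K" using K(1) compact_imp_closed by blast
  then have "open (- K)" by auto
  then obtain d0 where d0: "d0 > 0" "ball x d0 \<subseteq> - K" using K(4) by (meson ComplI openE)
  define d where "d = min d0 e"
  have d: "0 < d" using d0 e by (auto simp: d_def)
  have dT: "ball x d \<subseteq> - T" using d0 by (auto simp: d_def T_def)
  have J: "inside ?J \<noteq> {}" "open (inside ?J)" "connected (inside ?J)" "frontier (inside ?J) = ?J"
    using Jordan_inside_outside[OF c] by auto
  show thesis
  proof
    show "0 < d" by fact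
    fix u v assume u: "u \<in> inside ?J" and v: "v \<in> inside ?J" and du: "dist x u < d" and dv: "dist x v < d"
    have 1: "connected_component (- ?J) u v"
      unfolding connected_component_def using u v J(3) inside_no_overlap[of ?J]
      by (intro exI[of _ "inside ?J"] conjI) blast+
    have 2: "connected_component (- T) u v"
      using dT du dv by (auto simp: connected_component_def intro!: exI[of _ "ball x d"])
    have 3: "?J \<inter> T = K" using K(3,5) by (auto simp: T_def)
    have clT: "closed T" using \<open>closed K\<close> by (auto simp: T_def)
    have cJ: "compact ?J" using c(1) by (simp add: compact_simple_path_image)
    have "connected_component (- (?J \<union> T)) u v"
      using Janiszewski[OF cJ clT _ 1 2] K(2) 3 by auto
    moreover have "open (- (?J \<union> T))" using clT cJ compact_imp_closed by (metis closed_Un open_Compl)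
    ultimately have "path_component (- (?J \<union> T)) u v" by (simp add: open_path_connected_component)
    then obtain g where gg: "path g" "path_image g \<subseteq> - (?J \<union> T)" "pathstart g = u" "pathfinish g = v"
      by (auto simp: path_component_def)
    have "path_image g \<subseteq> inside ?J"
    proof (rule ccontr)
      assume "\<not> ?thesis"
      then have "path_image g \<inter> frontier (inside ?J) \<noteq> {}"
        using gg u by (intro connected_Int_frontier) (auto simp: connected_path_image)
      then show False using J(4) gg(2) by auto
    qed
    moreover have "path_image g \<subseteq> ball x e" using gg(2) by (auto simp: T_def)
    ultimately show "\<exists>g. path g \<and> pathstart g = u \<and> pathfinish g = v \<and> path_image g \<subseteq> inside ?J \<inter> ball x e"
      using gg by blast
  qed
qed

section \<open>Accessibility of the points of a Jordan curve\<close>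

text \<open>The paths are run one after another on [0, \<infinity>), and s / (1 - s) carries [0, 1)
  there. Continuity at the end holds because all paths from the n-th on stay in the ball of radius 1
  / (n + 1) about \<open>x\<close>.\<close>

lemma path_to_limit:
  fixes x :: "'a::metric_space"
  assumes p: "\<And>n. path (p n)" "\<And>n. pathfinish (p n) = pathstart (p (Suc n))"
    and im: "\<And>n. path_image (p n) \<subseteq> S \<inter> ball x (1 / real (Suc n))"
  shows "\<exists>g. path g \<and> pathstart g = pathstart (p 0) \<and> pathfinish g = x \<and> path_image g \<subseteq> insert x S"
proof -
  define F where "F t = p (nat \<lfloor>t\<rfloor>) (t - of_int \<lfloor>t\<rfloor>)" for t :: real
  have Fn: "F t = p n (t - real n)" if "t \<in> {real n..real n + 1}" for t n
  proof (cases "t = real n + 1")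
    case True
    then have "F t = p (Suc n) 0" by (simp add: F_def nat_add_distrib)
    also have "\<dots> = p n 1" using p(2)[of n] by (simp add: pathstart_def pathfinish_def)
    finally show ?thesis using True by simp
  next
    case False
    then have "\<lfloor>t\<rfloor> = int n" using that by (intro floor_unique) auto
    then show ?thesis by (simp add: F_def)
  qed
  have cn: "continuous_on {real n..real n + 1} F" for n
  proof -
    have "continuous_on {real n..real n + 1} (\<lambda>t. p n (t - real n))"
      by (rule continuous_on_compose2[of "{0..1}" "p n"])
         (use p(1)[of n] in \<open>auto simp: path_def intro!: continuous_intros\<close>)
    then show ?thesis by (rule continuous_on_eq) (use Fn in auto)
  qed
  have c0: "continuous_on {0..real n} F" for n
  proof (induction n)
    case 0
    show ?case by simp
  next
    case (Suc n)
    have "{0..real (Suc n)} = {0..real n} \<union> {real n..real n + 1}" by auto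
    then show ?case using Suc cn[of n] by (simp add: continuous_on_closed_Un)
  qed
  have ce: "continuous_on {0..} F"
    unfolding continuous_on_eq_continuous_within
  proof
    fix t :: real assume t: "t \<in> {0..}"
    obtain n where n: "t < real n" using reals_Archimedean2 by blast
    have "continuous (at t within {0..real n}) F"
      using c0[of n] t n by (auto simp: continuous_on_eq_continuous_within)
    moreover have "at t within {0..real n} = at t within {0..}"
      by (rule at_within_nhd[of _ "{..<real n}"]) (use n in auto)
    ultimately show "continuous (at t within {0..}) F" by simp
  qed
  have Fim: "F t \<in> S \<inter> ball x (1 / real (Suc n))" if "real n \<le> t" for t n
  proof -
    have "t \<ge> 0" using that by linarith
    then have *: "t \<in> {real (nat \<lfloor>t\<rfloor>)..real (nat \<lfloor>t\<rfloor>) + 1}" by (auto simp: of_nat_nat) 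
    let ?k = "nat \<lfloor>t\<rfloor>"
    have "?k \<ge> n" using that by (simp add: le_nat_floor)
    have "F t = p ?k (t - real ?k)" using Fn[OF *] .
    also have "\<dots> \<in> path_image (p ?k)"
      unfolding path_image_def using * by (intro imageI) (simp only: atLeastAtMost_iff, linarith)
    also have "\<dots> \<subseteq> S \<inter> ball x (1 / real (Suc ?k))" by (rule im)
    also have "\<dots> \<subseteq> S \<inter> ball x (1 / real (Suc n))" using \<open>?k \<ge> n\<close> by (auto simp: frac_le elim!: order.strict_trans2)
    finally show ?thesis .
  qed
  define g where "g s = (if s < 1 then F (s / (1 - s)) else x)" for s :: real
  have "continuous_on {0..1} g"
    unfolding continuous_on_eq_continuous_within
  proof
    fix s :: real assume s: "s \<in> {0..1}"
    show "continuous (at s within {0..1}) g"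
    proof (cases "s < 1")
      case True
      have "continuous_on {0..<1} (\<lambda>s. F (s / (1 - s)))"
        by (rule continuous_on_compose2[OF ce]) (auto intro!: continuous_intros)
      then have "continuous_on {0..<1} g" by (rule continuous_on_eq) (auto simp: g_def)
      then have "continuous (at s within {0..<1}) g" using True s by (auto simp: continuous_on_eq_continuous_within)
      moreover have "at s within {0..<1} = at s within {0..1}"
        by (rule at_within_nhd[of _ "{..<1}"]) (use True in auto)
      ultimately show ?thesis by simp
    next
      case False
      then have s1: "s = 1" using s by auto
      show ?thesis unfolding s1 continuous_within_eps_delta
      proof (intro allI impI)
        fix e :: real assume e: "e > 0"
        obtain n where n: "1 / real (Suc n) < e" using nat_approx_posE[OF e] by metis
        show "\<exists>d>0. \<forall>x'\<in>{0..1}. dist x' 1 < d \<longrightarrow> dist (g x') (g 1) < e"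
        proof (intro exI conjI ballI impI)
          show "1 / real (Suc n) > 0" by simp
          fix s assume s: "s \<in> {0..1::real}" "dist s 1 < 1 / real (Suc n)"
          show "dist (g s) (g 1) < e"
          proof (cases "s < 1")
            case True
            have "(1 - s) * real (Suc n) < 1" using s True by (auto simp: dist_real_def field_simps)
            then have "real n * (1 - s) \<le> s" by (simp add: algebra_simps)
            then have "real n \<le> s / (1 - s)" using True by (simp add: pos_le_divide_eq)
            then have "dist x (F (s / (1 - s))) < 1 / real (Suc n)" using Fim by fastforce
            then show ?thesis using True n by (simp add: g_def dist_commute)
          qed (use e in \<open>auto simp: g_def\<close>)
        qed
      qed
    qed
  qed
  then have "path g" by (simp add: path_def)
  moreover have "pathstart g = pathstart (p 0)" using Fn[of 0 0] by (simp add: pathstart_def g_def)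
  moreover have "pathfinish g = x" by (simp add: pathfinish_def g_def)
  moreover have "path_image g \<subseteq> insert x S"
  proof
    fix z assume "z \<in> path_image g"
    then obtain s where s: "s \<in> {0..1}" "z = g s" by (auto simp: path_image_def)
    show "z \<in> insert x S"
    proof (cases "s < 1")
      case True
      then have "s / (1 - s) \<ge> real 0" using s by auto
      from Fim[OF this] show ?thesis using True s by (auto simp: g_def)
    qed (use s in \<open>auto simp: g_def\<close>)
  qed
  ultimately show ?thesis by blast
qed

text \<open>Points of the inside that tend to \<open>x\<close> fast enough can be joined
  consecutively within shrinking balls, by local connectedness at \<open>x\<close>; the limit of
  these paths ends at \<open>x\<close>.\<close>

lemma inside_accessible:
  fixes c :: "real \<Rightarrow> complex"
  assumes c: "simple_path c" "pathfinish c = pathstart c" and x: "x \<in> path_image c"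
  obtains g where "path g" "pathstart g \<in> inside (path_image c)" "pathfinish g = x"
    "path_image g \<subseteq> insert x (inside (path_image c))"
proof -
  let ?I = "inside (path_image c)"
  have "\<exists>d>0. \<forall>u v. u \<in> ?I \<and> v \<in> ?I \<and> dist x u < d \<and> dist x v < d \<longrightarrow>
       (\<exists>g. path g \<and> pathstart g = u \<and> pathfinish g = v \<and> path_image g \<subseteq> ?I \<inter> ball x (1 / real (Suc n)))" for n
  proof -
    have "0 < 1 / real (Suc n)" by simp
    from inside_ulc[OF c x this] show ?thesis by (smt (verit, best))
  qed
  then obtain d where d: "\<And>n. d n > 0" and dd: "\<And>n u v. \<lbrakk>u \<in> ?I; v \<in> ?I; dist x u < d n; dist x v < d n\<rbrakk> \<Longrightarrow>
       \<exists>g. path g \<and> pathstart g = u \<and> pathfinish g = v \<and> path_image g \<subseteq> ?I \<inter> ball x (1 / real (Suc n))"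
    by metis
  have "x \<in> frontier ?I" using Jordan_inside_outside[OF c] x by auto
  then have cl: "x \<in> closure ?I" by (simp add: frontier_def)
  \<comment> \<open>\<open>u n\<close> is an end point both of path \<open>n - 1\<close> and of path
    \<open>n\<close>, whence the two bounds. For n = 0 truncated subtraction makes them
    coincide.\<close>
  have "\<exists>u. u \<in> ?I \<and> dist x u < min (d n) (d (n - 1))" for n
  proof -
    have "min (d n) (d (n - 1)) > 0" using d by auto
    then show ?thesis using cl unfolding closure_approachable by (metis dist_commute)
  qed
  then obtain u where u: "\<And>n. u n \<in> ?I" "\<And>n. dist x (u n) < min (d n) (d (n - 1))" by metis
  have "\<exists>g. path g \<and> pathstart g = u n \<and> pathfinish g = u (Suc n) \<and> path_image g \<subseteq> ?I \<inter> ball x (1 / real (Suc n))" for n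
    using dd[of "u n" "u (Suc n)" n] u[of n] u[of "Suc n"] by auto
  then obtain p where p: "\<And>n. path (p n)" "\<And>n. pathstart (p n) = u n" "\<And>n. pathfinish (p n) = u (Suc n)"
     "\<And>n. path_image (p n) \<subseteq> ?I \<inter> ball x (1 / real (Suc n))" by metis
  from path_to_limit[of p, OF p(1) _ p(4)] p(2,3) obtain g where
    "path g" "pathstart g = u 0" "pathfinish g = x" "path_image g \<subseteq> insert x ?I" by auto
  then show thesis using that u(1) by metis
qed

text \<open>Two access paths are joined through the connected inside. The result may cross itself,
  but an arc within its image has the same ends and still touches the curve only there.\<close>

lemma inside_crosscut:
  fixes c :: "real \<Rightarrow> complex"
  assumes c: "simple_path c" "pathfinish c = pathstart c" and xy: "x \<in> path_image c" "y \<in> path_image c" "x \<noteq> y"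
  obtains g where "arc g" "pathstart g = x" "pathfinish g = y"
    "path_image g \<subseteq> inside (path_image c) \<union> {x, y}"
proof -
  let ?I = "inside (path_image c)"
  obtain g where g: "path g" "pathstart g \<in> ?I" "pathfinish g = x" "path_image g \<subseteq> insert x ?I"
    using inside_accessible[OF c xy(1)] by blast
  obtain h where h: "path h" "pathstart h \<in> ?I" "pathfinish h = y" "path_image h \<subseteq> insert y ?I"
    using inside_accessible[OF c xy(2)] by blast
  have "open ?I" "connected ?I" using Jordan_inside_outside[OF c] by auto
  then have "path_connected ?I" by (simp add: connected_open_path_connected)
  then obtain k where k: "path k" "path_image k \<subseteq> ?I" "pathstart k = pathstart g" "pathfinish k = pathstart h"
    using g(2) h(2) unfolding path_connected_def by blast
  define p where "p = reversepath g +++ k +++ h"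
  have p: "path p" "pathstart p = x" "pathfinish p = y" "path_image p \<subseteq> ?I \<union> {x,y}"
    using g h k by (auto simp: p_def path_image_join)
  obtain r where "arc r" "path_image r \<subseteq> path_image p" "pathstart r = x" "pathfinish r = y"
    using path_contains_arc[OF p(1-3) xy(3)] by blast
  then show thesis using that p(4) by blast
qed

section \<open>Theta curves in the plane\<close>

lemma arc_continuous_image:
  assumes "arc g" "continuous_on (path_image g) f" "inj_on f (path_image g)"
  shows "arc (f \<circ> g)"
  using assms unfolding arc_def path_image_def
  by (auto simp: path_continuous_image path_image_def intro: comp_inj_on)

text \<open>This is the Jordan curve theorem for the loop along \<open>c1\<close> and back along
  \<open>c2\<close>. In the form for two arcs it applies to each of the three cycles of a theta
  curve.\<close>

lemma theta_inside:
  fixes c1 c2 :: "real \<Rightarrow> complex"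
  assumes c1: "arc c1" "pathstart c1 = x" "pathfinish c1 = y"
    and c2: "arc c2" "pathstart c2 = x" "pathfinish c2 = y"
    and meet: "path_image c1 \<inter> path_image c2 = {x, y}"
  shows "open (inside (path_image c1 \<union> path_image c2))"
    "connected (inside (path_image c1 \<union> path_image c2))"
    "bounded (inside (path_image c1 \<union> path_image c2))"
    "inside (path_image c1 \<union> path_image c2) \<noteq> {}"
    "frontier (inside (path_image c1 \<union> path_image c2)) = path_image c1 \<union> path_image c2"
    "connected (outside (path_image c1 \<union> path_image c2))"
    "\<not> bounded (outside (path_image c1 \<union> path_image c2))"
    "\<exists>c. simple_path c \<and> pathfinish c = pathstart c \<and> path_image c = path_image c1 \<union> path_image c2"
proof -
  define c where "c = c1 +++ reversepath c2"
  have "simple_path c" unfolding c_def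
    by (rule simple_path_join_loop) (use assms in \<open>auto simp: arc_reversepath\<close>)
  moreover have "pathfinish c = pathstart c" "path_image c = path_image c1 \<union> path_image c2"
    using c1 c2 by (auto simp: c_def path_image_join)
  ultimately show "open (inside (path_image c1 \<union> path_image c2))"
    "connected (inside (path_image c1 \<union> path_image c2))"
    "bounded (inside (path_image c1 \<union> path_image c2))"
    "inside (path_image c1 \<union> path_image c2) \<noteq> {}"
    "frontier (inside (path_image c1 \<union> path_image c2)) = path_image c1 \<union> path_image c2"
    "connected (outside (path_image c1 \<union> path_image c2))"
    "\<not> bounded (outside (path_image c1 \<union> path_image c2))"
    "\<exists>c. simple_path c \<and> pathfinish c = pathstart c \<and> path_image c = path_image c1 \<union> path_image c2"
    using Jordan_inside_outside[of c] by auto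
qed

lemma theta_crosscut:
  fixes c1 c2 :: "real \<Rightarrow> complex"
  assumes c1: "arc c1" "pathstart c1 = x" "pathfinish c1 = y"
    and c2: "arc c2" "pathstart c2 = x" "pathfinish c2 = y"
    and meet: "path_image c1 \<inter> path_image c2 = {x, y}"
  obtains c where "arc c" "pathstart c = x" "pathfinish c = y"
    "path_image c1 \<inter> path_image c = {x, y}" "path_image c2 \<inter> path_image c = {x, y}"
    "path_image c \<subseteq> inside (path_image c1 \<union> path_image c2) \<union> {x, y}"
    "inside (path_image c1 \<union> path_image c) \<inter> inside (path_image c2 \<union> path_image c) = {}"
    "inside (path_image c1 \<union> path_image c) \<subseteq> inside (path_image c1 \<union> path_image c2)"
    "inside (path_image c2 \<union> path_image c) \<subseteq> inside (path_image c1 \<union> path_image c2)"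
proof -
  let ?J = "path_image c1 \<union> path_image c2"
  have xy: "x \<noteq> y" using arc_distinct_ends[OF c1(1)] c1 by auto
  obtain j where j: "simple_path j" "pathfinish j = pathstart j" "path_image j = ?J"
    using theta_inside(8)[OF assms] by blast
  have "x \<in> ?J" "y \<in> ?J" using meet by auto
  then obtain c where c: "arc c" "pathstart c = x" "pathfinish c = y" "path_image c \<subseteq> inside ?J \<union> {x, y}"
    using inside_crosscut[OF j(1,2)] xy unfolding j(3) by metis
  have m: "path_image c1 \<inter> path_image c = {x, y}" "path_image c2 \<inter> path_image c = {x, y}"
    using c(4) inside_no_overlap[of ?J] meet c(2,3) pathstart_in_path_image[of c] pathfinish_in_path_image[of c]
    by blast+
  \<comment> \<open>The splitting theorem for theta curves asks that the crosscut enter the inside;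
    its midpoint shows that it does.\<close>
  have "c (1/2) \<in> path_image c" by (auto simp: path_image_def)
  moreover have "c (1/2) \<noteq> x" "c (1/2) \<noteq> y"
    using c(1-3) inj_onD[of c "{0..1}" "1/2" 0] inj_onD[of c "{0..1}" "1/2" 1]
    by (auto simp: arc_def pathstart_def pathfinish_def)
  ultimately have ne: "path_image c \<inter> inside ?J \<noteq> {}" using c(4) by auto
  show thesis
    apply (rule split_inside_simple_closed_curve[OF arc_imp_simple_path[OF c1(1)] c1(2,3)
        arc_imp_simple_path[OF c2(1)] c2(2,3) arc_imp_simple_path[OF c(1)] c(2,3) xy meet m ne])
    apply (rule that[OF c(1-3) m c(4)])
    by auto
qed

subsection \<open>Dividing a face on the sphere\<close>

text \<open>Disjointness makes \<open>F\<close> equal to \<open>closure R - R\<close>, so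
  \<open>F\<close> is the frontier of \<open>R\<close> and is determined by it. No graph occurs, so
  cells can be moved by homeomorphisms and cut by curves that are not yet edges.\<close>

definition cell :: "(real ^ 3) set \<Rightarrow> (real ^ 3) set \<Rightarrow> bool" where
  "cell R F \<longleftrightarrow> R \<noteq> {} \<and> connected R \<and> openin (top_of_set (sphere 0 1)) R \<and> closure R = R \<union> F \<and> R \<inter> F = {}"

lemma punctured_sphere_plane:
  fixes b :: "real ^ 3"
  assumes "b \<in> sphere 0 1"
  obtains h g where "homeomorphism (sphere 0 1 - {b}) (UNIV :: complex set) h g"
proof -
  have "(sphere 0 1 - {b}) homeomorphic {x::real^3. axis 1 1 \<bullet> x = 0}"
    by (rule homeomorphic_punctured_sphere_hyperplane) (use assms in \<open>auto simp: axis_eq_0_iff\<close>)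
  also have "{x::real^3. axis 1 1 \<bullet> x = 0} homeomorphic (UNIV :: complex set)"
    by (rule homeomorphic_affine_sets) (auto simp: affine_hyperplane aff_dim_hyperplane axis_eq_0_iff)
  finally show thesis using that by (auto simp: homeomorphic_def)
qed

text \<open>Boundedness keeps the removed point \<open>b\<close> away from the image: the closure of
  \<open>A\<close> is compact, so its image is already closed in the sphere.\<close>

lemma cell_plane_image:
  fixes A :: "complex set"
  assumes hom: "homeomorphism (sphere 0 1 - {b}) (UNIV :: complex set) h g" and b: "b \<in> sphere 0 1"
    and A: "open A" "connected A" "bounded A" "A \<noteq> {}" "frontier A = F"
  shows "cell (g ` A) (g ` F)"
proof -
  have cg: "continuous_on S g" for S using hom continuous_on_subset by (auto simp: homeomorphism_def)
  have inj: "inj g" by (rule inj_on_inverseI[of _ h]) (use hom in \<open>auto simp: homeomorphism_def\<close>)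
  have op: "openin (top_of_set (sphere 0 1 - {b})) (g ` A)"
    by (rule homeomorphism_imp_open_map[OF homeomorphism_sym[THEN iffD1, OF hom]]) (use A in \<open>simp add: open_openin[symmetric]\<close>)
  have "openin (top_of_set (sphere 0 1)) (sphere 0 1 - {b})"
    by (simp add: openin_delete)
  with op have op: "openin (top_of_set (sphere 0 1)) (g ` A)" by (rule openin_trans)
  have "compact (g ` closure A)"
    by (rule compact_continuous_image[OF cg]) (use A in \<open>simp add: compact_closure\<close>)
  then have "closed (g ` closure A)" by (rule compact_imp_closed)
  then have 1: "closure (g ` A) \<subseteq> g ` closure A" by (intro closure_minimal image_mono closure_subset)
  have 2: "g ` closure A \<subseteq> closure (g ` A)"
    by (rule image_closure_subset[OF cg]) (auto simp: closure_subset)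
  have 3: "closure A = A \<union> F" "A \<inter> F = {}" using A(1,5) by (auto simp: frontier_def interior_open closure_subset[THEN subsetD])
  show ?thesis unfolding cell_def
  proof (intro conjI)
    show "closure (g ` A) = g ` A \<union> g ` F" using 1 2 unfolding 3(1) image_Un by blast
    show "g ` A \<inter> g ` F = {}" by (simp add: image_Int[OF inj, symmetric] 3(2))
  qed (use op A(4) connected_continuous_image[OF cg A(2)] in auto)
qed

text \<open>The planar statement is transported by removing a point \<open>b\<close> outside
  \<open>R\<close> and its boundary; the image of \<open>R\<close> in the plane then is the inside
  of the image curve.\<close>

lemma sphere_crosscut:
  assumes c1: "arc c1" "pathstart c1 = x" "pathfinish c1 = y" "path_image c1 \<subseteq> sphere 0 1"
    and c2: "arc c2" "pathstart c2 = x" "pathfinish c2 = y" "path_image c2 \<subseteq> sphere 0 1"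
    and meet: "path_image c1 \<inter> path_image c2 = {x, y}"
    and R: "cell R (path_image c1 \<union> path_image c2)"
  obtains c R1 R2 where "arc c" "pathstart c = x" "pathfinish c = y" "path_image c \<subseteq> R \<union> {x, y}"
    "path_image c1 \<inter> path_image c = {x, y}" "path_image c2 \<inter> path_image c = {x, y}"
    "cell R1 (path_image c1 \<union> path_image c)" "cell R2 (path_image c2 \<union> path_image c)"
    "R1 \<subseteq> R" "R2 \<subseteq> R" "R1 \<inter> R2 = {}"
proof -
  let ?F = "path_image c1 \<union> path_image c2"
  let ?S = "sphere 0 1 :: (real^3) set"
  have Rp: "R \<noteq> {}" "connected R" "openin (top_of_set ?S) R" "closure R = R \<union> ?F" "R \<inter> ?F = {}"
    using R by (auto simp: cell_def)
  have RS: "R \<subseteq> ?S" using Rp(3) openin_imp_subset by blast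
  have plane: "arc (h \<circ> ci)" "pathstart (h \<circ> ci) = h (pathstart ci)" "pathfinish (h \<circ> ci) = h (pathfinish ci)"
     "path_image (h \<circ> ci) = h ` path_image ci"
    if "homeomorphism (?S - {b}) (UNIV :: complex set) h g" "arc ci" "path_image ci \<subseteq> ?S - {b}" for b h g ci
  proof -
    have "continuous_on (path_image ci) h"
      by (rule continuous_on_subset[OF homeomorphism_cont1[OF that(1)] that(3)])
    moreover have "inj_on h (path_image ci)"
      by (rule inj_on_inverseI[of _ g]) (use homeomorphism_apply1[OF that(1)] that(3) in blast)
    ultimately show "arc (h \<circ> ci)" by (rule arc_continuous_image[OF that(2)])
    show "pathstart (h \<circ> ci) = h (pathstart ci)" "pathfinish (h \<circ> ci) = h (pathfinish ci)"
     "path_image (h \<circ> ci) = h ` path_image ci"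
      by (simp_all add: pathstart_compose pathfinish_compose path_image_compose)
  qed
  have loop: "path_image (h \<circ> c1) \<inter> path_image (h \<circ> c2) = {h x, h y}"
    if "homeomorphism (?S - {b}) (UNIV :: complex set) h g" "?F \<subseteq> ?S - {b}" for b h g
  proof -
    have "inj_on h (?S - {b})" by (rule inj_on_inverseI[of _ g]) (rule homeomorphism_apply1[OF that(1)])
    then have "h ` path_image c1 \<inter> h ` path_image c2 = h ` (path_image c1 \<inter> path_image c2)"
      using that(2) by (intro inj_on_image_Int[symmetric]) auto
    then show ?thesis unfolding path_image_compose meet by simp
  qed
  \<comment> \<open>Otherwise \<open>b\<close> is chosen in \<open>R\<close>. The inside of the
    planar curve then corresponds to a set that is open and closed in the connected \<open>R\<close>
    and yet misses \<open>b\<close>.\<close>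
  obtain b where b: "b \<in> ?S" "b \<notin> R \<union> ?F"
  proof (rule ccontr)
    assume "\<not> thesis"
    then have cov: "?S \<subseteq> R \<union> ?F" using that by blast
    obtain b where bR: "b \<in> R" using Rp(1) by auto
    have b: "b \<in> ?S" "?F \<subseteq> ?S - {b}" using bR RS Rp(5) c1(4) c2(4) by auto
    obtain h g where hom: "homeomorphism (?S - {b}) (UNIV :: complex set) h g"
      using punctured_sphere_plane[OF b(1)] by blast
    let ?c1 = "h \<circ> c1" and ?c2 = "h \<circ> c2"
    let ?I = "inside (path_image ?c1 \<union> path_image ?c2)"
    note th = theta_inside[OF plane(1)[OF hom c1(1)] _ _ plane(1)[OF hom c2(1)] _ _ loop[OF hom b(2)]]
    have cI: "cell (g ` ?I) (g ` (path_image ?c1 \<union> path_image ?c2))"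
      by (rule cell_plane_image[OF hom b(1)])
         (use th b(2) plane(2,3)[OF hom c1(1)] plane(2,3)[OF hom c2(1)] c1 c2 in auto)
    have "g ` (path_image ?c1 \<union> path_image ?c2) = (g \<circ> h) ` ?F" by (auto simp: path_image_def)
    also have "\<dots> = ?F" using b(2) homeomorphism_apply1[OF hom] by force
    finally have cI: "cell (g ` ?I) ?F" using cI by simp
    have gS: "g ` ?I \<subseteq> ?S - {b}" using homeomorphism_image2[OF hom] by blast
    have "g ` ?I \<inter> ?F = {}" using cI unfolding cell_def by blast
    then have "g ` ?I \<subseteq> R" using cov gS by blast
    have "closedin (top_of_set R) (g ` ?I)"
    proof -
      have "g ` ?I = R \<inter> closure (g ` ?I)" using cI \<open>g ` ?I \<subseteq> R\<close> Rp(5) by (auto simp: cell_def)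
      then show ?thesis by (metis closed_closure closedin_closed_Int)
    qed
    moreover have "openin (top_of_set R) (g ` ?I)"
      using cI \<open>g ` ?I \<subseteq> R\<close> RS openin_subset_trans unfolding cell_def by blast
    moreover have "g ` ?I \<noteq> {}" using cI by (simp add: cell_def)
    ultimately have "g ` ?I = R" using Rp(2) unfolding connected_clopen by blast
    then show False using bR gS by auto
  qed
  have bF: "?F \<subseteq> ?S - {b}" "R \<subseteq> ?S - {b}" using b c1(4) c2(4) RS by auto
  obtain h g where hom: "homeomorphism (?S - {b}) (UNIV :: complex set) h g"
    using punctured_sphere_plane[OF b(1)] by blast
  let ?c1 = "h \<circ> c1" and ?c2 = "h \<circ> c2"
  let ?J = "path_image ?c1 \<union> path_image ?c2"
  have gh: "g (h z) = z" if "z \<in> ?S - {b}" for z using homeomorphism_apply1[OF hom that] .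
  have hg: "h (g z) = z" for z using homeomorphism_apply2[OF hom] by simp
  have ghI: "g ` h ` X = X" if "X \<subseteq> ?S - {b}" for X using gh that by force
  have p1: "arc ?c1" "pathstart ?c1 = h x" "pathfinish ?c1 = h y" "path_image ?c1 = h ` path_image c1"
    and p2: "arc ?c2" "pathstart ?c2 = h x" "pathfinish ?c2 = h y" "path_image ?c2 = h ` path_image c2"
    using plane[OF hom c1(1)] plane[OF hom c2(1)] bF c1 c2 by auto
  note lp = loop[OF hom bF(1)]
  note th = theta_inside[OF p1(1-3) p2(1-3) lp]
  have JF: "?J = h ` ?F" using p1 p2 by auto
  let ?A = "h ` R"
  note ch = homeomorphism_cont1[OF hom]
  have injh: "inj_on h (?S - {b})" by (rule inj_on_inverseI[of _ g]) (rule gh)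
  have Aop: "open ?A"
  proof -
    have "openin (top_of_set (?S - {b})) R" by (rule openin_subset_trans[OF Rp(3) bF(2)]) auto
    then have "openin (top_of_set UNIV) ?A" by (rule homeomorphism_imp_open_map[OF hom])
    then show ?thesis by (simp add: open_openin[symmetric])
  qed
  have Acon: "connected ?A" by (rule connected_continuous_image[OF continuous_on_subset[OF ch bF(2)] Rp(2)])
  have clR: "closure R \<subseteq> ?S - {b}" using Rp(4) bF by auto
  have "bounded (closure R)" by (rule bounded_subset[OF bounded_sphere[of 0 1]]) (use clR in auto)
  then have "compact (closure R)" by (simp add: compact_eq_bounded_closed)
  then have comp: "compact (h ` closure R)"
    by (rule compact_continuous_image[OF continuous_on_subset[OF ch clR]])
  have clA: "closure ?A \<subseteq> ?A \<union> ?J"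
  proof -
    have "closure ?A \<subseteq> h ` closure R"
      by (rule closure_minimal[OF image_mono[OF closure_subset] compact_imp_closed[OF comp]])
    then show ?thesis unfolding Rp(4) image_Un JF by simp
  qed
  have Abd: "bounded ?A"
    by (rule bounded_subset[OF compact_imp_bounded[OF comp] image_mono[OF closure_subset]])
  have AJ: "?A \<inter> ?J = {}"
    unfolding JF inj_on_image_Int[OF injh bF(2,1), symmetric] Rp(5) by simp
  have frA: "frontier ?A \<subseteq> ?J" using clA unfolding frontier_def interior_open[OF Aop] by blast
  \<comment> \<open>The frontier of \<open>?A\<close> lies on the curve, so each side of the curve
    is contained in \<open>?A\<close> or disjoint from it. The unbounded side cannot be contained in
    \<open>?A\<close>; the other one must be, as \<open>?A\<close> is nonempty.\<close>
  have "?A \<inter> outside ?J = {}"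
  proof (rule ccontr)
    assume "?A \<inter> outside ?J \<noteq> {}"
    moreover have "outside ?J - ?A \<noteq> {}" using th(7) Abd bounded_subset by blast
    ultimately have "outside ?J \<inter> frontier ?A \<noteq> {}" using connected_Int_frontier[OF th(6), of ?A] by blast
    then show False using frA outside_no_overlap[of ?J] by blast
  qed
  then have AI: "?A \<subseteq> inside ?J" using AJ inside_Un_outside[of ?J] by blast
  have "?A = inside ?J"
  proof (rule ccontr)
    assume "?A \<noteq> inside ?J"
    then have "inside ?J - ?A \<noteq> {}" using AI by blast
    moreover have "inside ?J \<inter> ?A \<noteq> {}" using AI Rp(1) by blast
    ultimately have "inside ?J \<inter> frontier ?A \<noteq> {}" using connected_Int_frontier[OF th(2), of ?A] by blast
    then show False using frA inside_no_overlap[of ?J] by blast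
  qed
  obtain c where c: "arc c" "pathstart c = h x" "pathfinish c = h y"
    "path_image ?c1 \<inter> path_image c = {h x, h y}" "path_image ?c2 \<inter> path_image c = {h x, h y}"
    "path_image c \<subseteq> inside ?J \<union> {h x, h y}"
    "inside (path_image ?c1 \<union> path_image c) \<inter> inside (path_image ?c2 \<union> path_image c) = {}"
    "inside (path_image ?c1 \<union> path_image c) \<subseteq> inside ?J"
    "inside (path_image ?c2 \<union> path_image c) \<subseteq> inside ?J"
    using theta_crosscut[OF p1(1-3) p2(1-3) lp] by blast
  have injg: "inj g" by (rule inj_on_inverseI[of _ h]) (rule hg)
  have cg: "continuous_on X g" for X by (rule continuous_on_subset[OF homeomorphism_cont2[OF hom]]) simp
  have xyF: "x \<in> ?F" "y \<in> ?F" using meet by auto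
  have gxy: "g (h x) = x" "g (h y) = y" using xyF gh bF(1) by blast+
  have gc1: "g ` path_image ?c1 = path_image c1" and gc2: "g ` path_image ?c2 = path_image c2"
    using ghI bF(1) p1(4) p2(4) by auto
  have pgc: "path_image (g \<circ> c) = g ` path_image c" by (simp add: path_image_compose)
  have gI: "g ` inside ?J = R" using ghI[OF bF(2)] \<open>?A = inside ?J\<close> by simp
  show thesis
  proof (rule that[of "g \<circ> c" "g ` inside (path_image ?c1 \<union> path_image c)" "g ` inside (path_image ?c2 \<union> path_image c)"])
    show "arc (g \<circ> c)" by (rule arc_continuous_image[OF c(1) cg]) (use injg in \<open>auto intro: inj_on_subset\<close>)
    show "pathstart (g \<circ> c) = x" "pathfinish (g \<circ> c) = y"
      using c(2,3) gxy by (auto simp: pathstart_def pathfinish_def)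
    show "path_image (g \<circ> c) \<subseteq> R \<union> {x, y}" using c(6) gI gxy unfolding pgc by (auto 0 3)
    have "path_image c1 \<inter> path_image (g \<circ> c) = g ` (path_image ?c1 \<inter> path_image c)"
      unfolding pgc by (simp only: image_Int[OF injg] gc1)
    then show "path_image c1 \<inter> path_image (g \<circ> c) = {x, y}" using c(4) gxy by simp
    have "path_image c2 \<inter> path_image (g \<circ> c) = g ` (path_image ?c2 \<inter> path_image c)"
      unfolding pgc by (simp only: image_Int[OF injg] gc2)
    then show "path_image c2 \<inter> path_image (g \<circ> c) = {x, y}" using c(5) gxy by simp
    have "cell (g ` inside (path_image ?c1 \<union> path_image c)) (g ` (path_image ?c1 \<union> path_image c))"
      by (rule cell_plane_image[OF hom b(1)]) (use theta_inside[OF p1(1-3) c(1-4)] in auto)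
    then show "cell (g ` inside (path_image ?c1 \<union> path_image c)) (path_image c1 \<union> path_image (g \<circ> c))"
      by (simp only: image_Un gc1 pgc)
    have "cell (g ` inside (path_image ?c2 \<union> path_image c)) (g ` (path_image ?c2 \<union> path_image c))"
      by (rule cell_plane_image[OF hom b(1)]) (use theta_inside[OF p2(1-3) c(1-3,5)] in auto)
    then show "cell (g ` inside (path_image ?c2 \<union> path_image c)) (path_image c2 \<union> path_image (g \<circ> c))"
      by (simp only: image_Un gc2 pgc)
    show "g ` inside (path_image ?c1 \<union> path_image c) \<subseteq> R" "g ` inside (path_image ?c2 \<union> path_image c) \<subseteq> R"
      using c(8,9) gI by blast+
    show "g ` inside (path_image ?c1 \<union> path_image c) \<inter> g ` inside (path_image ?c2 \<union> path_image c) = {}"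
      by (simp only: image_Int[OF injg, symmetric] c(7) image_empty)
  qed
qed

section \<open>Arcs as point sets, and tripods in a cell\<close>

text \<open>\<open>sphere_embedding\<close> records an edge as a point set, so parametrisation and
  orientation are forgotten here.\<close>

definition arc_joining :: "'a::topological_space set \<Rightarrow> 'a \<Rightarrow> 'a \<Rightarrow> bool" where
  "arc_joining A x y \<longleftrightarrow> (\<exists>g. arc g \<and> pathstart g = x \<and> pathfinish g = y \<and> path_image g = A)"

lemma arc_joining_sym: "arc_joining A x y \<Longrightarrow> arc_joining A y x"
  unfolding arc_joining_def by (metis arc_reversepath path_image_reversepath pathfinish_reversepath pathstart_reversepath)

lemma arc_joining_ends: "arc_joining A x y \<Longrightarrow> x \<in> A \<and> y \<in> A \<and> x \<noteq> y"
  unfolding arc_joining_def by (metis arc_distinct_ends pathfinish_in_path_image pathstart_in_path_image)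

lemma arc_joining_Un:
  "arc_joining A x y \<Longrightarrow> arc_joining B y z \<Longrightarrow> A \<inter> B = {y} \<Longrightarrow> arc_joining (A \<union> B) x z"
  unfolding arc_joining_def
proof (elim exE conjE)
  fix g h assume gh: "arc g" "pathstart g = x" "pathfinish g = y" "path_image g = A"
    "arc h" "pathstart h = y" "pathfinish h = z" "path_image h = B" "A \<inter> B = {y}"
  then have "arc (g +++ h)" by (intro arc_join) auto
  with gh show "\<exists>g. arc g \<and> pathstart g = x \<and> pathfinish g = z \<and> path_image g = A \<union> B"
    by (intro exI[of _ "g +++ h"]) (auto simp: path_image_join)
qed

text \<open>The dividing point \<open>z\<close> of a crosscut will be the place of the new
  vertex.\<close>

lemma arc_joining_split:
  fixes x y :: "'a::real_normed_vector"
  assumes "arc_joining A x y"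
  obtains z A1 A2 where "arc_joining A1 x z" "arc_joining A2 z y" "A1 \<union> A2 = A" "A1 \<inter> A2 = {z}"
    "y \<notin> A1" "x \<notin> A2"
proof -
  obtain g where g: "arc g" "g 0 = x" "g 1 = y" "g ` {0..1} = A"
    using assms by (auto simp: arc_joining_def pathstart_def pathfinish_def path_image_def)
  have inj: "inj_on g {0..1}" using g(1) by (simp add: arc_def)
  have un: "{0..1} = {0..1/2} \<union> {1/2..1::real}" and int: "{0..1/2} \<inter> {1/2..1::real} = {1/2}" by auto
  show thesis
  proof (rule that[of "g ` {0..1/2}" "g (1/2)" "g ` {1/2..1}"])
    show "arc_joining (g ` {0..1/2}) x (g (1/2))" unfolding arc_joining_def
      by (rule exI[of _ "subpath 0 (1/2) g"]) (use g in \<open>auto intro!: arc_subpath_arc simp: path_image_subpath\<close>)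
    show "arc_joining (g ` {1/2..1}) (g (1/2)) y" unfolding arc_joining_def
      by (rule exI[of _ "subpath (1/2) 1 g"]) (use g in \<open>auto intro!: arc_subpath_arc simp: path_image_subpath\<close>)
    show "g ` {0..1/2} \<union> g ` {1/2..1} = A" using g(4) un by auto
    have "g ` {0..1/2} \<inter> g ` {1/2..1} = g ` ({0..1/2} \<inter> {1/2..1})"
      by (rule inj_on_image_Int[OF inj, symmetric]) auto
    then show "g ` {0..1/2} \<inter> g ` {1/2..1} = {g (1/2)}" unfolding int by simp
    show "y \<notin> g ` {0..1/2}" "x \<notin> g ` {1/2..1}"
      using g(2,3) inj by (auto dest: inj_onD)
  qed
qed

lemma sphere_crosscut':
  assumes c1: "arc_joining A1 x y" "A1 \<subseteq> sphere 0 1" and c2: "arc_joining A2 x y" "A2 \<subseteq> sphere 0 1"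
    and meet: "A1 \<inter> A2 = {x, y}" and R: "cell R (A1 \<union> A2)"
  obtains C R1 R2 where "arc_joining C x y" "C \<subseteq> R \<union> {x, y}" "A1 \<inter> C = {x, y}" "A2 \<inter> C = {x, y}"
    "cell R1 (A1 \<union> C)" "cell R2 (A2 \<union> C)" "R1 \<subseteq> R" "R2 \<subseteq> R" "R1 \<inter> R2 = {}"
proof -
  obtain c1 c2 where c1: "arc c1" "pathstart c1 = x" "pathfinish c1 = y" "path_image c1 = A1"
    and c2: "arc c2" "pathstart c2 = x" "pathfinish c2 = y" "path_image c2 = A2"
    using assms unfolding arc_joining_def by blast
  note a = assms(2,4)[folded c1(4) c2(4)]
  show thesis
    apply (rule sphere_crosscut[OF c1(1-3) a(1) c2(1-3) a(2)])
    unfolding c1(4) c2(4)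
      apply (fact meet)
     apply (fact R)
    subgoal for c R1 R2 by (rule that[of "path_image c" R1 R2]) (auto simp: arc_joining_def)
    done
qed

lemma cell_disjoint: "cell R F \<Longrightarrow> R \<inter> F = {}"
  by (simp add: cell_def)

text \<open>A crosscut from \<open>a\<close> to \<open>b\<close> separates the cell at the side
  \<open>Eab\<close>. A point \<open>D\<close> on it serves as the centre. The rest of the face is
  bounded by two arcs from \<open>D\<close> to \<open>c\<close>, one through \<open>a\<close> and
  one through \<open>b\<close>, and a second crosscut there is the third leg.\<close>

lemma tripod_in_cell:
  assumes arcs: "arc_joining Eab a b" "arc_joining Ebc b c" "arc_joining Eac a c"
    and sub: "Eab \<subseteq> sphere 0 1" "Ebc \<subseteq> sphere 0 1" "Eac \<subseteq> sphere 0 1"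
    and meet: "Eab \<inter> Ebc = {b}" "Eab \<inter> Eac = {a}" "Eac \<inter> Ebc = {c}"
    and R: "cell R (Eab \<union> Ebc \<union> Eac)"
  obtains D Aa Ab Ac Rab Rbc Rac where "D \<in> R"
    "arc_joining Aa D a" "arc_joining Ab D b" "arc_joining Ac D c"
    "Aa \<subseteq> R \<union> {a}" "Ab \<subseteq> R \<union> {b}" "Ac \<subseteq> R \<union> {c}"
    "Aa \<inter> Ab = {D}" "Aa \<inter> Ac = {D}" "Ab \<inter> Ac = {D}"
    "cell Rab (Eab \<union> Aa \<union> Ab)" "cell Rbc (Ebc \<union> Ab \<union> Ac)" "cell Rac (Eac \<union> Aa \<union> Ac)"
    "Rab \<subseteq> R" "Rbc \<subseteq> R" "Rac \<subseteq> R"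
    "Rab \<inter> (Aa \<union> Ab \<union> Ac) = {}" "Rbc \<inter> (Aa \<union> Ab \<union> Ac) = {}" "Rac \<inter> (Aa \<union> Ab \<union> Ac) = {}"
proof -
  have RS: "R \<subseteq> sphere 0 1" using R openin_imp_subset unfolding cell_def by blast
  have ne: "a \<noteq> b" "b \<noteq> c" "a \<noteq> c" and mem: "a \<in> Eab" "b \<in> Eab" "b \<in> Ebc" "c \<in> Ebc" "a \<in> Eac" "c \<in> Eac"
    using arcs[THEN arc_joining_ends] by auto
  have nmem: "a \<notin> Ebc" "b \<notin> Eac" "c \<notin> Eab" using ne mem meet by auto
  have RE: "R \<inter> Eab = {}" "R \<inter> Ebc = {}" "R \<inter> Eac = {}" using cell_disjoint[OF R] by auto
  have "arc_joining (Eac \<union> Ebc) a b"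
    by (rule arc_joining_Un[OF arcs(3) arc_joining_sym[OF arcs(2)] meet(3)])
  moreover have "Eac \<union> Ebc \<subseteq> sphere 0 1" using sub by auto
  moreover have "Eab \<inter> (Eac \<union> Ebc) = {a, b}" using meet by auto
  moreover have "cell R (Eab \<union> (Eac \<union> Ebc))" using R by (simp add: Un_ac)
  ultimately obtain C R1 R2 where C: "arc_joining C a b" "C \<subseteq> R \<union> {a, b}" "Eab \<inter> C = {a, b}"
    "(Eac \<union> Ebc) \<inter> C = {a, b}" "cell R1 (Eab \<union> C)" "cell R2 ((Eac \<union> Ebc) \<union> C)" "R1 \<subseteq> R" "R2 \<subseteq> R" "R1 \<inter> R2 = {}"
    by (rule sphere_crosscut'[OF arcs(1) sub(1)])
  obtain D A B where D: "arc_joining A a D" "arc_joining B D b" "A \<union> B = C" "A \<inter> B = {D}" "b \<notin> A" "a \<notin> B"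
    by (rule arc_joining_split[OF C(1)])
  have DA: "D \<in> A" "D \<in> B" "a \<in> A" "b \<in> B" using D(1,2)[THEN arc_joining_ends] by auto
  have DR: "D \<in> R" using DA C(2) D(3,5,6) by auto
  have cC: "c \<notin> C" using C(2) ne mem RE by blast
  have x1: "arc_joining (A \<union> Eac) D c"
    by (rule arc_joining_Un[OF arc_joining_sym[OF D(1)] arcs(3)]) (use C(4) D(3,5) DA mem in blast)
  have x2: "arc_joining (B \<union> Ebc) D c"
    by (rule arc_joining_Un[OF D(2) arcs(2)]) (use C(4) D(3,6) DA mem in auto)
  have x3: "A \<union> Eac \<subseteq> sphere 0 1" "B \<union> Ebc \<subseteq> sphere 0 1" using sub C(2) D(3) RS mem by auto
  have x4: "(A \<union> Eac) \<inter> (B \<union> Ebc) = {D, c}"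
  proof -
    have "A \<inter> Ebc = {}" "Eac \<inter> B = {}" using C(4) D(3,5,6) nmem by auto
    then show ?thesis using D(4) meet(3) by blast
  qed
  have x5: "cell R2 ((A \<union> Eac) \<union> (B \<union> Ebc))" using C(6) unfolding D(3)[symmetric] by (simp add: Un_ac)
  obtain E R3 R4 where E: "arc_joining E D c" "E \<subseteq> R2 \<union> {D, c}" "(A \<union> Eac) \<inter> E = {D, c}"
    "(B \<union> Ebc) \<inter> E = {D, c}" "cell R3 ((A \<union> Eac) \<union> E)" "cell R4 ((B \<union> Ebc) \<union> E)" "R3 \<subseteq> R2" "R4 \<subseteq> R2" "R3 \<inter> R4 = {}"
    by (rule sphere_crosscut'[OF x1 x3(1) x2 x3(2) x4 x5])
  have DE: "D \<in> E" "c \<in> E" using E(1)[THEN arc_joining_ends] by auto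
  note dis = cell_disjoint[OF C(5)] cell_disjoint[OF C(6)] cell_disjoint[OF E(5)] cell_disjoint[OF E(6)]
  show thesis
  proof (rule that[of D A B E R1 R4 R3])
    show "A \<subseteq> R \<union> {a}" "B \<subseteq> R \<union> {b}" using C(2) D(3,5,6) by auto
    show "E \<subseteq> R \<union> {c}" using E(2) C(8) DR by auto
    show "A \<inter> E = {D}" "B \<inter> E = {D}" using E(3,4) cC D(3) DA DE by auto
    show "cell R1 (Eab \<union> A \<union> B)" using C(5) unfolding D(3)[symmetric] by (simp add: Un_ac)
    show "cell R4 (Ebc \<union> B \<union> E)" using E(6) by (simp add: Un_ac)
    show "cell R3 (Eac \<union> A \<union> E)" using E(5) by (simp add: Un_ac)
    have "c \<notin> R" using RE mem by blast
    then show "R1 \<inter> (A \<union> B \<union> E) = {}" using dis(1) E(2) C(7,9) D(3) DA by blast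
    show "R4 \<inter> (A \<union> B \<union> E) = {}" "R3 \<inter> (A \<union> B \<union> E) = {}" using dis(2-4) E(7,8) D(3) by blast+
    show "D \<in> R" by (fact DR)
    show "arc_joining A D a" by (rule arc_joining_sym[OF D(1)])
    show "arc_joining B D b" "arc_joining E D c" "A \<inter> B = {D}" by (fact D(2) E(1) D(4))+
    show "R1 \<subseteq> R" "R4 \<subseteq> R" "R3 \<subseteq> R" using C(7,8) E(7,8) by blast+
  qed
qed

section \<open>Faces of a drawing described by cells\<close>

text \<open>The closure of \<open>R\<close> adds only points of \<open>F\<close>, which lies in
  \<open>K\<close>. So \<open>R\<close> is open and closed in every connected subset of the sphere
  that contains it and avoids \<open>K\<close>.\<close>

lemma cell_imp_component:
  assumes "cell R F" "R \<inter> K = {}" "F \<subseteq> K"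
  shows "R \<in> components (sphere 0 1 - K)"
proof -
  have R: "R \<noteq> {}" "connected R" "openin (top_of_set (sphere 0 1)) R" "closure R = R \<union> F"
    using assms(1) by (auto simp: cell_def)
  show ?thesis unfolding in_components_maximal
  proof (intro conjI allI impI)
    show "R \<noteq> {}" "connected R" by fact+
    have RS: "R \<subseteq> sphere 0 1" using R(3) openin_imp_subset by blast
    then show "R \<subseteq> sphere 0 1 - K" using assms(2) by auto
    fix C :: "(real^3) set" assume "C \<noteq> {} \<and> R \<subseteq> C \<and> C \<subseteq> sphere 0 1 - K \<and> connected C"
    then have C: "R \<subseteq> C" "C \<subseteq> sphere 0 1" "C \<inter> K = {}" "connected C" by auto
    have "openin (top_of_set C) R" by (rule openin_subset_trans[OF R(3) C(1,2)])
    moreover have "closedin (top_of_set C) R"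
    proof -
      have "R = C \<inter> closure R" unfolding R(4) using C(1,3) assms(3) by blast
      then show ?thesis by (metis closed_closure closedin_closed_Int)
    qed
    ultimately show "C = R" using C(4) R(1) unfolding connected_clopen by metis
  qed
qed

lemma frontier_of_sphere_openin:
  fixes R :: "(real ^ 3) set"
  assumes "openin (top_of_set (sphere 0 1)) R"
  shows "top_of_set (sphere 0 1) frontier_of R = closure R - R"
proof -
  have RS: "R \<subseteq> sphere 0 1" using assms openin_imp_subset by blast
  then have "closure R \<subseteq> sphere 0 1" by (rule closure_minimal) simp
  then show ?thesis
    using RS unfolding frontier_of_openin[OF assms] closure_of_subtopology by (simp add: Int_absorb1)
qed

definition sides :: "'a set \<Rightarrow> 'a set set" where
  "sides T = {e. e \<subseteq> T \<and> card e = 2}"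

lemma sides_triple:
  assumes "a \<noteq> b" "b \<noteq> c" "a \<noteq> c"
  shows "sides {a, b, c} = {{a, b}, {b, c}, {a, c}}"
proof -
  have "e \<in> {{a, b}, {b, c}, {a, c}}" if "e \<subseteq> {a, b, c}" "card e = 2" for e
    using that by (auto simp: card_2_iff)
  then show ?thesis using assms by (auto simp: sides_def)
qed

definition drawing :: "'a sgraph \<Rightarrow> ('a \<Rightarrow> real ^ 3) \<Rightarrow> ('a set \<Rightarrow> (real ^ 3) set) \<Rightarrow> (real ^ 3) set" where
  "drawing G p \<gamma> = p ` verts G \<union> \<Union> (\<gamma> ` edges G)"

lemma simple_graph_edge:
  assumes "simple_graph G" "e \<in> edges G"
  obtains u v where "e = {u, v}" "u \<noteq> v" "u \<in> verts G" "v \<in> verts G"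
proof -
  have "e \<subseteq> verts G" "card e = 2" using assms by (auto simp: simple_graph_def)
  then obtain u v where "e = {u, v}" "u \<noteq> v" by (auto simp: card_2_iff)
  then show thesis using that \<open>e \<subseteq> verts G\<close> by auto
qed

lemma simple_graph_finite_edges: "simple_graph G \<Longrightarrow> finite (edges G)"
  by (rule finite_subset[of _ "Pow (verts G)"]) (auto simp: simple_graph_def)

lemma sphere_embedding_arc:
  assumes "sphere_embedding G p \<gamma>" "{u, v} \<in> edges G"
  shows "arc_joining (\<gamma> {u, v}) (p u) (p v)" "\<gamma> {u, v} \<subseteq> sphere 0 1"
proof -
  obtain g where "arc g" "pathstart g = p u" "pathfinish g = p v" "path_image g = \<gamma> {u, v}" "path_image g \<subseteq> sphere 0 1"
    using assms unfolding sphere_embedding_def by meson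
  then show "arc_joining (\<gamma> {u, v}) (p u) (p v)" "\<gamma> {u, v} \<subseteq> sphere 0 1"
    unfolding arc_joining_def by auto
qed

lemma sphere_embedding_vertex:
  assumes "sphere_embedding G p \<gamma>" "e \<in> edges G" "v \<in> verts G" "p v \<in> \<gamma> e"
  shows "v \<in> e"
proof -
  have "\<forall>e\<in>edges G. \<forall>v\<in>verts G. p v \<in> \<gamma> e \<longrightarrow> v \<in> e"
    using assms(1) unfolding sphere_embedding_def by (elim conjE)
  then show ?thesis using assms(2-4) by simp
qed

lemma sphere_embedding_meet:
  assumes "sphere_embedding G p \<gamma>" "e \<in> edges G" "f \<in> edges G" "e \<noteq> f"
  shows "\<gamma> e \<inter> \<gamma> f \<subseteq> p ` (e \<inter> f)"
proof -
  have "\<forall>e\<in>edges G. \<forall>f\<in>edges G. e \<noteq> f \<longrightarrow> \<gamma> e \<inter> \<gamma> f \<subseteq> p ` (e \<inter> f)"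
    using assms(1) unfolding sphere_embedding_def by (elim conjE)
  then show ?thesis using assms(2-4) by simp
qed

lemma drawing_closed:
  assumes G: "simple_graph G" and emb: "sphere_embedding G p \<gamma>"
  shows "closed (drawing G p \<gamma>)" "drawing G p \<gamma> \<subseteq> sphere 0 1"
proof -
  have "closed (\<gamma> e) \<and> \<gamma> e \<subseteq> sphere 0 1" if "e \<in> edges G" for e
  proof -
    obtain u v where "e = {u, v}" using simple_graph_edge[OF G \<open>e \<in> edges G\<close>] by blast
    then show ?thesis
      using sphere_embedding_arc[OF emb] that unfolding arc_joining_def by (metis closed_arc_image)
  qed
  moreover have "finite (verts G)" using G by (simp add: simple_graph_def)
  moreover have "p ` verts G \<subseteq> sphere 0 1" using emb by (simp add: sphere_embedding_def)
  ultimately show "closed (drawing G p \<gamma>)" "drawing G p \<gamma> \<subseteq> sphere 0 1"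
    unfolding drawing_def using simple_graph_finite_edges[OF G]
    by (auto intro!: closed_Un closed_Union finite_imp_closed[OF finite_imageI])
qed

text \<open>Components of the complement of the drawing are open because the sphere is locally
  connected. Once a face is described by a cell, an extension of the drawing can destroy it only by
  entering \<open>R\<close>.\<close>

lemma triangular_face_iff_cell:
  assumes G: "simple_graph G" and emb: "sphere_embedding G p \<gamma>"
  shows "triangular_face G p \<gamma> T \<longleftrightarrow>
    T \<subseteq> verts G \<and> card T = 3 \<and> sides T \<subseteq> edges G \<and>
    (\<exists>R. cell R (\<Union> (\<gamma> ` sides T)) \<and> R \<inter> drawing G p \<gamma> = {})"
proof -
  let ?K = "drawing G p \<gamma>"
  note K = drawing_closed[OF assms]
  have opK: "openin (top_of_set (sphere 0 1)) (sphere 0 1 - ?K)"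
    using openin_open_Int[of "- ?K" "sphere 0 1"] K(1) by (simp add: Diff_eq open_Compl)
  have 1: "cell R F" "R \<inter> ?K = {}" if "R \<in> components (sphere 0 1 - ?K)" "top_of_set (sphere 0 1) frontier_of R = F" for R F
  proof -
    have "openin (top_of_set (sphere 0 1 - ?K)) R"
      by (rule openin_components_locally_connected[OF _ that(1)])
        (rule locally_open_subset[OF locally_connected_sphere opK])
    then have op: "openin (top_of_set (sphere 0 1)) R"
      using opK by (rule openin_trans)
    have "F = closure R - R" using frontier_of_sphere_openin[OF op] that(2) by simp
    moreover have "R \<subseteq> closure R" by (rule closure_subset)
    moreover have "R \<noteq> {}" "connected R" using that(1) by (auto simp: in_components_nonempty in_components_connected)
    ultimately show "cell R F" unfolding cell_def using op by auto
    show "R \<inter> ?K = {}" using in_components_subset[OF that(1)] by auto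
  qed
  have 2: "R \<in> components (sphere 0 1 - ?K) \<and> top_of_set (sphere 0 1) frontier_of R = F"
    if "cell R F" "R \<inter> ?K = {}" "F \<subseteq> ?K" for R F
    using cell_imp_component[OF that] frontier_of_sphere_openin[of R] that(1) by (auto simp: cell_def)
  have 3: "\<Union> (\<gamma> ` sides T) \<subseteq> ?K" if "sides T \<subseteq> edges G" using that by (auto simp: drawing_def)
  show ?thesis
    unfolding triangular_face_def regions_def sides_def[symmetric] drawing_def[symmetric]
  proof (intro iffI; elim conjE bexE exE; intro conjI; assumption?)
    fix R assume "R \<in> components (sphere 0 1 - ?K)" "top_of_set (sphere 0 1) frontier_of R = \<Union> (\<gamma> ` sides T)"
    note 1[OF this]
    then show "\<exists>R. cell R (\<Union> (\<gamma> ` sides T)) \<and> R \<inter> ?K = {}" by auto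
  next
    fix R assume "cell R (\<Union> (\<gamma> ` sides T))" "R \<inter> ?K = {}" "sides T \<subseteq> edges G"
    then show "\<exists>R\<in>components (sphere 0 1 - ?K). top_of_set (sphere 0 1) frontier_of R = \<Union> (\<gamma> ` sides T)"
      using 2 3 by meson
  qed
qed

lemma cell_boundary_unique: "cell R F \<Longrightarrow> cell R F' \<Longrightarrow> F = F'"
  unfolding cell_def by blast

lemma simple_graph_split_triangle:
  assumes "simple_graph G" "{a, b, c} \<subseteq> verts G" "d \<notin> verts G"
  shows "simple_graph (split_triangle G a b c d)"
proof -
  have "d \<noteq> a" "d \<noteq> b" "d \<noteq> c" using assms(2,3) by auto
  then show ?thesis using assms by (auto simp: simple_graph_def split_triangle_def)
qed

text \<open>A drawn boundary determines its triangle. Hence distinct triangular faces have distinct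
  boundaries and therefore distinct cells.\<close>

lemma vertex_on_sides:
  assumes G: "simple_graph G" and emb: "sphere_embedding G p \<gamma>"
    and T: "T \<subseteq> verts G" "card T = 3" "sides T \<subseteq> edges G"
  shows "T = {v \<in> verts G. p v \<in> \<Union> (\<gamma> ` sides T)}"
proof (intro set_eqI iffI)
  obtain a b c where abc: "T = {a, b, c}" "a \<noteq> b" "b \<noteq> c" "a \<noteq> c" using T(2) by (auto simp: card_3_iff)
  have e: "{a, b} \<in> edges G" "{b, c} \<in> edges G" using T(3) abc by (auto simp: sides_triple)
  have "p a \<in> \<gamma> {a, b}" "p b \<in> \<gamma> {a, b}" "p c \<in> \<gamma> {b, c}"
    using sphere_embedding_arc(1)[OF emb, THEN arc_joining_ends] e by blast+
  then show "v \<in> {v \<in> verts G. p v \<in> \<Union> (\<gamma> ` sides T)}" if "v \<in> T" for v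
    using that abc T(1) by (auto simp: sides_triple)
  fix v assume v: "v \<in> {v \<in> verts G. p v \<in> \<Union> (\<gamma> ` sides T)}"
  then obtain e where e: "e \<in> sides T" "p v \<in> \<gamma> e" by auto
  then have "v \<in> e" using sphere_embedding_vertex[OF emb _ _ e(2)] v T(3) by auto
  then show "v \<in> T" using e(1) by (auto simp: sides_def)
qed

text \<open>The drawing is kept, and a tripod is added inside one cell. The whole family
  \<open>\<F>\<close> is treated at once because property Q asks for one embedding with all its
  triangles as faces.\<close>

lemma split_face_embedding:
  assumes G: "simple_graph G" and emb: "sphere_embedding G p \<gamma>"
    and F: "\<And>T. T \<in> \<F> \<Longrightarrow> triangular_face G p \<gamma> T"
    and T: "{a, b, c} \<in> \<F>" and d: "d \<notin> verts G"
  obtains p' \<gamma>' where "sphere_embedding (split_triangle G a b c d) p' \<gamma>'"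
    "\<And>T. T \<in> \<F> - {{a, b, c}} \<union> {{a, b, d}, {b, c, d}, {a, c, d}} \<Longrightarrow>
       triangular_face (split_triangle G a b c d) p' \<gamma>' T"
proof -
  let ?K = "drawing G p \<gamma>"
  note iff = triangular_face_iff_cell[OF G emb]
  have tf: "{a, b, c} \<subseteq> verts G" "card {a, b, c} = 3" "sides {a, b, c} \<subseteq> edges G"
    using F[OF T] unfolding iff by auto
  then have ne: "a \<noteq> b" "b \<noteq> c" "a \<noteq> c" by (auto simp: card_insert_if split: if_splits)
  have eds: "{a, b} \<in> edges G" "{b, c} \<in> edges G" "{a, c} \<in> edges G"
    using tf(3) ne by (auto simp: sides_triple)
  have ver: "a \<in> verts G" "b \<in> verts G" "c \<in> verts G" using tf(1) by auto
  then have dne: "d \<noteq> a" "d \<noteq> b" "d \<noteq> c" using d by auto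
  have S: "\<Union> (\<gamma> ` sides {a, b, c}) = \<gamma> {a, b} \<union> \<gamma> {b, c} \<union> \<gamma> {a, c}" using ne by (auto simp: sides_triple)
  obtain R where R: "cell R (\<gamma> {a, b} \<union> \<gamma> {b, c} \<union> \<gamma> {a, c})" "R \<inter> ?K = {}"
    using F[OF T] unfolding iff S by auto
  note arcs = sphere_embedding_arc[OF emb eds(1)] sphere_embedding_arc[OF emb eds(2)] sphere_embedding_arc[OF emb eds(3)]
  note ends = arcs(1,3,5)[THEN arc_joining_ends]
  note E4 = sphere_embedding_vertex[OF emb] and E5 = sphere_embedding_meet[OF emb]
  have inj: "inj_on p (verts G)" and pS: "p ` verts G \<subseteq> sphere 0 1"
    using emb by (simp_all add: sphere_embedding_def)
  have m1: "\<gamma> {a, b} \<inter> \<gamma> {b, c} = {p b}" using E5[OF eds(1,2)] ends ne by (auto simp: doubleton_eq_iff)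
  have m2: "\<gamma> {a, b} \<inter> \<gamma> {a, c} = {p a}" using E5[OF eds(1,3)] ends ne by (auto simp: doubleton_eq_iff)
  have m3: "\<gamma> {a, c} \<inter> \<gamma> {b, c} = {p c}" using E5[OF eds(3,2)] ends ne by (auto simp: doubleton_eq_iff)
  obtain D Aa Ab Ac Rab Rbc Rac where D: "D \<in> R"
    and A: "arc_joining Aa D (p a)" "arc_joining Ab D (p b)" "arc_joining Ac D (p c)"
    and AR: "Aa \<subseteq> R \<union> {p a}" "Ab \<subseteq> R \<union> {p b}" "Ac \<subseteq> R \<union> {p c}"
    and AA: "Aa \<inter> Ab = {D}" "Aa \<inter> Ac = {D}" "Ab \<inter> Ac = {D}"
    and cells: "cell Rab (\<gamma> {a, b} \<union> Aa \<union> Ab)" "cell Rbc (\<gamma> {b, c} \<union> Ab \<union> Ac)" "cell Rac (\<gamma> {a, c} \<union> Aa \<union> Ac)"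
    and RR: "Rab \<subseteq> R" "Rbc \<subseteq> R" "Rac \<subseteq> R"
    and RA: "Rab \<inter> (Aa \<union> Ab \<union> Ac) = {}" "Rbc \<inter> (Aa \<union> Ab \<union> Ac) = {}" "Rac \<inter> (Aa \<union> Ab \<union> Ac) = {}"
    by (rule tripod_in_cell[OF arcs(1,3,5,2,4,6) m1 m2 m3 R(1)])
  define G' where "G' = split_triangle G a b c d"
  define p' where "p' = p(d := D)"
  define \<gamma>' where "\<gamma>' = \<gamma>({d, a} := Aa, {d, b} := Ab, {d, c} := Ac)"
  have G'v: "verts G' = insert d (verts G)" and G'e: "edges G' = edges G \<union> {{d, a}, {d, b}, {d, c}}"
    by (auto simp: G'_def split_triangle_def)
  have p'd: "p' d = D" and p'o: "p' v = p v" if "v \<in> verts G" for v using that d by (auto simp: p'_def)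
  then have p'd: "p' d = D" by (simp add: p'_def)
  have old: "d \<notin> e" if "e \<in> edges G" for e using that G d by (auto simp: simple_graph_def)
  have gn: "\<gamma>' {d, a} = Aa" "\<gamma>' {d, b} = Ab" "\<gamma>' {d, c} = Ac"
    using ne dne by (auto simp: \<gamma>'_def doubleton_eq_iff)
  have go: "\<gamma>' e = \<gamma> e" if "e \<in> edges G" for e
  proof -
    have "e \<noteq> {d, a}" "e \<noteq> {d, b}" "e \<noteq> {d, c}" using old[OF that] by auto
    then show ?thesis by (simp add: \<gamma>'_def)
  qed
  define A where "A x = \<gamma>' {d, x}" for x
  have Aj: "arc_joining (A x) D (p x)" and AxR: "A x \<subseteq> R \<union> {p x}" if "x \<in> {a, b, c}" for x
    using that A AR gn by (auto simp: A_def)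
  have AxA: "A x \<inter> A y = {D}" if "x \<in> {a, b, c}" "y \<in> {a, b, c}" "x \<noteq> y" for x y
    using that AA gn by (auto simp: A_def)
  have pK: "p v \<in> ?K" if "v \<in> verts G" for v using that by (auto simp: drawing_def)
  have gK: "\<gamma> e \<subseteq> ?K" if "e \<in> edges G" for e using that by (auto simp: drawing_def)
  have RS: "R \<subseteq> sphere 0 1" using R(1) openin_imp_subset unfolding cell_def by blast
  have DK: "D \<notin> ?K" using D R(2) by auto
  have new: "\<exists>x\<in>{a, b, c}. e = {d, x} \<and> \<gamma>' e = A x" if "e \<in> edges G'" "e \<notin> edges G" for e
    using that by (auto simp: G'e A_def)
  have Ap: "v = x" if "x \<in> {a, b, c}" "v \<in> verts G" "p v \<in> A x" for x v
  proof -
    have "p v = p x" using AxR[OF that(1)] that(3) pK[OF that(2)] R(2) by blast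
    moreover have "x \<in> verts G" using that(1) ver by auto
    ultimately show ?thesis using inj that(2) by (meson inj_onD)
  qed
  have emb': "sphere_embedding G' p' \<gamma>'"
    unfolding sphere_embedding_def
  proof (intro conjI allI impI ballI)
    have "D \<notin> p ` verts G" using DK pK by auto
    then show "inj_on p' (verts G')" using inj d unfolding G'v p'_def
      by (auto simp: inj_on_def)
    show "p' ` verts G' \<subseteq> sphere 0 1" using pS D RS d unfolding G'v p'_def by auto
  next
    fix u v assume uv: "{u, v} \<in> edges G'"
    have "arc_joining (\<gamma>' {u, v}) (p' u) (p' v) \<and> \<gamma>' {u, v} \<subseteq> sphere 0 1"
    proof (cases "{u, v} \<in> edges G")
      case True
      then have "u \<in> verts G" "v \<in> verts G" using G by (auto simp: simple_graph_def)
      then show ?thesis using sphere_embedding_arc[OF emb True] go[OF True] p'o by auto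
    next
      case False
      then obtain x where x: "x \<in> {a, b, c}" "{u, v} = {d, x}" "\<gamma>' {u, v} = A x" using new uv by blast
      have "x \<in> verts G" using x(1) ver by auto
      have "u = d \<and> v = x \<or> u = x \<and> v = d" using x(2) by (auto simp: doubleton_eq_iff)
      moreover have "arc_joining (A x) (p' d) (p' x)" using Aj[OF x(1)] p'd p'o[OF \<open>x \<in> verts G\<close>] by simp
      moreover have "A x \<subseteq> sphere 0 1" using AxR[OF x(1)] RS pS \<open>x \<in> verts G\<close> by auto
      ultimately show ?thesis using x(3) arc_joining_sym by auto
    qed
    then show "\<exists>g. arc g \<and> pathstart g = p' u \<and> pathfinish g = p' v \<and> path_image g = \<gamma>' {u, v} \<and> path_image g \<subseteq> sphere 0 1"
      unfolding arc_joining_def by auto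
  next
    fix e v assume ev: "e \<in> edges G'" "v \<in> verts G'" "p' v \<in> \<gamma>' e"
    show "v \<in> e"
    proof (cases "e \<in> edges G")
      case True
      then have "v \<noteq> d" using ev(3) gK[OF True] DK go[OF True] p'd by auto
      then have "v \<in> verts G" using ev(2) G'v by auto
      then show ?thesis using E4[OF True] ev(3) go[OF True] p'o by auto
    next
      case False
      then obtain x where x: "x \<in> {a, b, c}" "e = {d, x}" "\<gamma>' e = A x" using new ev(1) by blast
      show ?thesis
      proof (cases "v = d")
        case False
        then have "v \<in> verts G" using ev(2) G'v by auto
        then show ?thesis using Ap[OF x(1)] ev(3) x(2,3) p'o by auto
      qed (use x in auto)
    qed
  next
    fix e f assume ef: "e \<in> edges G'" "f \<in> edges G'" "e \<noteq> f"
    \<comment> \<open>A leg leaves \<open>R\<close> only at its end \<open>p x\<close>, and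
      \<open>R\<close> misses the old drawing; so an old edge can meet a leg only in that
      vertex.\<close>
    have mixed: "\<gamma>' e \<inter> \<gamma>' f \<subseteq> p' ` (e \<inter> f)" if ef: "e \<in> edges G" "f \<in> edges G'" "f \<notin> edges G" for e f
    proof -
      obtain x where x: "x \<in> {a, b, c}" "f = {d, x}" "\<gamma>' f = A x" using new ef by blast
      have xv: "x \<in> verts G" using x(1) ver by auto
      have "\<gamma> e \<inter> A x \<subseteq> {p x}" using gK[OF ef(1)] AxR[OF x(1)] R(2) by blast
      moreover have "x \<in> e" if "p x \<in> \<gamma> e" using E4[OF ef(1) xv that] .
      moreover have "\<gamma>' e \<inter> \<gamma>' f = \<gamma> e \<inter> A x" using go[OF ef(1)] x(3) by simp
      moreover have "p x \<in> p' ` (e \<inter> f)" if "x \<in> e"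
        using that x(2) p'o[OF xv] by (intro image_eqI[of _ _ x]) auto
      ultimately show ?thesis by blast
    qed
    show "\<gamma>' e \<inter> \<gamma>' f \<subseteq> p' ` (e \<inter> f)"
    proof (cases "e \<in> edges G"; cases "f \<in> edges G")
      assume ee: "e \<in> edges G" "f \<in> edges G"
      then have "e \<inter> f \<subseteq> verts G" using G by (auto simp: simple_graph_def)
      then have "p' ` (e \<inter> f) = p ` (e \<inter> f)" using p'o by (intro image_cong) auto
      then show ?thesis using E5[OF ee ef(3)] go ee by simp
    next
      assume "e \<notin> edges G" "f \<notin> edges G"
      then obtain x y where xy: "x \<in> {a, b, c}" "e = {d, x}" "\<gamma>' e = A x" "y \<in> {a, b, c}" "f = {d, y}" "\<gamma>' f = A y"
        using new ef by meson
      then have "x \<noteq> y" using ef(3) by auto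
      then show ?thesis using AxA[OF xy(1,4)] xy p'd by auto
    next
      assume "e \<in> edges G" "f \<notin> edges G"
      then show ?thesis using mixed ef by blast
    next
      assume "e \<notin> edges G" "f \<in> edges G"
      then show ?thesis using mixed[of f e] ef by (simp add: Int_commute)
    qed
  qed
  have G': "simple_graph G'" unfolding G'_def by (rule simple_graph_split_triangle[OF G tf(1) d])
  note iff' = triangular_face_iff_cell[OF G' emb']
  have K': "drawing G' p' \<gamma>' \<subseteq> ?K \<union> Aa \<union> Ab \<union> Ac"
  proof -
    have "p' ` verts G' = insert D (p ` verts G)" unfolding G'v using p'd p'o by auto
    moreover have "D \<in> Aa" using A(1)[THEN arc_joining_ends] by auto
    ultimately show ?thesis unfolding drawing_def G'e using gn go by auto
  qed
  have newface: "triangular_face G' p' \<gamma>' {x, y, d}"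
    if xy: "x \<in> {a, b, c}" "y \<in> {a, b, c}" "x \<noteq> y" "{x, y} \<in> edges G"
      "cell Q (\<gamma> {x, y} \<union> A x \<union> A y)" "Q \<subseteq> R" "Q \<inter> (Aa \<union> Ab \<union> Ac) = {}" for x y Q
  proof -
    have v: "x \<in> verts G" "y \<in> verts G" using xy(1,2) ver by auto
    then have n: "x \<noteq> d" "y \<noteq> d" using d by auto
    have s: "sides {x, y, d} = {{x, y}, {d, y}, {d, x}}"
      using sides_triple[of x y d] n xy(3) by (auto simp: insert_commute)
    have "\<Union> (\<gamma>' ` sides {x, y, d}) = \<gamma> {x, y} \<union> A x \<union> A y"
      unfolding s using go[OF xy(4)] by (auto simp: A_def)
    moreover have "Q \<inter> drawing G' p' \<gamma>' = {}" using K' xy(6,7) R(2) by blast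
    moreover have "sides {x, y, d} \<subseteq> edges G'" unfolding s G'e using xy(1,2,4) by auto
    moreover have "card {x, y, d} = 3" using n xy(3) by auto
    moreover have "{x, y, d} \<subseteq> verts G'" using v G'v by auto
    ultimately show ?thesis unfolding iff' using xy(5) by auto
  qed
  \<comment> \<open>The cell of another face is another component of the complement of the old
    drawing. The tripod stays in \<open>R\<close> apart from its ends, which lie on that drawing, so
    it does not reach this cell.\<close>
  have oldface: "triangular_face G' p' \<gamma>' U" if U: "U \<in> \<F>" "U \<noteq> {a, b, c}" for U
  proof -
    have u: "U \<subseteq> verts G" "card U = 3" "sides U \<subseteq> edges G" using F[OF U(1)] unfolding iff by auto
    obtain Q where Q: "cell Q (\<Union> (\<gamma> ` sides U))" "Q \<inter> ?K = {}" using F[OF U(1)] unfolding iff by auto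
    have sub: "\<Union> (\<gamma> ` sides U) \<subseteq> ?K" "\<gamma> {a, b} \<union> \<gamma> {b, c} \<union> \<gamma> {a, c} \<subseteq> ?K" using u(3) gK eds by auto
    have "Q \<noteq> R"
    proof
      assume "Q = R"
      then have "\<Union> (\<gamma> ` sides U) = \<Union> (\<gamma> ` sides {a, b, c})"
        unfolding S using cell_boundary_unique[OF Q(1)] R(1) by blast
      then show False using vertex_on_sides[OF G emb u] vertex_on_sides[OF G emb tf] U(2) by simp
    qed
    then have "Q \<inter> R = {}"
      using components_eq[OF cell_imp_component[OF Q sub(1)] cell_imp_component[OF R sub(2)]] by simp
    then have "Q \<inter> drawing G' p' \<gamma>' = {}" using K' Q(2) AR pK ver by blast
    moreover have "\<Union> (\<gamma>' ` sides U) = \<Union> (\<gamma> ` sides U)" using go u(3) by auto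
    moreover have "U \<subseteq> verts G'" "sides U \<subseteq> edges G'" using u G'v G'e by auto
    ultimately show ?thesis unfolding iff' using Q(1) u(2) by auto
  qed
  show thesis
  proof (rule that[of p' \<gamma>'])
    show "sphere_embedding (split_triangle G a b c d) p' \<gamma>'" using emb' unfolding G'_def .
    fix U assume U: "U \<in> \<F> - {{a, b, c}} \<union> {{a, b, d}, {b, c, d}, {a, c, d}}"
    have "triangular_face G' p' \<gamma>' {a, b, d}"
      by (rule newface[of _ _ Rab]) (use ne eds cells RR RA gn in \<open>auto simp: A_def\<close>)
    moreover have "triangular_face G' p' \<gamma>' {b, c, d}"
      by (rule newface[of _ _ Rbc]) (use ne eds cells RR RA gn in \<open>auto simp: A_def\<close>)
    moreover have "triangular_face G' p' \<gamma>' {a, c, d}"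
      by (rule newface[of _ _ Rac]) (use ne eds cells RR RA gn in \<open>auto simp: A_def\<close>)
    ultimately show "triangular_face (split_triangle G a b c d) p' \<gamma>' U"
      using U oldface unfolding G'_def by blast
  qed
qed

subsection \<open>Splitting faces of a polytope\<close>

text \<open>\<open>\<F>\<close> is a selection of the faces rather than all of them, so that faces
  may be forgotten.\<close>

definition faces_realized :: "'a sgraph \<Rightarrow> 'a set set \<Rightarrow> bool" where
  "faces_realized G \<F> \<longleftrightarrow> simple_graph G \<and>
     (\<exists>p \<gamma>. sphere_embedding G p \<gamma> \<and> (\<forall>T\<in>\<F>. triangular_face G p \<gamma> T))"

lemma faces_realized_mono:
  assumes "faces_realized G \<F>" "\<F>' \<subseteq> \<F>"
  shows "faces_realized G \<F>'"
proof -
  obtain p \<gamma> where "sphere_embedding G p \<gamma>" "\<forall>T\<in>\<F>. triangular_face G p \<gamma> T"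
    using assms(1) unfolding faces_realized_def by auto
  then show ?thesis using assms unfolding faces_realized_def by (intro conjI exI[of _ p] exI[of _ \<gamma>]) auto
qed

lemma faces_realizedD:
  assumes "faces_realized G \<F>" "T \<in> \<F>"
  shows "T \<subseteq> verts G" "card T = 3" "sides T \<subseteq> edges G"
proof -
  obtain p \<gamma> where "triangular_face G p \<gamma> T" using assms unfolding faces_realized_def by auto
  then show "T \<subseteq> verts G" "card T = 3" "sides T \<subseteq> edges G"
    by (simp_all add: triangular_face_def sides_def)
qed

lemma faces_realized_split:
  assumes "faces_realized G \<F>" "{a, b, c} \<in> \<F>" "d \<notin> verts G"
  shows "faces_realized (split_triangle G a b c d) (\<F> - {{a, b, c}} \<union> {{a, b, d}, {b, c, d}, {a, c, d}})"
proof -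
  have G: "simple_graph G" using assms(1) by (simp add: faces_realized_def)
  obtain p \<gamma> where e: "sphere_embedding G p \<gamma>" "\<And>T. T \<in> \<F> \<Longrightarrow> triangular_face G p \<gamma> T"
    using assms(1) unfolding faces_realized_def by auto
  have "{a, b, c} \<subseteq> verts G" using e(2)[OF assms(2)] by (simp add: triangular_face_def)
  then have "simple_graph (split_triangle G a b c d)" by (rule simple_graph_split_triangle[OF G _ assms(3)])
  moreover obtain p' \<gamma>' where "sphere_embedding (split_triangle G a b c d) p' \<gamma>'"
    "\<forall>T \<in> \<F> - {{a, b, c}} \<union> {{a, b, d}, {b, c, d}, {a, c, d}}.
       triangular_face (split_triangle G a b c d) p' \<gamma>' T"
    using e by (rule split_face_embedding[OF G _ _ assms(2,3)]) (assumption, rule that, auto)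
  ultimately show ?thesis unfolding faces_realized_def by (intro conjI exI[of _ p'] exI[of _ \<gamma>'])
qed

lemma verts_split_triangle [simp]: "verts (split_triangle G a b c d) = insert d (verts G)"
  by (simp add: split_triangle_def)

lemma edges_split_triangle [simp]: "edges (split_triangle G a b c d) = edges G \<union> {{d, a}, {d, b}, {d, c}}"
  by (simp add: split_triangle_def)

lemma deg_split_triangle:
  assumes G: "simple_graph G" and abc: "card {a, b, c} = 3" "{a, b, c} \<subseteq> verts G" and d: "d \<notin> verts G"
  shows "deg (split_triangle G a b c d) v =
    (if v = d then 3 else deg G v + (if v \<in> {a, b, c} then 1 else 0))"
proof -
  have ne: "a \<noteq> b" "b \<noteq> c" "a \<noteq> c" using abc(1) by (auto simp: card_insert_if split: if_splits)
  have nd: "d \<noteq> a" "d \<noteq> b" "d \<noteq> c" using abc(2) d by auto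
  have old: "d \<notin> e" if "e \<in> edges G" for e using that G d by (auto simp: simple_graph_def)
  have fin: "finite (edges G)" by (rule simple_graph_finite_edges[OF G])
  let ?E = "{e \<in> edges G. v \<in> e}" and ?N = "{e \<in> {{d, a}, {d, b}, {d, c}}. v \<in> e}"
  have "{e \<in> edges (split_triangle G a b c d). v \<in> e} = ?E \<union> ?N" by auto
  moreover have "?E \<inter> ?N = {}" using old by auto
  ultimately have s: "deg (split_triangle G a b c d) v = card ?E + card ?N"
    unfolding deg_def using fin by (simp add: card_Un_disjoint)
  show ?thesis
  proof (cases "v = d")
    case True
    then have "?E = {}" "?N = {{d, a}, {d, b}, {d, c}}" using old by auto
    moreover have "card {{d, a}, {d, b}, {d, c}} = 3" using ne nd by (simp add: doubleton_eq_iff)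
    ultimately have "card ?E = 0" "card ?N = 3" by (simp_all only: card.empty)
    then show ?thesis using s True by simp
  next
    case False
    have "?N = (if v \<in> {a, b, c} then {{d, v}} else {})" using False ne by auto
    then show ?thesis using s False by (simp add: deg_def)
  qed
qed

text \<open>At most two vertices are deleted, so a corner of the triangle survives, and
  \<open>d\<close>, unless deleted, is attached to it. Among the old vertices the connections of
  \<open>G\<close> remain.\<close>

lemma k_connected_split:
  assumes G: "simple_graph G" and k: "k_connected 3 G" and abc: "card {a, b, c} = 3" "{a, b, c} \<subseteq> verts G"
    and d: "d \<notin> verts G"
  shows "k_connected 3 (split_triangle G a b c d)"
  unfolding k_connected_def
proof (intro conjI allI impI)
  let ?G = "split_triangle G a b c d"
  have fin: "finite (verts G)" using G by (simp add: simple_graph_def)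
  show "3 + 1 \<le> card (verts ?G)" using k d fin by (simp add: k_connected_def)
  fix X assume X: "X \<subseteq> verts ?G" "card X \<le> 3 - 1"
  let ?X = "X - {d}"
  let ?r = "{(x, y). {x, y} \<in> edges (delete_verts ?G X)}" and ?s = "{(x, y). {x, y} \<in> edges (delete_verts G ?X)}"
  have finX: "finite X" using X(1) fin finite_subset by auto
  have "?X \<subseteq> verts G" "card ?X \<le> 3 - 1" using X finX by (auto simp: card_Diff_singleton_if)
  then have con: "graph_connected (delete_verts G ?X)" using k by (simp add: k_connected_def)
  have old: "d \<notin> e" if "e \<in> edges G" for e using that G d by (auto simp: simple_graph_def)
  have sub: "?s \<subseteq> ?r" using old by (auto simp: delete_verts_def)
  then have sub': "?s\<^sup>* \<subseteq> ?r\<^sup>*" by (rule rtrancl_mono)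
  have path: "(u, v) \<in> ?r\<^sup>*" if "u \<in> verts G - X" "v \<in> verts G - X" for u v
    using con that sub' by (auto simp: graph_connected_def delete_verts_def)
  show "graph_connected (delete_verts ?G X)"
  proof (cases "d \<in> X")
    case True
    then show ?thesis using path by (auto simp: graph_connected_def delete_verts_def)
  next
    case False
    have "\<not> {a, b, c} \<subseteq> X"
    proof
      assume "{a, b, c} \<subseteq> X"
      then have "card {a, b, c} \<le> card X" by (rule card_mono[OF finX])
      then show False using X(2) abc(1) by simp
    qed
    then obtain x where x: "x \<in> {a, b, c}" "x \<notin> X" by auto
    have xe: "{d, x} \<in> edges (delete_verts ?G X)" using x False by (auto simp: delete_verts_def)
    then have dx: "(d, x) \<in> ?r\<^sup>*" "(x, d) \<in> ?r\<^sup>*" by (auto simp: insert_commute intro!: r_into_rtrancl)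
    have xV: "x \<in> verts G - X" using x abc(2) by auto
    show ?thesis unfolding graph_connected_def
    proof (intro ballI)
      fix u v assume uv: "u \<in> verts (delete_verts ?G X)" "v \<in> verts (delete_verts ?G X)"
      have to: "(u, x) \<in> ?r\<^sup>* \<and> (x, u) \<in> ?r\<^sup>*" if "u \<in> verts (delete_verts ?G X)" for u
        using that path[of u x] path[of x u] dx xV by (cases "u = d") (auto simp: delete_verts_def)
      show "(u, v) \<in> ?r\<^sup>*" using to[OF uv(1)] to[OF uv(2)] by (meson rtrancl_trans)
    qed
  qed
qed

text \<open>Of the three faces made by each splitting only the one on the edge \<open>{a, b}\<close>
  is kept, for it is split next. Its final third vertex \<open>last ds\<close> takes the place of
  \<open>c\<close>.\<close>

lemma split_about_faces:
  assumes "faces_realized G \<F>" "{a, b, c} \<in> \<F>" "distinct ds" "set ds \<inter> verts G = {}" "ds \<noteq> []"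
  shows "faces_realized (split_about G a b c ds) (\<F> - {{a, b, c}} \<union> {{a, b, last ds}})"
  using assms
proof (induction ds arbitrary: G \<F> c)
  case (Cons d ds)
  let ?\<F> = "\<F> - {{a, b, c}} \<union> {{a, b, d}, {b, c, d}, {a, c, d}}"
  have fr: "faces_realized (split_triangle G a b c d) ?\<F>"
    using Cons.prems by (intro faces_realized_split) auto
  show ?case
  proof (cases "ds = []")
    case True
    have "faces_realized (split_triangle G a b c d) (\<F> - {{a, b, c}} \<union> {{a, b, d}})"
      by (rule faces_realized_mono[OF fr]) auto
    then show ?thesis using True by simp
  next
    case False
    have "faces_realized (split_about (split_triangle G a b c d) a b d ds) (?\<F> - {{a, b, d}} \<union> {{a, b, last ds}})"
      using Cons.prems False by (intro Cons.IH[OF fr]) auto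
    moreover
    have "{a, b, d} \<notin> \<F>" using faces_realizedD(1)[OF Cons.prems(1)] Cons.prems(4) by auto
    then have "\<F> - {{a, b, c}} \<union> {{a, b, last ds}} \<subseteq> ?\<F> - {{a, b, d}} \<union> {{a, b, last ds}}" by auto
    ultimately have "faces_realized (split_about (split_triangle G a b c d) a b d ds) (\<F> - {{a, b, c}} \<union> {{a, b, last ds}})"
      by (rule faces_realized_mono)
    then show ?thesis using False by simp
  qed
qed simp

text \<open>\<open>a\<close> and \<open>b\<close> gain an edge in every splitting, while
  \<open>c\<close> takes part in the first one only. The degree of \<open>c\<close> is left out:
  property Q prescribes none for third vertices.\<close>

lemma split_about_props:
  assumes "simple_graph G" "card {a, b, c} = 3" "{a, b, c} \<subseteq> verts G" "distinct ds" "set ds \<inter> verts G = {}"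
  shows "simple_graph (split_about G a b c ds)"
    "verts (split_about G a b c ds) = verts G \<union> set ds"
    "edges G \<subseteq> edges (split_about G a b c ds)"
    "k_connected 3 G \<Longrightarrow> k_connected 3 (split_about G a b c ds)"
    "v \<in> verts G \<Longrightarrow> v \<noteq> c \<Longrightarrow> deg (split_about G a b c ds) v = deg G v + (if v \<in> {a, b} then length ds else 0)"
proof -
  have "simple_graph (split_about G a b c ds) \<and> verts (split_about G a b c ds) = verts G \<union> set ds \<and>
    edges G \<subseteq> edges (split_about G a b c ds) \<and> (k_connected 3 G \<longrightarrow> k_connected 3 (split_about G a b c ds)) \<and>
    (\<forall>v\<in>verts G. v \<noteq> c \<longrightarrow> deg (split_about G a b c ds) v = deg G v + (if v \<in> {a, b} then length ds else 0))"
    using assms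
  proof (induction ds arbitrary: G c)
    case (Cons d ds)
    let ?G = "split_triangle G a b c d"
    have d: "d \<notin> verts G" using Cons.prems by auto
    have G: "simple_graph ?G" using Cons.prems by (intro simple_graph_split_triangle) auto
    have ne: "a \<noteq> b" "a \<noteq> d" "b \<noteq> d" using Cons.prems(2,3) d by (auto simp: card_insert_if split: if_splits)
    have "card {a, b, d} = 3" using ne by simp
    note IH = Cons.IH[OF G this]
    have k: "k_connected 3 G \<longrightarrow> k_connected 3 ?G"
      using k_connected_split[OF Cons.prems(1) _ Cons.prems(2,3) d] by simp
    have IH: "simple_graph (split_about ?G a b d ds) \<and> verts (split_about ?G a b d ds) = verts ?G \<union> set ds \<and>
      edges ?G \<subseteq> edges (split_about ?G a b d ds) \<and> (k_connected 3 ?G \<longrightarrow> k_connected 3 (split_about ?G a b d ds)) \<and>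
      (\<forall>v\<in>verts ?G. v \<noteq> d \<longrightarrow> deg (split_about ?G a b d ds) v = deg ?G v + (if v \<in> {a, b} then length ds else 0))"
      by (rule IH) (use Cons.prems in auto)
    have dg: "deg ?G v = (if v = d then 3 else deg G v + (if v \<in> {a, b, c} then 1 else 0))" for v
      by (rule deg_split_triangle) (use Cons.prems d in auto)
    show ?case
      using IH k d by (auto simp: dg)
  qed auto
  then show "simple_graph (split_about G a b c ds)"
    "verts (split_about G a b c ds) = verts G \<union> set ds"
    "edges G \<subseteq> edges (split_about G a b c ds)"
    "k_connected 3 G \<Longrightarrow> k_connected 3 (split_about G a b c ds)"
    "v \<in> verts G \<Longrightarrow> v \<noteq> c \<Longrightarrow> deg (split_about G a b c ds) v = deg G v + (if v \<in> {a, b} then length ds else 0)"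
    by blast+
qed

subsection \<open>Stacked triangulations\<close>

type_synonym triple = "nat \<times> nat \<times> nat"

fun split_faces :: "triple set \<Rightarrow> triple \<Rightarrow> nat \<Rightarrow> triple set" where
  "split_faces F (a, b, c) N = F - {(a, b, c)} \<union> {(a, b, N), (b, c, N), (a, c, N)}"

text \<open>A stacking is a list of triples: the triple at position \<open>i\<close> is split, the new vertex being \<open>N + i\<close>.
  All triples are kept increasing, so that a triangle is represented by a unique triple.\<close>

fun valid_stack :: "nat \<Rightarrow> triple set \<Rightarrow> triple list \<Rightarrow> bool" where
  "valid_stack N F [] \<longleftrightarrow> True"
| "valid_stack N F (t # ts) \<longleftrightarrow> t \<in> F \<and> valid_stack (Suc N) (split_faces F t N) ts"

fun stack_faces :: "nat \<Rightarrow> triple set \<Rightarrow> triple list \<Rightarrow> triple set" where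
  "stack_faces N F [] = F"
| "stack_faces N F (t # ts) = stack_faces (Suc N) (split_faces F t N) ts"

text \<open>\<open>f\<close> sends the numbers of a stacking to vertices: it is the identity for the
  auxiliary graph itself, and the copying map when a copy is grown inside a triangle.\<close>

fun stack :: "(nat \<Rightarrow> 'a) \<Rightarrow> nat \<Rightarrow> 'a sgraph \<Rightarrow> triple list \<Rightarrow> 'a sgraph" where
  "stack f N G [] = G"
| "stack f N G ((a, b, c) # ts) = stack f (Suc N) (split_triangle G (f a) (f b) (f c) (f N)) ts"

text \<open>A splitting gives one new edge to each corner, so this counts the edges that
  \<open>i\<close> gains after its introduction.\<close>

definition occ :: "nat \<Rightarrow> triple list \<Rightarrow> nat" where
  "occ i ts = length (filter (\<lambda>(a, b, c). i = a \<or> i = b \<or> i = c) ts)"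

definition increasing :: "nat \<Rightarrow> triple set \<Rightarrow> bool" where
  "increasing N F \<longleftrightarrow> (\<forall>(a, b, c)\<in>F. a < b \<and> b < c \<and> c < N)"

lemma increasing_base: "increasing 3 {(0, 1, 2)}"
  by (simp add: increasing_def)

lemma occ_Nil [simp]: "occ i [] = 0"
  by (simp add: occ_def)

lemma occ_Cons [simp]: "occ i ((a, b, c) # ts) = (if i = a \<or> i = b \<or> i = c then Suc (occ i ts) else occ i ts)"
  by (simp add: occ_def)

lemma occ_append [simp]: "occ i (ts @ us) = occ i ts + occ i us"
  by (simp add: occ_def)

lemma valid_stack_append [simp]:
  "valid_stack N F (ts @ us) \<longleftrightarrow> valid_stack N F ts \<and> valid_stack (N + length ts) (stack_faces N F ts) us"
  by (induction ts arbitrary: N F) auto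

lemma stack_faces_append [simp]:
  "stack_faces N F (ts @ us) = stack_faces (N + length ts) (stack_faces N F ts) us"
  by (induction ts arbitrary: N F) auto

lemma increasing_split:
  "increasing N F \<Longrightarrow> t \<in> F \<Longrightarrow> increasing (Suc N) (split_faces F t N)"
  by (cases t) (fastforce simp: increasing_def)

lemma increasing_stack:
  "increasing N F \<Longrightarrow> valid_stack N F ts \<Longrightarrow> increasing (N + length ts) (stack_faces N F ts)"
proof (induction ts arbitrary: N F)
  case (Cons t ts)
  then show ?case using Cons.IH[of "Suc N" "split_faces F t N"] increasing_split by auto
qed simp

text \<open>The bound includes the vertex introduced last, which no triple of the list can contain.
  It supplies the vertex of degree 3.\<close>

lemma occ_fresh: "increasing N F \<Longrightarrow> valid_stack N F ts \<Longrightarrow> N + length ts \<le> Suc i \<Longrightarrow> occ i ts = 0"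
proof (induction ts arbitrary: N F)
  case (Cons t ts)
  obtain a b c where t: "t = (a, b, c)" by (cases t)
  have "a < b" "b < c" "c < N" using Cons.prems t by (auto simp: increasing_def)
  moreover have "occ i ts = 0"
    using Cons.prems increasing_split by (intro Cons.IH[of "Suc N" "split_faces F t N"]) auto
  ultimately show ?case using Cons.prems(3) t by simp
qed simp

definition triple_image :: "(nat \<Rightarrow> 'a) \<Rightarrow> triple \<Rightarrow> 'a set" where
  "triple_image f = (\<lambda>(a, b, c). {f a, f b, f c})"

lemma triple_image_inj:
  assumes "increasing N F" "inj_on f {..<N}" "s \<in> F" "t \<in> F" "triple_image f s = triple_image f t"
  shows "s = t"
proof -
  obtain a b c a' b' c' where st: "s = (a, b, c)" "t = (a', b', c')" by (cases s; cases t) auto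
  have o: "a < b" "b < c" "c < N" "a' < b'" "b' < c'" "c' < N" using assms(1,3,4) st by (auto simp: increasing_def)
  have "f ` {a, b, c} = f ` {a', b', c'}" using assms(5) st by (simp add: triple_image_def)
  moreover have "{a, b, c} \<subseteq> {..<N}" "{a', b', c'} \<subseteq> {..<N}" using o by auto
  ultimately have "{a, b, c} = {a', b', c'}" using inj_on_image_eq_iff[OF assms(2)] by blast
  then show ?thesis using o unfolding st by (simp add: set_eq_iff) (metis less_asym' less_trans)
qed

lemma triple_image_card:
  assumes "increasing N F" "inj_on f {..<N}" "(a, b, c) \<in> F"
  shows "card {f a, f b, f c} = 3"
proof -
  have o: "a < b" "b < c" "c < N" using assms(1,3) by (auto simp: increasing_def)
  then have "card (f ` {a, b, c}) = card {a, b, c}" by (intro card_image inj_on_subset[OF assms(2)]) auto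
  then show ?thesis using o by simp
qed

text \<open>\<open>\<G>\<close> collects faces outside the region being stacked, which are carried
  along untouched. It is kept disjoint from the others because a splitting deletes a triangle from
  the family as a set.\<close>

lemma stack_faces_realized:
  assumes "faces_realized G (\<G> \<union> triple_image f ` F)" "increasing N F" "valid_stack N F ts"
    "inj_on f {..<N + length ts}" "f ` {..<N} \<subseteq> verts G" "f ` {N..<N + length ts} \<inter> verts G = {}"
    "\<G> \<inter> triple_image f ` F = {}"
  shows "faces_realized (stack f N G ts) (\<G> \<union> triple_image f ` stack_faces N F ts)"
  using assms
proof (induction ts arbitrary: N F G)
  case (Cons t ts)
  obtain a b c where t: "t = (a, b, c)" by (cases t)
  have tF: "(a, b, c) \<in> F" using Cons.prems(3) t by simp
  have "f N \<in> f ` {N..<N + length (t # ts)}" by simp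
    then have fN: "f N \<notin> verts G" using Cons.prems(6) by blast
  have iN: "inj_on f {..<N}" using Cons.prems(4) by (rule inj_on_subset) auto
  let ?G = "split_triangle G (f a) (f b) (f c) (f N)" and ?F = "split_faces F t N"
  have T: "triple_image f t = {f a, f b, f c}" by (simp add: t triple_image_def)
  have fr: "faces_realized ?G ((\<G> \<union> triple_image f ` F) - {{f a, f b, f c}} \<union> {{f a, f b, f N}, {f b, f c, f N}, {f a, f c, f N}})"
    by (rule faces_realized_split[OF Cons.prems(1) _ fN]) (use tF in \<open>force simp: triple_image_def\<close>)
  define X where "X = {f a, f b, f c}"
  define New where "New = {{f a, f b, f N}, {f b, f c, f N}, {f a, f c, f N}}"
  have imF: "triple_image f ` ?F = triple_image f ` (F - {t}) \<union> New"
    by (simp add: t triple_image_def image_Un New_def)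
  have XF: "X \<in> triple_image f ` F" using tF T t unfolding X_def by (metis image_eqI)
  have "\<G> \<union> triple_image f ` ?F \<subseteq> (\<G> \<union> triple_image f ` F) - {X} \<union> New"
  proof -
    have "X \<notin> \<G>" using Cons.prems(7) XF by blast
    moreover have "X \<notin> triple_image f ` (F - {t})"
    proof
      assume "X \<in> triple_image f ` (F - {t})"
      then obtain s where s: "s \<in> F" "s \<noteq> t" "X = triple_image f s" by blast
      then show False using triple_image_inj[OF Cons.prems(2) iN, of s t] tF t T X_def by simp
    qed
    ultimately show ?thesis unfolding imF by blast
  qed
  then have fr: "faces_realized ?G (\<G> \<union> triple_image f ` ?F)"
    by (rule faces_realized_mono[OF fr[folded X_def New_def]])
  have "\<G> \<inter> triple_image f ` ?F = {}"
  proof -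
    have "U \<notin> New" if "U \<in> \<G>" for U
    proof -
      have "U \<subseteq> verts G" by (rule faces_realizedD(1)[OF Cons.prems(1)]) (use that in simp)
      then show ?thesis using fN by (auto simp: New_def)
    qed
    then show ?thesis using Cons.prems(7) unfolding imF by blast
  qed
  moreover have "f ` {Suc N..<Suc N + length ts} \<inter> verts ?G = {}"
  proof -
    have "f N \<notin> f ` {Suc N..<Suc N + length ts}" using Cons.prems(4) by (auto dest: inj_onD)
    moreover have "f ` {Suc N..<Suc N + length ts} \<subseteq> f ` {N..<N + length (t # ts)}" by auto
    ultimately show ?thesis using Cons.prems(6) by auto
  qed
  moreover have "f ` {..<Suc N} \<subseteq> verts ?G" using Cons.prems(5) by (auto simp: lessThan_Suc)
  ultimately have "faces_realized (stack f (Suc N) ?G ts) (\<G> \<union> triple_image f ` stack_faces (Suc N) ?F ts)"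
    using Cons.prems(3,4) t by (intro Cons.IH[OF fr increasing_split[OF Cons.prems(2)]]) auto
  then show ?case using t by simp
qed simp

fun stack_edges :: "(nat \<Rightarrow> 'a) \<Rightarrow> nat \<Rightarrow> triple list \<Rightarrow> 'a set set" where
  "stack_edges f N [] = {}"
| "stack_edges f N ((a, b, c) # ts) = {{f N, f a}, {f N, f b}, {f N, f c}} \<union> stack_edges f (Suc N) ts"

lemma edges_stack: "edges (stack f N G ts) = edges G \<union> stack_edges f N ts"
  by (induction f N G ts rule: stack.induct) auto

lemma verts_stack: "verts (stack f N G ts) = verts G \<union> f ` {N..<N + length ts}"
proof (induction f N G ts rule: stack.induct)
  case (2 f N G a b c ts)
  have "{N..<N + length ((a, b, c) # ts)} = insert N {Suc N..<Suc N + length ts}" by auto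
  then show ?case using 2 by auto
qed simp

text \<open>Relabelling commutes with stacking; hence growing the stack in place yields the same
  edges as gluing a copy.\<close>

lemma stack_edges_image: "stack_edges f N ts = (\<lambda>e. f ` e) ` stack_edges (\<lambda>x. x) N ts"
  by (induction f N ts rule: stack_edges.induct) auto

lemma stack_props:
  assumes "simple_graph G" "increasing N F" "valid_stack N F ts"
    "inj_on f {..<N + length ts}" "f ` {..<N} \<subseteq> verts G" "f ` {N..<N + length ts} \<inter> verts G = {}"
  shows "simple_graph (stack f N G ts)"
    "k_connected 3 G \<Longrightarrow> k_connected 3 (stack f N G ts)"
    "i < N + length ts \<Longrightarrow> deg (stack f N G ts) (f i) = (if i < N then deg G (f i) else 3) + occ i ts"
    "v \<notin> f ` {..<N + length ts} \<Longrightarrow> deg (stack f N G ts) v = deg G v"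
proof -
  have "simple_graph (stack f N G ts) \<and> (k_connected 3 G \<longrightarrow> k_connected 3 (stack f N G ts)) \<and>
    (\<forall>i<N + length ts. deg (stack f N G ts) (f i) = (if i < N then deg G (f i) else 3) + occ i ts) \<and>
    (\<forall>v. v \<notin> f ` {..<N + length ts} \<longrightarrow> deg (stack f N G ts) v = deg G v)"
    using assms
  proof (induction ts arbitrary: N F G)
    case (Cons t ts)
    obtain a b c where t: "t = (a, b, c)" by (cases t)
    have tF: "(a, b, c) \<in> F" using Cons.prems(3) t by simp
    have o: "a < N" "b < N" "c < N" using Cons.prems(2) tF by (auto simp: increasing_def)
    have "f N \<in> f ` {N..<N + length (t # ts)}" by simp
    then have fN: "f N \<notin> verts G" using Cons.prems(6) by blast
    have iN: "inj_on f {..<N}" using Cons.prems(4) by (rule inj_on_subset) auto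
    let ?G = "split_triangle G (f a) (f b) (f c) (f N)" and ?F = "split_faces F t N"
    have sub: "{f a, f b, f c} \<subseteq> verts G" using Cons.prems(5) o by auto
    note cd = triple_image_card[OF Cons.prems(2) iN tF]
    note dg = deg_split_triangle[OF Cons.prems(1) cd sub fN]
    have G: "simple_graph ?G" by (rule simple_graph_split_triangle[OF Cons.prems(1) sub fN])
    have k: "k_connected 3 G \<longrightarrow> k_connected 3 ?G" using k_connected_split[OF Cons.prems(1) _ cd sub fN] by simp
    have fr: "f ` {Suc N..<Suc N + length ts} \<inter> verts ?G = {}"
    proof -
      have "f N \<notin> f ` {Suc N..<Suc N + length ts}" using Cons.prems(4) by (auto dest: inj_onD)
      moreover have "f ` {Suc N..<Suc N + length ts} \<subseteq> f ` {N..<N + length (t # ts)}" by auto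
      ultimately show ?thesis using Cons.prems(6) by auto
    qed
    have "f ` {..<Suc N} \<subseteq> verts ?G" using Cons.prems(5) by (auto simp: lessThan_Suc)
    then have IH: "simple_graph (stack f (Suc N) ?G ts) \<and> (k_connected 3 ?G \<longrightarrow> k_connected 3 (stack f (Suc N) ?G ts)) \<and>
      (\<forall>i<Suc N + length ts. deg (stack f (Suc N) ?G ts) (f i) = (if i < Suc N then deg ?G (f i) else 3) + occ i ts) \<and>
      (\<forall>v. v \<notin> f ` {..<Suc N + length ts} \<longrightarrow> deg (stack f (Suc N) ?G ts) v = deg ?G v)"
      using Cons.prems(3,4) t fr by (intro Cons.IH[OF G increasing_split[OF Cons.prems(2)]]) auto
    have st: "stack f N G (t # ts) = stack f (Suc N) ?G ts" by (simp add: t)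
    show ?case unfolding st
    proof (intro conjI allI impI)
      show "simple_graph (stack f (Suc N) ?G ts)" using IH by blast
      show "k_connected 3 (stack f (Suc N) ?G ts)" if "k_connected 3 G" using IH k that by blast
      fix i assume i: "i < N + length (t # ts)"
      have eq: "f i = f j \<longleftrightarrow> i = j" if "j \<le> N" for j
        using i that Cons.prems(4) by (auto dest!: inj_onD)
      have "deg ?G (f i) = (if i = N then 3 else deg G (f i) + (if i = a \<or> i = b \<or> i = c then 1 else 0))"
        using o eq[of N] eq[of a] eq[of b] eq[of c] by (simp add: dg)
      then show "deg (stack f (Suc N) ?G ts) (f i) = (if i < N then deg G (f i) else 3) + occ i (t # ts)"
        using IH i o by (auto simp: t less_Suc_eq)
    next
      fix v assume v: "v \<notin> f ` {..<N + length (t # ts)}"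
      have "v \<noteq> f N" "v \<notin> {f a, f b, f c}" using v o by auto
      then have "deg ?G v = deg G v" by (simp add: dg)
      moreover have "deg (stack f (Suc N) ?G ts) v = deg ?G v" using IH v by simp
      ultimately show "deg (stack f (Suc N) ?G ts) v = deg G v" by simp
    qed
  qed auto
  then show "simple_graph (stack f N G ts)"
    "k_connected 3 G \<Longrightarrow> k_connected 3 (stack f N G ts)"
    "i < N + length ts \<Longrightarrow> deg (stack f N G ts) (f i) = (if i < N then deg G (f i) else 3) + occ i ts"
    "v \<notin> f ` {..<N + length ts} \<Longrightarrow> deg (stack f N G ts) v = deg G v"
    by blast+
qed

section \<open>The initial triangle\<close>

definition triangle_graph :: "'a \<Rightarrow> 'a \<Rightarrow> 'a \<Rightarrow> 'a sgraph" where
  "triangle_graph u v w = \<lparr>verts = {u, v, w}, edges = {{u, v}, {v, w}, {u, w}}\<rparr>"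

text \<open>The plane triangle with corners 0, 1, \<i> is carried to the sphere by a homeomorphism
  of the plane with the punctured sphere. Its inside is the recorded face; the other face contains
  the puncture \<open>b\<close>.\<close>

lemma triangle_graph_realized:
  assumes n: "n0 \<noteq> n1" "n1 \<noteq> n2" "n0 \<noteq> n2"
  shows "faces_realized (triangle_graph n0 n1 n2) {{n0, n1, n2}}"
proof -
  have nc: "\<not> collinear {0, 1, \<i>}" by (simp add: collinear_lemma complex_eq_iff)
  have perm: "\<not> collinear {1, 0, \<i>}" "\<not> collinear {0, \<i>, 1}" using nc by (simp_all add: insert_commute)
  let ?A = "closed_segment 0 1 :: complex set" and ?B = "closed_segment 1 \<i>" and ?C = "closed_segment 0 \<i>"
  have AB: "?A \<inter> ?B = {1}" using Int_closed_segment[of 1 0 \<i>] nc by blast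
  have AC: "?A \<inter> ?C = {0}" using Int_closed_segment[of 0 1 \<i>] perm(1) by (simp add: closed_segment_commute)
  have CB: "?C \<inter> ?B = {\<i>}" using Int_closed_segment[of \<i> 0 1] perm(2) by (simp add: closed_segment_commute)
  define b :: "real ^ 3" where "b = axis 1 1"
  have b: "b \<in> sphere 0 1" by (simp add: b_def norm_axis_1)
  obtain h g where hom: "homeomorphism (sphere 0 1 - {b}) (UNIV :: complex set) h g"
    using punctured_sphere_plane[OF b] by blast
  have hg: "h (g z) = z" for z using homeomorphism_apply2[OF hom] by simp
  have inj: "inj g" by (rule inj_on_inverseI[of _ h]) (rule hg)
  then have geq: "g u = g v \<longleftrightarrow> u = v" for u v by (simp add: inj_eq)
  have gS: "g u \<in> sphere 0 1" for u using homeomorphism_image2[OF hom] by blast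
  have cg: "continuous_on X g" for X by (rule continuous_on_subset[OF homeomorphism_cont2[OF hom]]) simp
  define z where "z i = (if i = n0 then 0 else if i = n1 then 1 else \<i>)" for i
  have z: "z n0 = 0" "z n1 = 1" "z n2 = \<i>" using n by (auto simp: z_def)
  define \<gamma> where "\<gamma> e = g ` (convex hull (z ` e))" for e
  have \<gamma>: "\<gamma> {u, v} = g ` closed_segment (z u) (z v)" for u v
    by (simp add: \<gamma>_def segment_convex_hull)
  have \<gamma>3: "\<gamma> {n0, n1} = g ` ?A" "\<gamma> {n1, n2} = g ` ?B" "\<gamma> {n0, n2} = g ` ?C" by (simp_all only: \<gamma> z)
  let ?p = "\<lambda>i. g (z i)"
  let ?G = "triangle_graph n0 n1 n2"
  have ends: "0 \<in> ?A" "1 \<in> ?A" "1 \<in> ?B" "\<i> \<in> ?B" "0 \<in> ?C" "\<i> \<in> ?C" by auto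
  have nmem: "\<i> \<notin> ?A" "0 \<notin> ?B" "1 \<notin> ?C"
    using AB AC CB ends complex_i_not_one complex_i_not_zero by (metis Int_iff singletonD zero_neq_one)+
  have E: "edges ?G = {{n0, n1}, {n1, n2}, {n0, n2}}" and V: "verts ?G = {n0, n1, n2}" by (simp_all add: triangle_graph_def)
  have sg: "simple_graph ?G" using n by (simp add: simple_graph_def E V)
  have meet: "\<gamma> {n0, n1} \<inter> \<gamma> {n1, n2} = {g 1}" "\<gamma> {n0, n1} \<inter> \<gamma> {n0, n2} = {g 0}" "\<gamma> {n0, n2} \<inter> \<gamma> {n1, n2} = {g \<i>}"
    by (simp_all only: \<gamma>3 image_Int[OF inj, symmetric] AB AC CB image_insert image_empty)
  have neq: "{n0, n1} \<noteq> {n1, n2}" "{n0, n1} \<noteq> {n0, n2}" "{n0, n2} \<noteq> {n1, n2}" using n by (auto simp: doubleton_eq_iff)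
  have int: "{n0, n1} \<inter> {n1, n2} = {n1}" "{n0, n1} \<inter> {n0, n2} = {n0}" "{n0, n2} \<inter> {n1, n2} = {n2}" using n by auto
  have emb: "sphere_embedding ?G ?p \<gamma>"
    unfolding sphere_embedding_def
  proof (intro conjI allI impI ballI)
    show "inj_on ?p (verts ?G)" using n by (auto simp: V inj_on_def geq z_def)
    show "?p ` verts ?G \<subseteq> sphere 0 1" using gS by auto
  next
    fix u v assume "{u, v} \<in> edges ?G"
    then have ne: "z u \<noteq> z v" using n by (auto simp: E z_def doubleton_eq_iff)
    have "arc (g \<circ> linepath (z u) (z v))"
      by (rule arc_continuous_image[OF arc_linepath[OF ne] cg inj_on_subset[OF inj subset_UNIV]])
    then show "\<exists>k. arc k \<and> pathstart k = g (z u) \<and> pathfinish k = g (z v) \<and> path_image k = \<gamma> {u, v} \<and> path_image k \<subseteq> sphere 0 1"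
      using gS by (intro exI[of _ "g \<circ> linepath (z u) (z v)"])
        (auto simp: pathstart_compose pathfinish_compose path_image_compose \<gamma>)
  next
    fix e v assume e: "e \<in> edges ?G" and v: "v \<in> verts ?G" "g (z v) \<in> \<gamma> e"
    have gi: "g u \<in> g ` X \<longleftrightarrow> u \<in> X" for u X using inj by (rule inj_image_mem_iff)
    consider "e = {n0, n1}" | "e = {n1, n2}" | "e = {n0, n2}" using e by (auto simp: E)
    then show "v \<in> e"
    proof cases
      case 1 then show ?thesis using v nmem(1) by (auto simp: V z gi \<gamma>3)
    next
      case 2 then show ?thesis using v nmem(2) by (auto simp: V z gi \<gamma>3)
    next
      case 3 then show ?thesis using v nmem(3) by (auto simp: V z gi \<gamma>3)
    qed
  next
    fix e f assume ef: "e \<in> edges ?G" "f \<in> edges ?G" "e \<noteq> f"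
    have z': "?p ` {n1} = {g 1}" "?p ` {n0} = {g 0}" "?p ` {n2} = {g \<i>}" by (simp_all add: z)
    have "\<gamma> {n0, n1} \<inter> \<gamma> {n1, n2} \<subseteq> ?p ` ({n0, n1} \<inter> {n1, n2})" "\<gamma> {n0, n1} \<inter> \<gamma> {n0, n2} \<subseteq> ?p ` ({n0, n1} \<inter> {n0, n2})"
      "\<gamma> {n0, n2} \<inter> \<gamma> {n1, n2} \<subseteq> ?p ` ({n0, n2} \<inter> {n1, n2})"
      by (simp_all only: meet int z' order_refl)
    then show "\<gamma> e \<inter> \<gamma> f \<subseteq> ?p ` (e \<inter> f)"
      using ef unfolding E by (elim insertE emptyE) (simp_all only: Int_commute not_False_eq_True)
  qed
  define c1 where "c1 = linepath 0 1 +++ linepath 1 \<i>"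
  have c1: "arc c1" unfolding c1_def
    by (rule arc_join) (use AB in \<open>auto intro: arc_linepath\<close>)
  have c1': "pathstart c1 = 0" "pathfinish c1 = \<i>" "path_image c1 = ?A \<union> ?B"
    by (auto simp: c1_def path_image_join)
  have c2: "arc (linepath 0 \<i>)" "pathstart (linepath 0 \<i>) = 0" "pathfinish (linepath 0 \<i>) = \<i>" "path_image (linepath 0 \<i>) = ?C"
    by (auto intro: arc_linepath)
  have "path_image c1 \<inter> path_image (linepath 0 \<i>) = {0, \<i>}" unfolding c1'(3) c2(4) using AC CB by blast
  note th = theta_inside[OF c1 c1'(1,2) c2(1-3) this, unfolded c1'(3) c2(4)]
  have cl: "cell (g ` inside (?A \<union> ?B \<union> ?C)) (g ` (?A \<union> ?B \<union> ?C))"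
    by (rule cell_plane_image[OF hom b]) (use th in auto)
  have S: "\<Union> (\<gamma> ` sides {n0, n1, n2}) = g ` (?A \<union> ?B \<union> ?C)"
  proof -
    have "sides {n0, n1, n2} = {{n0, n1}, {n1, n2}, {n0, n2}}" by (rule sides_triple) (use n in auto)
    then show ?thesis using \<gamma>3 by (simp add: image_Un Un_ac)
  qed
  have D: "drawing ?G ?p \<gamma> \<subseteq> g ` (?A \<union> ?B \<union> ?C)"
    unfolding drawing_def E V using \<gamma>3 ends by (auto simp: z)
  have "triangular_face ?G ?p \<gamma> {n0, n1, n2}"
    unfolding triangular_face_iff_cell[OF sg emb]
  proof (intro conjI)
    show "sides {n0, n1, n2} \<subseteq> edges ?G" unfolding E by (subst sides_triple) (use n in auto)
    show "\<exists>R. cell R (\<Union> (\<gamma> ` sides {n0, n1, n2})) \<and> R \<inter> drawing ?G ?p \<gamma> = {}"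
      unfolding S using cl cell_disjoint[OF cl] D by blast
  qed (use n in \<open>auto simp: V\<close>)
  then show ?thesis unfolding faces_realized_def using sg emb by blast
qed

section \<open>Recognising the faces of a stacking\<close>

fun side :: "nat \<Rightarrow> nat \<Rightarrow> triple \<Rightarrow> bool" where
  "side a b (x, y, z) \<longleftrightarrow> a = x \<and> b = y \<or> a = y \<and> b = z \<or> a = x \<and> b = z"

text \<open>\<open>T\<close> is the whole list and \<open>M\<close> the number of the next vertex.
  Unless a triple is an initial face, it is compared with the one entry that introduced its largest
  vertex \<open>c\<close>; so a long list can be checked without computing face sets.\<close>

fun sides_ok :: "nat \<Rightarrow> triple set \<Rightarrow> triple list \<Rightarrow> nat \<Rightarrow> triple list \<Rightarrow> bool" where
  "sides_ok N F T M [] \<longleftrightarrow> True"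
| "sides_ok N F T M ((a, b, c) # ts) \<longleftrightarrow>
     (N \<le> c \<and> c < M \<and> side a b (T ! (c - N)) \<or> (a, b, c) \<in> F) \<and> sides_ok N F T (Suc M) ts"

text \<open>The face \<open>(a, b, c)\<close> arises when the vertex \<open>c\<close> is inserted into a face with side \<open>ab\<close>,
  and it disappears when it is split itself.\<close>

lemma stack_faces_iff:
  assumes "valid_stack N F ts" "increasing N F"
  shows "(a, b, c) \<in> stack_faces N F ts \<longleftrightarrow>
    (a, b, c) \<notin> set ts \<and> ((a, b, c) \<in> F \<or> N \<le> c \<and> c < N + length ts \<and> side a b (ts ! (c - N)))"
  using assms
proof (induction ts arbitrary: N F)
  case Nil
  then show ?case by auto
next
  case (Cons t ts)
  obtain x y z where t: "t = (x, y, z)" by (cases t)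
  have v: "t \<in> F" "valid_stack (Suc N) (split_faces F t N) ts" using Cons.prems(1) by auto
  note IH = Cons.IH[OF v(2) increasing_split[OF Cons.prems(2) v(1)]]
  have o: "z < N" using Cons.prems(2) v(1) t by (auto simp: increasing_def)
  have cN: "c < N" if "(a, b, c) \<in> F" using Cons.prems(2) that by (auto simp: increasing_def)
  have sf: "(a, b, c) \<in> split_faces F t N \<longleftrightarrow> (a, b, c) \<in> F \<and> (a, b, c) \<noteq> t \<or> c = N \<and> side a b t"
    using o by (auto simp: t)
  have eq: "stack_faces N F (t # ts) = stack_faces (Suc N) (split_faces F t N) ts" by simp
  consider "c < N" | "c = N" | "Suc N \<le> c" by linarith
  then show ?case
  proof cases
    case 1 then show ?thesis unfolding eq IH sf by auto
  next
    case 2 then show ?thesis unfolding eq IH sf using cN o t by auto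
  next
    case 3
    then have "c - N = Suc (c - Suc N)" by simp
    then show ?thesis using 3 unfolding eq IH sf using cN o t by auto
  qed
qed

text \<open>The side condition says that a face has arisen, distinctness that it has not been split
  before. The prefix \<open>ts\<close> serves the induction, in which positions refer to the whole
  list.\<close>

lemma valid_stack_criterion:
  assumes "distinct (ts @ us)" "sides_ok N F (ts @ us) (N + length ts) us" "valid_stack N F ts" "increasing N F"
  shows "valid_stack N F (ts @ us)"
  using assms
proof (induction us arbitrary: ts)
  case (Cons u us)
  obtain a b c where u: "u = (a, b, c)" by (cases u)
  have ok: "N \<le> c \<and> c < N + length ts \<and> side a b ((ts @ u # us) ! (c - N)) \<or> (a, b, c) \<in> F"
    "sides_ok N F (ts @ u # us) (Suc (N + length ts)) us"
    using Cons.prems(2) u by auto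
  have "(ts @ u # us) ! (c - N) = ts ! (c - N)" if "N \<le> c" "c < N + length ts"
  proof -
    have "c - N < length ts" using that by linarith
    then show ?thesis by (simp add: nth_append)
  qed
  then have "(a, b, c) \<in> stack_faces N F ts"
    using ok(1) Cons.prems(1,3,4) u by (auto simp: stack_faces_iff)
  then have "valid_stack N F (ts @ [u])" using Cons.prems(3) u by simp
  then have "valid_stack N F ((ts @ [u]) @ us)"
    using Cons.prems ok(2) by (intro Cons.IH) auto
  then show ?case by simp
qed simp

lemma valid_stackI:
  assumes "distinct ts" "sides_ok N F ts N ts" "increasing N F"
  shows "valid_stack N F ts"
  using valid_stack_criterion[of "[]" ts N F] assms by simp

subsection \<open>Blueprints of the auxiliary graphs\<close>

definition spec_verts :: "triple list \<Rightarrow> nat set" where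
  "spec_verts ps = (\<Union>(a, b, c)\<in>set ps. {a, b})"

definition thirds :: "triple list \<Rightarrow> nat set" where
  "thirds ps = (\<Union>(a, b, c)\<in>set ps. {c})"

text \<open>The corners of the initial triangle start with two edges, every later vertex with
  three.\<close>

definition valence :: "triple list \<Rightarrow> nat \<Rightarrow> nat" where
  "valence ts i = (if i < 3 then 2 else 3) + occ i ts"

text \<open>The gluing triangle is \<open>(0, 1, 2)\<close>; \<open>t\<close> is the other face at the edge \<open>01\<close>, that is the triangle
  \<open>{x 1 1, x 1 2, x 1 3}\<close>, and \<open>ps\<close> lists the triangles \<open>{x j 1, x j 2, x j 3}\<close> with \<open>j \<ge> 2\<close>. The last conjunct
  is what makes \<open>{0, 1, 2}\<close> a face (\<open>stacked_graph_base_face\<close>).\<close>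

definition framed :: "nat \<Rightarrow> triple list \<Rightarrow> triple \<Rightarrow> triple list \<Rightarrow> bool" where
  "framed q ts t ps \<longleftrightarrow> valid_stack 3 {(0, 1, 2)} ts \<and> ts \<noteq> [] \<and>
     set (t # ps) \<subseteq> stack_faces 3 {(0, 1, 2)} ts \<and> fst t = 0 \<and> fst (snd t) = 1 \<and>
     valence ts 0 = q - 1 \<and> valence ts 1 = q - 1 \<and> 2 * length ps = q - 3 \<and>
     (\<forall>i\<in>spec_verts ps. 3 \<le> i) \<and> 2 \<notin> thirds ps \<and> thirds (t # ps) \<inter> spec_verts (t # ps) = {} \<and> 2 < snd (snd t) \<and> (0, 2, 3) \<notin> set ts"

definition blueprint :: "nat \<Rightarrow> triple list \<Rightarrow> triple \<Rightarrow> triple list \<Rightarrow> bool" where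
  "blueprint q ts t ps \<longleftrightarrow> framed q ts t ps \<and> valence ts ` spec_verts ps = {4..q} \<and>
     4 * (3 + length ts) + 7 * q = q * q + 34"

fun deficit :: "triple \<Rightarrow> nat \<Rightarrow> nat" where
  "deficit (a, b, c) i = (if i = a then 3 else if i = b then 5 else if i = c then 7 else 0)"

text \<open>All degrees are right except that the vertices of the face \<open>u\<close> lack 3, 5 and 7. These are the numbers of edges
  which they gain if the next four core vertices are placed in \<open>u\<close>; they are also gained by one vertex in \<open>u\<close>
  followed by two and four splittings along two of its sides.\<close>

definition pre_blueprint :: "nat \<Rightarrow> triple list \<Rightarrow> triple \<Rightarrow> triple list \<Rightarrow> triple \<Rightarrow> bool" where
  "pre_blueprint q ts t ps u \<longleftrightarrow> framed q ts t ps \<and>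
     (\<lambda>i. valence ts i + deficit u i) ` spec_verts ps = {4..q} \<and>
     4 * (10 + length ts) + 7 * q = q * q + 34 \<and> u \<in> stack_faces 3 {(0, 1, 2)} ts \<and>
     (case u of (a, b, c) \<Rightarrow> {a, b, c} \<subseteq> spec_verts ps)"

section \<open>The stackings for q = 17 and q = 21\<close>

text \<open>The first 14 entries introduce the core vertices 3, ..., 16, the next 24 put a vertex
  into core faces, and the last 10 split triangles on core edges. Vertex 2 lies in the core face {0,
  1, 3}. The empty core faces are {11, 12, 15} and {11, 14, 15}, at the vertex 15 of degree 4, and
  {0, 3, 16}, at the vertex 16 of degree 5.\<close>

definition stack17 :: "triple list" where
  "stack17 =
    [(0, 1, 2), (0, 1, 3), (0, 1, 4), (0, 1, 5), (1, 5, 6), (0, 3, 4), (1, 6, 7), (6, 7, 9), (0, 4, 8), (4, 8,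
    11), (5, 6, 7), (4, 11, 12), (11, 12, 14), (0, 3, 8), (0, 1, 6), (0, 4, 5), (0, 4, 11), (0, 5, 6), (0, 8,
    11), (0, 8, 16), (1, 3, 4), (1, 4, 5), (1, 5, 7), (1, 6, 9), (1, 7, 9), (3, 4, 8), (3, 8, 16), (4, 8, 12),
    (4, 11, 14), (4, 12, 14), (5, 6, 13), (5, 7, 13), (6, 7, 10), (6, 7, 13), (6, 9, 10), (7, 9, 10), (8, 11,
    12), (12, 14, 15), (6, 10, 35), (1, 5, 25), (1, 5, 42), (7, 10, 38), (6, 9, 26), (0, 5, 18), (3, 8, 29),
    (3, 8, 47), (11, 12, 39), (4, 11, 31)]"

text \<open>Here the three groups have 18, 31 and 23 entries, and the core vertices are 0, 1, 3,
  ..., 20. The core faces {8, 9, 18}, {8, 10, 18} and {0, 6, 20} stay empty for good; {9, 11, 12} is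
  left vacant for the continuation.\<close>

definition stack21 :: "triple list" where
  "stack21 =
    [(0, 1, 2), (0, 1, 3), (0, 1, 4), (0, 1, 5), (0, 1, 6), (0, 6, 7), (0, 6, 8), (6, 8, 9), (6, 9, 10), (9, 10,
    11), (10, 11, 12), (0, 6, 9), (1, 4, 5), (4, 5, 15), (11, 12, 13), (8, 9, 10), (11, 12, 17), (0, 6, 14),
    (0, 1, 7), (0, 3, 4), (0, 4, 5), (0, 5, 6), (0, 7, 8), (0, 8, 9), (0, 9, 14), (0, 14, 20), (1, 3, 4), (1,
    4, 15), (1, 5, 6), (1, 5, 15), (1, 6, 7), (4, 5, 16), (4, 15, 16), (5, 15, 16), (6, 7, 8), (6, 8, 10), (6,
    9, 11), (6, 9, 14), (6, 10, 11), (6, 14, 20), (9, 10, 12), (9, 10, 18), (10, 11, 13), (10, 12, 13), (11,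
    12, 19), (11, 13, 17), (11, 17, 19), (12, 13, 17), (12, 17, 19), (17, 19, 49), (9, 14, 27), (9, 14, 53),
    (9, 14, 54), (0, 14, 28), (10, 13, 46), (10, 13, 57), (6, 14, 40), (8, 10, 38), (8, 10, 60), (6, 8, 37),
    (11, 13, 48), (13, 17, 48), (7, 8, 25), (1, 5, 31), (1, 5, 66), (1, 4, 30), (1, 3, 29), (1, 3, 69), (5,
    15, 32), (4, 15, 30), (1, 15, 30), (4, 5, 23)]"

definition pairs17 :: "triple list" where
  "pairs17 =
    [(3, 16, 29), (14, 15, 40), (4, 11, 50), (8, 12, 30), (5, 13, 34), (7, 9, 27), (6, 10, 41)]"

lemma valid_stack17: "valid_stack 3 {(0, 1, 2)} stack17"
  unfolding stack17_def by (rule valid_stackI) (simp_all add: increasing_def)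

text \<open>The vertices are listed by increasing degree, so that the claim about degrees becomes an
  equality of two lists.\<close>

lemma spec_verts17: "spec_verts pairs17 = set
    [15, 16, 13, 14, 10, 9, 12, 3, 11, 7, 8, 5, 6, 4]"
  by (auto simp: spec_verts_def pairs17_def)

lemma length_stack17: "length stack17 = 48"
  by (simp add: stack17_def)

lemma faces17: "set ((0, 1, 17) # pairs17) \<subseteq> stack_faces 3 {(0, 1, 2)} stack17"
proof -
  note iff = stack_faces_iff[OF valid_stack17 increasing_base]
  show ?thesis by (simp add: pairs17_def iff length_stack17 del: One_nat_def) (simp add: stack17_def)
qed

definition pairs21 :: "triple list" where
  "pairs21 =
    [(3, 4, 29), (7, 8, 65), (10, 18, 44), (15, 16, 35), (5, 6, 31), (14, 20, 42), (9, 11, 39), (17, 19, 51), (12,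
     13, 46)]"

lemma valid_stack21: "valid_stack 3 {(0, 1, 2)} stack21"
  unfolding stack21_def by (rule valid_stackI) (simp_all add: increasing_def)

text \<open>The order is that of the degrees increased by the deficits at (9, 11, 12).\<close>

lemma spec_verts21: "spec_verts pairs21 = set
    [18, 20, 16, 19, 3, 7, 17, 15, 13, 14, 8, 4, 5, 10, 12, 11, 9, 6]"
  by (auto simp: spec_verts_def pairs21_def)

lemma length_stack21: "length stack21 = 72"
  by (simp add: stack21_def)

lemma faces21: "set ((0, 1, 21) # pairs21) \<subseteq> stack_faces 3 {(0, 1, 2)} stack21"
proof -
  note iff = stack_faces_iff[OF valid_stack21 increasing_base]
  show ?thesis by (simp add: pairs21_def iff length_stack21 del: One_nat_def) (simp add: stack21_def)
qed

lemma framed17: "framed 17 stack17 (0, 1, 17) pairs17"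
  unfolding framed_def
proof (intro conjI)
  show "valence stack17 0 = 17 - 1" "valence stack17 1 = 17 - 1"
    by (simp_all add: valence_def stack17_def)
  show "\<forall>i\<in>spec_verts pairs17. 3 \<le> i" by (simp add: spec_verts17)
  show "2 \<notin> thirds pairs17" by (simp add: thirds_def pairs17_def)
  show "thirds ((0, 1, 17) # pairs17) \<inter> spec_verts ((0, 1, 17) # pairs17) = {}"
    by (simp add: thirds_def spec_verts_def pairs17_def)
  show "2 * length pairs17 = 17 - 3" by (simp add: pairs17_def)
  show "stack17 \<noteq> []" "(0, 2, 3) \<notin> set stack17" by (simp_all add: stack17_def)
qed (fact valid_stack17 faces17 | simp)+

lemma blueprint17: "blueprint 17 stack17 (0, 1, 17) pairs17"
  unfolding blueprint_def
proof (intro conjI)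
  show "framed 17 stack17 (0, 1, 17) pairs17" by (fact framed17)
  show "valence stack17 ` spec_verts pairs17 = {4..17}"
    unfolding spec_verts17 set_map[symmetric] atLeastAtMost_upt
    by (rule arg_cong[of _ _ set]) (simp add: valence_def stack17_def)
qed (simp add: length_stack17)

lemma framed21: "framed 21 stack21 (0, 1, 21) pairs21"
  unfolding framed_def
proof (intro conjI)
  show "valence stack21 0 = 21 - 1" "valence stack21 1 = 21 - 1"
    by (simp_all add: valence_def stack21_def)
  show "\<forall>i\<in>spec_verts pairs21. 3 \<le> i" by (simp add: spec_verts21)
  show "2 \<notin> thirds pairs21" by (simp add: thirds_def pairs21_def)
  show "thirds ((0, 1, 21) # pairs21) \<inter> spec_verts ((0, 1, 21) # pairs21) = {}"
    by (simp add: thirds_def spec_verts_def pairs21_def)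
  show "2 * length pairs21 = 21 - 3" by (simp add: pairs21_def)
  show "stack21 \<noteq> []" "(0, 2, 3) \<notin> set stack21" by (simp_all add: stack21_def)
qed (fact valid_stack21 faces21 | simp)+

lemma pre_blueprint21: "pre_blueprint 21 stack21 (0, 1, 21) pairs21 (9, 11, 12)"
  unfolding pre_blueprint_def
proof (intro conjI)
  show "framed 21 stack21 (0, 1, 21) pairs21" by (fact framed21)
  show "(\<lambda>i. valence stack21 i + deficit (9, 11, 12) i) ` spec_verts pairs21 = {4..21}"
    unfolding spec_verts21 set_map[symmetric] atLeastAtMost_upt
    by (rule arg_cong[of _ _ set]) (simp add: valence_def stack21_def)
  note iff = stack_faces_iff[OF valid_stack21 increasing_base]
  show "(9, 11, 12) \<in> stack_faces 3 {(0, 1, 2)} stack21"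
    by (simp add: iff length_stack21 del: One_nat_def) (simp add: stack21_def)
qed (simp_all add: length_stack21 spec_verts21)

section \<open>Repeated splitting along one edge\<close>

text \<open>This is the list form of an h-splitting of \<open>(a, b, c)\<close> about
  \<open>c\<close>, with new vertices numbered from \<open>N\<close>.\<close>

fun chain :: "nat \<Rightarrow> nat \<Rightarrow> nat \<Rightarrow> nat \<Rightarrow> nat \<Rightarrow> triple list" where
  "chain a b c N 0 = []"
| "chain a b c N (Suc h) = (a, b, c) # chain a b N (Suc N) h"

lemma length_chain [simp]: "length (chain a b c N h) = h"
  by (induction a b c N h rule: chain.induct) auto

lemma occ_chain: "i < N \<Longrightarrow> i \<noteq> c \<Longrightarrow> occ i (chain a b c N h) = (if i = a \<or> i = b then h else 0)"
  by (induction a b c N h rule: chain.induct) auto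

lemma set_chain: "(x, y, w) \<in> set (chain a b c N h) \<Longrightarrow> x = a \<and> y = b"
  by (induction a b c N h rule: chain.induct) auto

lemma split_faces_mono: "F \<subseteq> F' \<Longrightarrow> split_faces F t N \<subseteq> split_faces F' t N"
  by (cases t) auto

lemma valid_stack_mono: "valid_stack N F ts \<Longrightarrow> F \<subseteq> F' \<Longrightarrow> valid_stack N F' ts"
proof (induction ts arbitrary: N F F')
  case (Cons t ts)
  then show ?case using Cons.IH[OF _ split_faces_mono[OF Cons.prems(2)]] by auto
qed simp

lemma stack_faces_mono: "F \<subseteq> F' \<Longrightarrow> stack_faces N F ts \<subseteq> stack_faces N F' ts"
proof (induction ts arbitrary: N F F')
  case (Cons t ts)
  then show ?case using Cons.IH[OF split_faces_mono[OF Cons.prems]] by simp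
qed simp

lemma valid_chain:
  "(a, b, c) \<in> F \<Longrightarrow> increasing N F \<Longrightarrow> valid_stack N F (chain a b c N h) \<and>
     F - {(a, b, c)} \<union> {(a, b, if h = 0 then c else N + h - 1)} \<subseteq> stack_faces N F (chain a b c N h)"
proof (induction h arbitrary: F c N)
  case (Suc h)
  let ?F = "split_faces F (a, b, c) N"
  have "increasing (Suc N) ?F" by (rule increasing_split[OF Suc.prems(2,1)])
  moreover have "(a, b, N) \<in> ?F" by simp
  ultimately have IH: "valid_stack (Suc N) ?F (chain a b N (Suc N) h)"
    "?F - {(a, b, N)} \<union> {(a, b, if h = 0 then N else Suc N + h - 1)} \<subseteq> stack_faces (Suc N) ?F (chain a b N (Suc N) h)"
    using Suc.IH by blast+
  have "(a, b, N) \<notin> F" using Suc.prems(2) by (auto simp: increasing_def)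
  then have "F - {(a, b, c)} \<subseteq> ?F - {(a, b, N)}" by auto
  moreover have "(if h = 0 then N else Suc N + h - 1) = N + Suc h - 1" by simp
  ultimately have "F - {(a, b, c)} \<union> {(a, b, N + Suc h - 1)} \<subseteq> stack_faces (Suc N) ?F (chain a b N (Suc N) h)"
    using IH(2) by auto
  then show ?case using IH(1) Suc.prems(1) by simp
qed simp

text \<open>\<open>F\<close> is a lower bound for the current faces, so that after each group of
  splittings only the faces still to be used have to be listed.\<close>

definition reach :: "triple set \<Rightarrow> triple list \<Rightarrow> bool" where
  "reach F ts \<longleftrightarrow> valid_stack 3 {(0, 1, 2)} ts \<and> F \<subseteq> stack_faces 3 {(0, 1, 2)} ts"

lemma reach_mono: "reach F ts \<Longrightarrow> F' \<subseteq> F \<Longrightarrow> reach F' ts"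
  by (auto simp: reach_def)

lemma reach_increasing:
  assumes "reach F ts" "N = 3 + length ts"
  shows "increasing N F"
  using increasing_stack[OF increasing_base, of ts] assms unfolding reach_def increasing_def by blast

lemma reach_append:
  assumes "reach F ts" "N = 3 + length ts" "valid_stack N F us" "F' \<subseteq> stack_faces N F us"
  shows "reach F' (ts @ us)"
proof -
  have F: "F \<subseteq> stack_faces 3 {(0, 1, 2)} ts" "valid_stack 3 {(0, 1, 2)} ts" using assms(1) by (auto simp: reach_def)
  have "valid_stack N (stack_faces 3 {(0, 1, 2)} ts) us" by (rule valid_stack_mono[OF assms(3) F(1)])
  moreover have "F' \<subseteq> stack_faces N (stack_faces 3 {(0, 1, 2)} ts) us"
    using assms(4) stack_faces_mono[OF F(1)] by (rule subset_trans)
  ultimately show ?thesis using F(2) assms(2) by (simp add: reach_def)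
qed

lemma reach_chain:
  assumes "reach F ts" "N = 3 + length ts" "(a, b, c) \<in> F" "h > 0"
  shows "reach (F - {(a, b, c)} \<union> {(a, b, N + h - 1)}) (ts @ chain a b c N h)"
proof -
  note v = valid_chain[OF assms(3) reach_increasing[OF assms(1,2)], of h]
  show ?thesis by (rule reach_append[OF assms(1,2)]) (use v assms(4) in auto)
qed

lemma valence_append: "valence (ts @ us) i = valence ts i + occ i us"
  by (simp add: valence_def)

lemma valence_fresh: "reach F ts \<Longrightarrow> 3 + length ts \<le> i \<Longrightarrow> valence ts i = 3"
  using occ_fresh[OF increasing_base, of ts i] by (simp add: valence_def reach_def)

lemma spec_verts_Cons [simp]: "spec_verts ((a, b, c) # ps) = {a, b} \<union> spec_verts ps"
  by (simp add: spec_verts_def)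

lemma thirds_Cons [simp]: "thirds ((a, b, c) # ps) = insert c (thirds ps)"
  by (simp add: thirds_def)

lemma spec_verts_bound: "increasing N F \<Longrightarrow> set ps \<subseteq> F \<Longrightarrow> i \<in> spec_verts ps \<Longrightarrow> i < N"
  by (fastforce simp: increasing_def spec_verts_def)

lemma thirds_bound: "increasing N F \<Longrightarrow> set ps \<subseteq> F \<Longrightarrow> i \<in> thirds ps \<Longrightarrow> i < N"
  by (fastforce simp: increasing_def thirds_def)

lemma thirds_mem: "(a, b, c) \<in> set ps \<Longrightarrow> c \<in> thirds ps"
  by (force simp: thirds_def)

section \<open>Completing a blueprint, and passing from q to q + 4\<close>

lemma framedD:
  assumes "framed q ts t ps" "u \<in> stack_faces 3 {(0, 1, 2)} ts"
  obtains z where "t = (0, 1, z)" "reach (insert u (set (t # ps))) ts" "2 < z"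
  using assms by (cases t) (auto simp: framed_def reach_def)

lemma pre_blueprint_close:
  assumes "pre_blueprint q ts t ps u"
  shows "\<exists>ts'. blueprint q ts' t ps"
proof -
  obtain a b c where u: "u = (a, b, c)" by (cases u)
  have fr: "framed q ts t ps" and img: "(\<lambda>i. valence ts i + deficit u i) ` spec_verts ps = {4..q}"
    and len: "4 * (10 + length ts) + 7 * q = q * q + 34" and uF: "u \<in> stack_faces 3 {(0, 1, 2)} ts"
    and us: "{a, b, c} \<subseteq> spec_verts ps"
    using assms u by (auto simp: pre_blueprint_def)
  obtain z where t: "t = (0, 1, z)" and r: "reach (insert u (set (t # ps))) ts" and z2: "2 < z"
    using framedD[OF fr uF] by metis
  define N where "N = 3 + length ts"
  note inc = reach_increasing[OF r N_def]
  have o: "a < b" "b < c" "c < N" using inc u by (auto simp: increasing_def)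
  have dis: "thirds (t # ps) \<inter> spec_verts (t # ps) = {}" and ge3: "\<forall>i\<in>spec_verts ps. 3 \<le> i"
    using fr by (auto simp: framed_def)
  have cs: "c \<in> spec_verts (t # ps)" using us t by simp
  have uP: "u \<notin> set (t # ps)" using dis cs thirds_mem[of a b c "t # ps"] u by blast
  have zb: "z < N" using inc t by (auto simp: increasing_def)
  have sb: "\<And>i. i \<in> spec_verts ps \<Longrightarrow> i < N" using spec_verts_bound[OF inc, of ps] by auto
  define P where "P = set (t # ps)"
  have PN: "(x, y, w) \<notin> P" if "N \<le> w" for x y w
    using inc that unfolding P_def[symmetric] by (auto simp: increasing_def)
  have uP: "u \<notin> P" using uP by (simp add: P_def)
  note r = r[folded P_def] and inc = inc[folded P_def]
  \<comment> \<open>The vertex in \<open>u\<close> gives the corners 1, 1, 1 edges, the two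
    splittings along \<open>ac\<close> give 2, 0, 2 and the four along \<open>bc\<close> give 0, 4,
    4. Seven new vertices thus make up the missing 3, 5, 7.\<close>
  have r1: "reach (P \<union> {(b, c, N), (a, c, N)}) (ts @ [u])"
    by (rule reach_append[OF r N_def]) (use uP u in auto)
  have r2: "reach (P \<union> {(b, c, N)}) ((ts @ [u]) @ chain a c N (N + 1) 2)"
    by (rule reach_mono[OF reach_chain[OF r1]]) (use PN o in \<open>auto simp: N_def\<close>)
  have r3: "reach P (((ts @ [u]) @ chain a c N (N + 1) 2) @ chain b c N (N + 3) 4)"
    by (rule reach_mono[OF reach_chain[OF r2]]) (use PN o in \<open>auto simp: N_def\<close>)
  define ts' where "ts' = ((ts @ [u]) @ chain a c N (N + 1) 2) @ chain b c N (N + 3) 4"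
  have val: "valence ts' i = valence ts i + deficit u i" if "i < N" for i
    using that o u unfolding ts'_def valence_append by (simp add: occ_chain)
  have "blueprint q ts' t ps"
    unfolding blueprint_def framed_def
  proof (intro conjI)
    show "valid_stack 3 {(0, 1, 2)} ts'" "set (t # ps) \<subseteq> stack_faces 3 {(0, 1, 2)} ts'"
      using r3 by (simp_all add: reach_def ts'_def P_def)
    show "ts' \<noteq> []" by (simp add: ts'_def)
    show "(0, 2, 3) \<notin> set ts'"
    proof -
      have "(0, 2, 3) \<notin> set ts" using fr by (simp add: framed_def)
      then show ?thesis using us ge3 u by (auto simp: ts'_def dest!: set_chain)
    qed
    have "0 \<notin> {a, b, c}" "1 \<notin> {a, b, c}" using us ge3 by auto
    then have "deficit u 0 = 0" "deficit u 1 = 0" using u by auto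
    moreover have "0 < N" "1 < N" by (auto simp: N_def)
    ultimately show "valence ts' 0 = q - 1" "valence ts' 1 = q - 1" using fr by (simp_all add: framed_def val)
    show "valence ts' ` spec_verts ps = {4..q}"
      unfolding img[symmetric] by (rule image_cong) (simp_all add: val sb)
    show "4 * (3 + length ts') + 7 * q = q * q + 34" using len by (simp add: ts'_def)
  qed (use fr in \<open>simp_all add: framed_def\<close>)
  then show ?thesis by blast
qed

text \<open>The core vertices \<open>N, \<dots>, N + 3\<close> continue a strip in which each vertex is joined to the three
  before it. The other eight vertices fill all new core faces but the last one, in which the strip will go on.\<close>

definition strip_block :: "nat \<Rightarrow> nat \<Rightarrow> nat \<Rightarrow> nat \<Rightarrow> triple list" where
  "strip_block a b c N = [(a, b, c), (b, c, N), (c, N, N + 1), (N, N + 1, N + 2),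
     (a, b, N), (a, c, N), (b, c, N + 1), (b, N, N + 1), (c, N, N + 2), (c, N + 1, N + 2),
     (N, N + 1, N + 3), (N, N + 2, N + 3)]"

text \<open>The last of the five new faces is the next \<open>u\<close>. The others lie on the edges
  along which degrees will be adjusted; their third vertices \<open>N + 9\<close>,
  \<open>N + 10\<close> and \<open>N + 11\<close> are fillers of core faces.\<close>

lemma strip_block:
  assumes inc: "increasing N (insert (a, b, c) P)" and P: "(a, b, c) \<notin> P"
  shows "valid_stack N (insert (a, b, c) P) (strip_block a b c N)"
    "P \<union> {(N, N + 3, N + 11), (N + 2, N + 3, N + 11), (N + 1, N + 3, N + 10), (N + 1, N + 2, N + 9),
       (N + 1, N + 2, N + 3)} \<subseteq> stack_faces N (insert (a, b, c) P) (strip_block a b c N)"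
proof -
  have o: "a < b" "b < c" "c < N" using inc by (auto simp: increasing_def)
  then have ne: "a \<noteq> b" "b \<noteq> c" "a \<noteq> c" "a < N" "b < N" "a \<noteq> N" "b \<noteq> N" "c \<noteq> N" "N \<noteq> a" "N \<noteq> b" "N \<noteq> c" by auto
  show v: "valid_stack N (insert (a, b, c) P) (strip_block a b c N)"
    by (rule valid_stackI[OF _ _ inc]) (use o ne in \<open>simp_all add: strip_block_def\<close>)
  have old: "s \<in> stack_faces N (insert (a, b, c) P) (strip_block a b c N)" if s: "s \<in> P" for s
  proof -
    obtain x y w where xyw: "s = (x, y, w)" by (cases s)
    have "w < N" using inc s xyw by (auto simp: increasing_def)
    moreover have "s \<noteq> (a, b, c)" using s P by blast
    ultimately have "s \<notin> set (strip_block a b c N)" by (simp add: strip_block_def xyw)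
    then show ?thesis using s unfolding xyw stack_faces_iff[OF v inc] by blast
  qed
  have new: "(x, y, N + k) \<in> stack_faces N (insert (a, b, c) P) (strip_block a b c N)"
    if "(x, y, N + k) \<notin> set (strip_block a b c N)" "k < 12" "side x y (strip_block a b c N ! k)" for x y k
    using that unfolding stack_faces_iff[OF v inc] by (simp add: strip_block_def)
  have "(N, N + 3, N + 11) \<in> stack_faces N (insert (a, b, c) P) (strip_block a b c N)"
    by (rule new) (use o in \<open>simp_all add: strip_block_def\<close>)
  moreover have "(N + 2, N + 3, N + 11) \<in> stack_faces N (insert (a, b, c) P) (strip_block a b c N)"
    by (rule new) (use o in \<open>simp_all add: strip_block_def\<close>)
  moreover have "(N + 1, N + 3, N + 10) \<in> stack_faces N (insert (a, b, c) P) (strip_block a b c N)"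
    by (rule new) (use o in \<open>simp_all add: strip_block_def\<close>)
  moreover have "(N + 1, N + 2, N + 9) \<in> stack_faces N (insert (a, b, c) P) (strip_block a b c N)"
    by (rule new) (use o in \<open>simp_all add: strip_block_def\<close>)
  moreover have "(N + 1, N + 2, N + 3) \<in> stack_faces N (insert (a, b, c) P) (strip_block a b c N)"
    by (rule new) (use o in \<open>simp_all add: strip_block_def\<close>)
  ultimately show "P \<union> {(N, N + 3, N + 11), (N + 2, N + 3, N + 11), (N + 1, N + 3, N + 10), (N + 1, N + 2, N + 9),
       (N + 1, N + 2, N + 3)} \<subseteq> stack_faces N (insert (a, b, c) P) (strip_block a b c N)"
    using old by blast
qed

text \<open>The block placed in \<open>u\<close> makes up the missing 3, 5, 7 at its corners and
  passes the same deficits on to the last three new core vertices. The bound on \<open>q\<close>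
  makes the chain length \<open>A\<close> positive.\<close>

lemma pre_blueprint_step:
  assumes "pre_blueprint q ts t ps u" and q: "12 \<le> q"
  shows "\<exists>ts' t' ps' u'. pre_blueprint (q + 4) ts' t' ps' u'"
proof -
  obtain a b c where u: "u = (a, b, c)" by (cases u)
  have fr: "framed q ts t ps" and img: "(\<lambda>i. valence ts i + deficit u i) ` spec_verts ps = {4..q}"
    and len: "4 * (10 + length ts) + 7 * q = q * q + 34" and uF: "u \<in> stack_faces 3 {(0, 1, 2)} ts"
    and us: "{a, b, c} \<subseteq> spec_verts ps"
    using assms u by (auto simp: pre_blueprint_def)
  obtain z where t: "t = (0, 1, z)" and r: "reach (insert u (set (t # ps))) ts" and z2: "2 < z"
    using framedD[OF fr uF] by metis
  define N where "N = 3 + length ts"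
  note inc = reach_increasing[OF r N_def]
  have o: "a < b" "b < c" "c < N" using inc u by (auto simp: increasing_def)
  have dis: "thirds (t # ps) \<inter> spec_verts (t # ps) = {}" and ge3: "\<forall>i\<in>spec_verts ps. 3 \<le> i"
    using fr by (auto simp: framed_def)
  have cs: "c \<in> spec_verts (t # ps)" using us t by simp
  have uP: "u \<notin> set (t # ps)" using dis cs thirds_mem[of a b c "t # ps"] u by blast
  have zb: "z < N" using inc t by (auto simp: increasing_def)
  have sb: "\<And>i. i \<in> spec_verts ps \<Longrightarrow> i < N" using spec_verts_bound[OF inc, of ps] by auto
  have tb: "\<And>i. i \<in> thirds ps \<Longrightarrow> i < N" using thirds_bound[OF inc, of ps] by auto
  define P where "P = set (t # ps)"
  have PN: "(x, y, w) \<notin> P" if "N \<le> w" for x y w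
    using inc that unfolding P_def[symmetric] by (auto simp: increasing_def)
  have uP: "u \<notin> P" using uP by (simp add: P_def)
  note r = r[folded P_def] and inc = inc[folded P_def]
  \<comment> \<open>After the block, \<open>N\<close>, ..., \<open>N + 3\<close> have degrees 12, 9,
    7, 5, and they are to reach q + 1, q - 1, q - 2, q - 3. They lack A, A + 1, A + 2, A + 3 with A
    = q - 11. Chains of length A on \<open>N\<close>, \<open>N + 3\<close> and on
    \<open>N + 1\<close>, \<open>N + 2\<close>, of length 2 on \<open>N + 2\<close>,
    \<open>N + 3\<close> and of length 1 on \<open>N + 1\<close>, \<open>N + 3\<close> provide
    this.\<close>
  define A where "A = q - 11"
  define blk where "blk = strip_block a b c N"
  note blk_def = blk_def[unfolded strip_block_def]
  define M where "M = N + 12"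
  define Q where "Q = {(N, N + 3, N + 11), (N + 2, N + 3, N + 11), (N + 1, N + 3, N + 10), (N + 1, N + 2, N + 9), (N + 1, N + 2, N + 3)}"
  have vb: "valid_stack N (insert u P) blk" "P \<union> Q \<subseteq> stack_faces N (insert u P) blk"
    using strip_block[of N a b c P] inc uP unfolding u Q_def blk_def strip_block_def by blast+
  have r0: "reach (P \<union> Q) (ts @ blk)" by (rule reach_append[OF r N_def vb])
  define ts1 where "ts1 = ts @ blk @ chain N (N + 3) (N + 11) M A"
  define ts2 where "ts2 = ts1 @ chain (N + 2) (N + 3) (N + 11) (M + A) 2"
  define ts3 where "ts3 = ts2 @ chain (N + 1) (N + 3) (N + 10) (M + A + 2) 1"
  define ts4 where "ts4 = ts3 @ chain (N + 1) (N + 2) (N + 9) (M + A + 3) A"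
  define ts' where "ts' = ts4 @ chain 0 1 z (M + 2 * A + 3) 4"
  have A: "A > 0" using q by (simp add: A_def)
  have lb: "length blk = 12" by (simp add: blk_def)
  have l1: "M + A = 3 + length ts1" by (simp add: ts1_def lb M_def N_def)
  have l2: "M + A + 2 = 3 + length ts2" using l1 by (simp add: ts2_def)
  have l3: "M + A + 3 = 3 + length ts3" using l2 by (simp add: ts3_def)
  have l4: "M + 2 * A + 3 = 3 + length ts4" using l3 by (simp add: ts4_def)
  \<comment> \<open>The pairs \<open>N\<close>, \<open>N + 3\<close> and \<open>N + 1\<close>,
    \<open>N + 2\<close> extend the matching of the prescribed vertices. Each third vertex is the
    last one introduced by the chain on that edge, and likewise for the edge 01.\<close>
  let ?p1 = "(N, N + 3, M + A - 1)" and ?p4 = "(N + 1, N + 2, M + 2 * A + 2)" and ?t = "(0, 1, M + 2 * A + 6)"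
  let ?u = "(N + 1, N + 2, N + 3)"
  have r1: "reach (P \<union> {?p1, (N + 2, N + 3, N + 11), (N + 1, N + 3, N + 10), (N + 1, N + 2, N + 9), ?u}) ts1"
    unfolding ts1_def append_assoc[symmetric]
    by (rule reach_mono[OF reach_chain[OF r0]]) (use PN A in \<open>auto simp: N_def M_def lb Q_def\<close>)
  have r2: "reach (P \<union> {?p1, (N + 1, N + 3, N + 10), (N + 1, N + 2, N + 9), ?u}) ts2"
    unfolding ts2_def by (rule reach_mono[OF reach_chain[OF r1 l1]]) (use PN in auto)
  have r3: "reach (P \<union> {?p1, (N + 1, N + 2, N + 9), ?u}) ts3"
    unfolding ts3_def by (rule reach_mono[OF reach_chain[OF r2 l2]]) (use PN in auto)
  have r4: "reach (P \<union> {?p1, ?p4, ?u}) ts4"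
    unfolding ts4_def by (rule reach_mono[OF reach_chain[OF r3 l3]]) (use PN A in auto)
  have "0 \<notin> spec_verts ps" using ge3 by auto
  then have tps: "(0, 1, z) \<notin> set ps" by (force simp: spec_verts_def)
  have r5: "reach (insert ?u (set (?t # ?p1 # ?p4 # ps))) ts'"
    unfolding ts'_def by (rule reach_mono[OF reach_chain[OF r4 l4]]) (use PN t tps in \<open>auto simp: P_def\<close>)
  have len': "length ts' = length ts + 2 * A + 19" using l4 by (simp add: ts'_def N_def M_def)
  \<comment> \<open>\<open>z\<close> is excluded because the first splitting along the edge 01 gives
    it an edge.\<close>
  have val: "valence ts' i = valence ts i + deficit u i" if "3 \<le> i" "i < N" "i \<noteq> z" for i
    using that o u unfolding ts'_def ts4_def ts3_def ts2_def ts1_def valence_append M_def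
    by (simp add: occ_chain blk_def)
  have val01: "valence ts' i = valence ts i + 4" if "i = 0 \<or> i = 1" for i
  proof -
    have "i < N" "i \<noteq> z" "i \<notin> {a, b, c}" using that z2 us ge3 by (auto simp: N_def)
    then show ?thesis using that o unfolding ts'_def ts4_def ts3_def ts2_def ts1_def valence_append M_def
      by (simp add: occ_chain blk_def)
  qed
  have valw: "valence ts' (N + k) = 3 + occ (N + k) blk + (if k = 0 \<or> k = 3 then A else 0) + (if k = 2 \<or> k = 3 then 2 else 0)
      + (if k = 1 \<or> k = 3 then 1 else 0) + (if k = 1 \<or> k = 2 then A else 0)" if "k < 4" for k
  proof -
    have "valence ts (N + k) = 3" by (rule valence_fresh[OF r]) (simp add: N_def)
    moreover have "N + k \<noteq> z" "N + k \<noteq> 0" "N + k \<noteq> 1" using zb by (auto simp: N_def)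
    ultimately show ?thesis using that unfolding ts'_def ts4_def ts3_def ts2_def ts1_def valence_append M_def
      by (simp add: occ_chain)
  qed
  have w: "valence ts' N = q + 1" "valence ts' (N + 1) + 3 = q + 2" "valence ts' (N + 2) + 5 = q + 3" "valence ts' (N + 3) + 7 = q + 4"
    using valw[of 0] valw[of 1] valw[of 2] valw[of 3] o q by (simp_all add: blk_def A_def)
  let ?ps = "?p1 # ?p4 # ps"
  have spec: "spec_verts ?ps = {N, N + 1, N + 2, N + 3} \<union> spec_verts ps" by auto
  have "pre_blueprint (q + 4) ts' ?t ?ps ?u"
    unfolding pre_blueprint_def framed_def
  proof (intro conjI)
    show "valid_stack 3 {(0, 1, 2)} ts'" "set (?t # ?ps) \<subseteq> stack_faces 3 {(0, 1, 2)} ts'" "?u \<in> stack_faces 3 {(0, 1, 2)} ts'"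
      using r5 by (simp_all add: reach_def)
    show "ts' \<noteq> []" using len' by auto
    show "(0, 2, 3) \<notin> set ts'"
    proof -
      have "(0, 2, 3) \<notin> set ts" using fr by (simp add: framed_def)
      moreover have "0 \<notin> {a, b, c, N, N + 1}" using us ge3 by (auto simp: N_def)
      moreover have "fst s \<in> {a, b, c, N, N + 1}" if "s \<in> set blk" for s using that by (auto simp: blk_def)
      ultimately have "(0, 2, 3) \<notin> set (ts @ blk)" by fastforce
      then show ?thesis
        by (auto simp: ts'_def ts4_def ts3_def ts2_def ts1_def N_def dest!: set_chain)
    qed
    show "valence ts' 0 = q + 4 - 1" "valence ts' 1 = q + 4 - 1" using fr q by (simp_all add: val01 framed_def)
    show "2 * length ?ps = q + 4 - 3" using fr q by (simp add: framed_def)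
    show "\<forall>i\<in>spec_verts ?ps. 3 \<le> i" unfolding spec using ge3 by (auto simp: N_def)
    show "2 \<notin> thirds ?ps" using fr A by (auto simp: framed_def M_def N_def)
    have "spec_verts ps \<inter> thirds ps = {}" "0 \<notin> thirds ps" "1 \<notin> thirds ps" using dis t by auto
    then show "thirds (?t # ?ps) \<inter> spec_verts (?t # ?ps) = {}"
      using sb tb A by (fastforce simp: M_def N_def)
    have "(\<lambda>i. valence ts' i + deficit ?u i) ` spec_verts ps = {4..q}"
      unfolding img[symmetric]
    proof (rule image_cong)
      fix i assume i: "i \<in> spec_verts ps"
      have "i \<noteq> z" using dis t i by auto
      then show "valence ts' i + deficit ?u i = valence ts i + deficit u i" using val[of i] sb[OF i] ge3 i by simp
    qed simp
    moreover have "valence ts' N + deficit ?u N = q + 1" "valence ts' (N + 1) + deficit ?u (N + 1) = q + 2"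
      "valence ts' (N + 2) + deficit ?u (N + 2) = q + 3" "valence ts' (N + 3) + deficit ?u (N + 3) = q + 4"
      using w by simp_all
    then have "(\<lambda>i. valence ts' i + deficit ?u i) ` {N, N + 1, N + 2, N + 3} = {q + 1, q + 2, q + 3, q + 4}"
      by (simp only: image_insert image_empty)
    ultimately have "(\<lambda>i. valence ts' i + deficit ?u i) ` spec_verts ?ps = {q + 1, q + 2, q + 3, q + 4} \<union> {4..q}"
      unfolding spec image_Un by simp
    also have "\<dots> = {4..q + 4}" using q by auto
    finally show "(\<lambda>i. valence ts' i + deficit ?u i) ` spec_verts ?ps = {4..q + 4}" .
    have "length ts' + 3 = length ts + 2 * q" using q len' by (simp add: A_def)
    then show "4 * (10 + length ts') + 7 * (q + 4) = (q + 4) * (q + 4) + 34" using len by (simp add: algebra_simps)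
  qed (auto simp: M_def N_def)
  then show ?thesis by blast
qed

lemma exists_blueprint:
  assumes "17 \<le> q" "q mod 4 = 1"
  shows "\<exists>ts t ps. blueprint q ts t ps"
proof (cases "q = 17")
  case True
  then show ?thesis using blueprint17 by blast
next
  case False
  define k where "k = (q - 21) div 4"
  have qk: "q = 21 + 4 * k" using assms False unfolding k_def by presburger
  have "\<exists>ts t ps u. pre_blueprint (21 + 4 * k) ts t ps u" for k
  proof (induction k)
    case 0
    show ?case using pre_blueprint21 by (simp only: mult_0_right add_0_right) blast
  next
    case (Suc k)
    then obtain ts t ps u where "pre_blueprint (21 + 4 * k) ts t ps u" by blast
    then have "\<exists>ts t ps u. pre_blueprint (21 + 4 * k + 4) ts t ps u" by (rule pre_blueprint_step) simp
    then show ?case by (simp add: algebra_simps)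
  qed
  then show ?thesis using pre_blueprint_close unfolding qk by blast
qed

subsection \<open>The auxiliary graphs\<close>

text \<open>A triangle that is never split may be struck off the initial faces; this will be applied
  to {0, 2, 3}.\<close>

lemma valid_stack_remove:
  "valid_stack N F ts \<Longrightarrow> x \<notin> set ts \<Longrightarrow> valid_stack N (F - {x}) ts"
proof (induction ts arbitrary: N F)
  case (Cons t ts)
  have "valid_stack (Suc N) (split_faces F t N - {x}) ts" using Cons by auto
  moreover have "split_faces F t N - {x} \<subseteq> split_faces (F - {x}) t N" by (cases t) auto
  ultimately have "valid_stack (Suc N) (split_faces (F - {x}) t N) ts" by (rule valid_stack_mono)
  then show ?case using Cons.prems by auto
qed simp

definition stacked_graph :: "triple list \<Rightarrow> nat sgraph" where
  "stacked_graph ts = stack (\<lambda>i. i) 3 (triangle_graph 0 1 2) ts"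

lemma simple_triangle_graph: "u \<noteq> v \<Longrightarrow> v \<noteq> w \<Longrightarrow> u \<noteq> w \<Longrightarrow> simple_graph (triangle_graph u v w)"
  by (simp add: simple_graph_def triangle_graph_def)

lemma deg_triangle_graph:
  assumes "u \<noteq> v" "v \<noteq> w" "u \<noteq> w" "x \<in> {u, v, w}"
  shows "deg (triangle_graph u v w) x = 2"
proof -
  have eq: "{e \<in> {{u, v}, {v, w}, {u, w}}. x \<in> e} = (if x = u then {{u, v}, {u, w}} else if x = v then {{u, v}, {v, w}} else {{v, w}, {u, w}})"
    using assms by auto
  show ?thesis unfolding deg_def triangle_graph_def using eq assms by (auto simp: doubleton_eq_iff)
qed

context
  fixes q ts t ps
  assumes bp: "blueprint q ts t ps"
begin

lemma blueprint_facts: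
  shows "valid_stack 3 {(0, 1, 2)} ts" "ts \<noteq> []" "set (t # ps) \<subseteq> stack_faces 3 {(0, 1, 2)} ts"
    "fst t = 0" "fst (snd t) = 1" "valence ts 0 = q - 1" "valence ts 1 = q - 1" "2 * length ps = q - 3"
    "\<And>i. i \<in> spec_verts ps \<Longrightarrow> 3 \<le> i" "2 \<notin> thirds ps" "thirds (t # ps) \<inter> spec_verts (t # ps) = {}"
    "2 < snd (snd t)" "(0, 2, 3) \<notin> set ts" "valence ts ` spec_verts ps = {4..q}"
    "4 * (3 + length ts) + 7 * q = q * q + 34"
  using bp by (auto simp: blueprint_def framed_def)

lemma stack_hd: "ts = (0, 1, 2) # tl ts"
  using blueprint_facts(1,2) by (cases ts) auto

lemma verts_stacked_graph: "verts (stacked_graph ts) = {..<3 + length ts}"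
  unfolding stacked_graph_def verts_stack by (auto simp: triangle_graph_def)

lemma stacked_graph_props:
  shows "simple_graph (stacked_graph ts)"
    "i < 3 + length ts \<Longrightarrow> deg (stacked_graph ts) i = valence ts i"
proof -
  have s: "simple_graph (triangle_graph (0::nat) 1 2)" by (rule simple_triangle_graph) auto
  have v: "{..<3} \<subseteq> verts (triangle_graph (0::nat) 1 2)" by (auto simp: triangle_graph_def)
  have f: "{3..<3 + length ts} \<inter> verts (triangle_graph (0::nat) 1 2) = {}" by (auto simp: triangle_graph_def)
  note p = stack_props[OF s increasing_base blueprint_facts(1), of "\<lambda>i. i"]
  show "simple_graph (stacked_graph ts)" unfolding stacked_graph_def by (rule p(1)) (use v f in auto)
  assume i: "i < 3 + length ts"
  have "deg (stacked_graph ts) i = (if i < 3 then deg (triangle_graph 0 1 2) i else 3) + occ i ts"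
    unfolding stacked_graph_def by (rule p(3)[where i = i]) (use v f i in auto)
  moreover have "deg (triangle_graph (0::nat) 1 2) i = 2" if "i < 3"
    by (rule deg_triangle_graph) (use that in auto)
  ultimately show "deg (stacked_graph ts) i = valence ts i" by (simp add: valence_def)
qed

text \<open>3-connectedness begins with four vertices, so it is propagated from the first splitting
  on and not from the triangle.\<close>

abbreviation K4 :: "nat sgraph" where "K4 \<equiv> split_triangle (triangle_graph 0 1 2) 0 1 2 3"

lemma K4_connected: "k_connected 3 K4" "simple_graph K4" "verts K4 = {..<4}"
proof -
  show v: "verts K4 = {..<4}" by (auto simp: triangle_graph_def)
  show s: "simple_graph K4"
    by (rule simple_graph_split_triangle) (auto simp: triangle_graph_def intro!: simple_triangle_graph[unfolded triangle_graph_def])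
  have e: "{u, w} \<in> edges K4" if "u \<in> verts K4" "w \<in> verts K4" "u \<noteq> w" for u w
    using that by (auto simp: triangle_graph_def insert_commute)
  show "k_connected 3 K4" unfolding k_connected_def
  proof (intro conjI allI impI)
    show "3 + 1 \<le> card (verts K4)" unfolding v by simp
    fix X :: "nat set"
    show "graph_connected (delete_verts K4 X)"
      unfolding graph_connected_def
    proof (intro ballI)
      fix u w assume uw: "u \<in> verts (delete_verts K4 X)" "w \<in> verts (delete_verts K4 X)"
      show "(u, w) \<in> {(x, y). {x, y} \<in> edges (delete_verts K4 X)}\<^sup>*"
      proof (cases "u = w")
        case False
        then have "{u, w} \<in> edges (delete_verts K4 X)"
          using uw e[of u w] by (auto simp: delete_verts_def)
        then show ?thesis by auto
      qed simp
    qed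
  qed
qed

lemma stacked_graph_tl: "stacked_graph ts = stack (\<lambda>i. i) 4 K4 (tl ts)"
proof -
  obtain us where us: "ts = (0, 1, 2) # us" using stack_hd by blast
  show ?thesis unfolding stacked_graph_def us by simp
qed

lemma valid_tl: "valid_stack 4 {(0, 1, 3), (1, 2, 3), (0, 2, 3)} (tl ts)"
proof -
  obtain us where us: "ts = (0, 1, 2) # us" using stack_hd by blast
  show ?thesis using blueprint_facts(1) unfolding us by (simp add: insert_commute)
qed

lemma stacked_graph_connected: "k_connected 3 (stacked_graph ts)"
  unfolding stacked_graph_tl
  by (rule stack_props(2)[OF K4_connected(2) _ valid_tl _ _ _ K4_connected(1)])
     (auto simp: triangle_graph_def increasing_def)

lemma stacked_graph_faces:
  "faces_realized (stacked_graph ts) (triple_image (\<lambda>i. i) ` stack_faces 3 {(0, 1, 2)} ts)"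
proof -
  have "faces_realized (stack (\<lambda>i. i) 3 (triangle_graph 0 1 2) ts)
      ({} \<union> triple_image (\<lambda>i. i) ` stack_faces 3 {(0, 1, 2)} ts)"
    by (rule stack_faces_realized[OF _ increasing_base blueprint_facts(1)])
      (use triangle_graph_realized[of "0::nat" 1 2] in \<open>auto simp: triple_image_def triangle_graph_def\<close>)
  then show ?thesis by (simp add: stacked_graph_def)
qed

text \<open>The face \<open>{0, 1, 2}\<close> is lost by the first split. To see that it is a face nevertheless, the first four
  vertices are obtained by splitting \<open>{0, 2, 3}\<close> instead, a triangle that is not used later.\<close>

lemma stacked_graph_base_face: "faces_realized (stacked_graph ts) {{0, 1, 2}}"
proof -
  have "faces_realized (triangle_graph (0::nat) 2 3) {{0, 2, 3}}" by (rule triangle_graph_realized) auto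
  then have "faces_realized (split_triangle (triangle_graph (0::nat) 2 3) 0 2 3 1)
      ({{0, 2, 3}} - {{0, 2, 3}} \<union> {{0, 2, 1}, {2, 3, 1}, {0, 3, 1}})"
    by (rule faces_realized_split) (auto simp: triangle_graph_def)
  moreover have "split_triangle (triangle_graph (0::nat) 2 3) 0 2 3 1 = K4"
    by (auto simp: split_triangle_def triangle_graph_def insert_commute)
  ultimately have r: "faces_realized K4 {{0, 2, 1}, {2, 3, 1}, {0, 3, 1}}" by simp
  have v: "valid_stack 4 {(0, 1, 3), (1, 2, 3)} (tl ts)"
  proof -
    have "(0, 2, 3) \<notin> set (tl ts)" using blueprint_facts(13) by (auto dest: list.set_sel(2)[OF blueprint_facts(2)])
    from valid_stack_remove[OF valid_tl this] show ?thesis by (rule valid_stack_mono) auto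
  qed
  have "faces_realized (stack (\<lambda>i. i) 4 K4 (tl ts))
      ({{0, 1, 2}} \<union> triple_image (\<lambda>i. i) ` stack_faces 4 {(0, 1, 3), (1, 2, 3)} (tl ts))"
  proof (rule stack_faces_realized[OF _ _ v])
    show "faces_realized K4 ({{0, 1, 2}} \<union> triple_image (\<lambda>i. i) ` {(0, 1, 3), (1, 2, 3)})"
      by (rule faces_realized_mono[OF r]) (auto simp: triple_image_def)
    show "{{0, 1, 2}} \<inter> triple_image (\<lambda>i. i) ` {(0, 1, 3), (1, 2, 3)} = {}"
      by (auto simp: triple_image_def set_eq_iff)
  qed (auto simp: increasing_def triangle_graph_def)
  then show ?thesis unfolding stacked_graph_tl by (rule faces_realized_mono) simp
qed

end

fun corner :: "triple \<Rightarrow> nat \<Rightarrow> nat" where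
  "corner (a, b, c) i = (if i = 1 then a else if i = 2 then b else c)"

lemma spec_verts_corner: "spec_verts ps = (\<Union>u\<in>set ps. {corner u 1, corner u 2})"
proof -
  have "(case u of (a, b, c) \<Rightarrow> {a, b}) = {corner u 1, corner u 2}" for u by (cases u) simp
  then show ?thesis unfolding spec_verts_def by (rule SUP_cong[OF refl])
qed

lemma thirds_corner: "thirds ps = (\<Union>u\<in>set ps. {corner u 3})"
proof -
  have "(case u of (a, b, c) \<Rightarrow> {c}) = {corner u 3}" for u by (cases u) simp
  then show ?thesis unfolding thirds_def by (rule SUP_cong[OF refl])
qed

lemma corner_spec_verts: "(\<lambda>u. corner u 1) ` set ps \<union> (\<lambda>u. corner u 2) ` set ps = spec_verts ps"
  unfolding spec_verts_corner by blast

lemma corner_in: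
  "u \<in> set ps \<Longrightarrow> corner u 1 \<in> spec_verts ps" "u \<in> set ps \<Longrightarrow> corner u 2 \<in> spec_verts ps"
  "u \<in> set ps \<Longrightarrow> corner u 3 \<in> thirds ps"
  unfolding spec_verts_corner thirds_corner by blast+

lemma corner_image: "{f (corner u 1), f (corner u 2), f (corner u 3)} = triple_image f u"
  by (cases u) (simp add: triple_image_def)

lemma blueprint_auxiliary_graph:
  assumes bp: "blueprint (m + 3) ts t ps" and m: "even m"
  shows "auxiliary_graph m (stacked_graph ts) (\<lambda>j. corner ((t # ps) ! (j - 1)))"
proof -
  note facts = blueprint_facts[OF bp]
  let ?s = "stacked_graph ts"
  note dg = stacked_graph_props(2)[OF bp]
  have L: "(m + 2) div 2 = Suc (length ps)" using facts(8) m by simp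
  obtain z where t: "t = (0, 1, z)" using facts(4,5) by (cases t) auto
  let ?x = "\<lambda>j. corner ((t # ps) ! (j - 1))"
  have mem: "(t # ps) ! (j - 1) \<in> set (t # ps)" if "j \<in> {1..(m + 2) div 2}" for j
    using that L by (intro nth_mem) auto
  have inc: "increasing (3 + length ts) (stack_faces 3 {(0, 1, 2)} ts)"
    by (rule increasing_stack[OF increasing_base facts(1)])
  have sb: "i < 3 + length ts" if "i \<in> spec_verts ps" for i
    by (rule spec_verts_bound[OF inc _ that]) (use facts(3) in auto)
  obtain p \<gamma> where emb: "sphere_embedding ?s p \<gamma>"
    "\<And>u. u \<in> stack_faces 3 {(0, 1, 2)} ts \<Longrightarrow> triangular_face ?s p \<gamma> (triple_image (\<lambda>i. i) u)"
    using stacked_graph_faces[OF bp] unfolding faces_realized_def by auto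
  have ps_im: "{2..(m + 2) div 2} = (\<lambda>i. i + 2) ` {..<length ps}"
  proof (intro set_eqI iffI)
    fix j assume "j \<in> {2..(m + 2) div 2}"
    then have "j - 2 < length ps" "j = (j - 2) + 2" unfolding L by auto
    then show "j \<in> (\<lambda>i. i + 2) ` {..<length ps}" by blast
  next
    fix j assume "j \<in> (\<lambda>i. i + 2) ` {..<length ps}"
    then show "j \<in> {2..(m + 2) div 2}" unfolding L by auto
  qed
  have nth_im: "(\<lambda>j. (t # ps) ! (j - 1)) ` {2..(m + 2) div 2} = set ps"
    unfolding ps_im image_image by (auto simp: set_conv_nth)
  show ?thesis
    unfolding auxiliary_graph_def
  proof (intro conjI)
    show "three_polytope ?s"
      unfolding three_polytope_def planar_def
      using stacked_graph_props(1)[OF bp] stacked_graph_connected[OF bp] emb(1) by blast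
    have "4 * real (card (verts ?s)) + 7 * (real m + 3) = (real m + 3) * (real m + 3) + 34"
      using arg_cong[OF facts(15), of real] unfolding verts_stacked_graph[OF bp] by simp
    then show "real (card (verts ?s)) = ((real m + 3)\<^sup>2 - 7 * (real m + 3) + 34) / 4"
      by (simp add: power2_eq_square field_simps)
    \<comment> \<open>This is the vertex introduced last.\<close>
    have "deg ?s (2 + length ts) = 3"
      using dg[of "2 + length ts"] occ_fresh[OF increasing_base facts(1), of "2 + length ts"] facts(2)
      by (cases ts) (auto simp: valence_def)
    moreover have "2 + length ts \<in> verts ?s" by (simp add: verts_stacked_graph[OF bp])
    ultimately show "\<exists>w\<in>verts ?s. deg ?s w = 3" by blast
    show "\<exists>p \<gamma>. sphere_embedding ?s p \<gamma> \<and> (\<forall>j\<in>{1..(m + 2) div 2}. triangular_face ?s p \<gamma> {?x j 1, ?x j 2, ?x j 3})"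
    proof (intro exI conjI ballI)
      show "sphere_embedding ?s p \<gamma>" by (rule emb(1))
      fix j assume "j \<in> {1..(m + 2) div 2}"
      then have "(t # ps) ! (j - 1) \<in> stack_faces 3 {(0, 1, 2)} ts" using mem facts(3) by blast
      from emb(2)[OF this] show "triangular_face ?s p \<gamma> {?x j 1, ?x j 2, ?x j 3}"
        unfolding corner_image[of "\<lambda>i. i"] .
    qed
    show "deg ?s (?x 1 1) = m + 2" "deg ?s (?x 1 2) = m + 2"
      using dg[of 0] dg[of 1] facts(6,7) by (simp_all add: t)
    have "(\<lambda>j. deg ?s (?x j 1)) ` {2..(m + 2) div 2} \<union> (\<lambda>j. deg ?s (?x j 2)) ` {2..(m + 2) div 2}
        = deg ?s ` ((\<lambda>u. corner u 1) ` set ps \<union> (\<lambda>u. corner u 2) ` set ps)"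
      unfolding nth_im[symmetric] image_Un image_image ..
    also have "\<dots> = valence ts ` spec_verts ps"
      unfolding corner_spec_verts by (rule image_cong) (use dg sb in auto)
    finally show "(\<lambda>j. deg ?s (?x j 1)) ` {2..(m + 2) div 2} \<union> (\<lambda>j. deg ?s (?x j 2)) ` {2..(m + 2) div 2} = {4..m + 3}"
      using facts(14) by simp
    show "\<forall>i\<in>{1..(m + 2) div 2}. \<forall>j\<in>{1..(m + 2) div 2}. ?x j 3 \<noteq> ?x i 1 \<and> ?x j 3 \<noteq> ?x i 2"
    proof (intro ballI)
      fix i j assume ij: "i \<in> {1..(m + 2) div 2}" "j \<in> {1..(m + 2) div 2}"
      have "?x j 3 \<in> thirds (t # ps)" "?x i 1 \<in> spec_verts (t # ps)" "?x i 2 \<in> spec_verts (t # ps)"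
        using mem ij by (simp_all only: corner_in)
      then show "?x j 3 \<noteq> ?x i 1 \<and> ?x j 3 \<noteq> ?x i 2" using facts(11) by force
    qed
  qed
qed

subsection \<open>The algorithm\<close>

lemma last_map_upt: "m > 0 \<Longrightarrow> last (map f [a..<a + m]) = f (a + m - 1)"
  by (simp add: last_map)

text \<open>Gluing the copy amounts to growing its stack inside the triangle, so the other faces
  survive. The prescribed vertices of \<open>G\<close> all gain \<open>m\<close> edges, which moves
  their degrees from 4, ..., n to m + 4, ..., m + n; the copy supplies the degrees 4, ..., m +
  3.\<close>

lemma algorithm_step_exists:
  fixes G :: "'a::infinite sgraph"
  assumes bp: "blueprint (m + 3) ts t ps" and m: "0 < m" "even m"
    and n: "5 \<le> n" "odd n" and poly: "three_polytope G" and Q: "property_Q n G" and QT: "Q_triangles n G v"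
  shows "\<exists>G' v'. algorithm_step m (stacked_graph ts) n v G G' \<and> three_polytope G' \<and> property_Q (n + m) G' \<and>
    Q_triangles (n + m) G' v' \<and> subgraph G G' \<and>
    card (verts G') = card (verts G) + m * ((n - 3) div 2 - 1) + length ts"
proof -
  note facts = blueprint_facts[OF bp]
  obtain z where t: "t = (0, 1, z)" and z: "2 < z" using facts(4,5,12) by (cases t) auto
  define L where "L = length ps"
  have mL: "m = 2 * L" using facts(8) by (simp add: L_def)
  define r where "r = (n - 3) div 2"
  have r1: "1 \<le> r" and nr: "n = 2 * r + 3" using n unfolding r_def by presburger+
  have G: "simple_graph G" "k_connected 3 G" using poly by (auto simp: three_polytope_def)
  have finV: "finite (verts G)" using G(1) by (simp add: simple_graph_def)
  obtain p \<gamma> where emb: "sphere_embedding G p \<gamma>" "\<forall>j\<in>{1..r}. triangular_face G p \<gamma> {v j 1, v j 2, v j 3}"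
    and degs: "(\<lambda>j. deg G (v j 1)) ` {1..r} \<union> (\<lambda>j. deg G (v j 2)) ` {1..r} = {4..n}"
    and thirds: "\<And>i j. i \<in> {1..r} \<Longrightarrow> j \<in> {1..r} \<Longrightarrow> v j 3 \<noteq> v i 1 \<and> v j 3 \<noteq> v i 2"
  proof -
    obtain p \<gamma> where "sphere_embedding G p \<gamma>" "\<forall>j\<in>{1..r}. triangular_face G p \<gamma> {v j 1, v j 2, v j 3}"
      using QT unfolding Q_triangles_def r_def by (elim conjE exE)
    moreover have "(\<lambda>j. deg G (v j 1)) ` {1..r} \<union> (\<lambda>j. deg G (v j 2)) ` {1..r} = {4..n}"
      using QT unfolding Q_triangles_def r_def by (elim conjE)
    moreover have "\<forall>i\<in>{1..r}. \<forall>j\<in>{1..r}. v j 3 \<noteq> v i 1 \<and> v j 3 \<noteq> v i 2"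
      using QT unfolding Q_triangles_def r_def by (elim conjE)
    ultimately show thesis by (intro that) simp_all
  qed
  define T where "T j = {v j 1, v j 2, v j 3}" for j
  have fr0: "faces_realized G (T ` {1..r})" 
    using G(1) emb unfolding faces_realized_def T_def by (intro conjI exI[of _ p] exI[of _ \<gamma>]) auto
  have TV: "v j 1 \<in> verts G" "v j 2 \<in> verts G" "v j 3 \<in> verts G" "card (T j) = 3" if "j \<in> {1..r}" for j
    using faces_realizedD(1,2)[OF fr0, of "T j"] that by (auto simp: T_def)
  \<comment> \<open>There are 2r = n - 3 index pairs and as many degrees, so the degrees, and with
    them the vertices, are distinct.\<close>
  have injv: "inj_on (\<lambda>(j, i). v j i) ({1..r} \<times> {1, 2::nat})"
  proof -
    have "(\<lambda>(j, i). deg G (v j i)) ` ({1..r} \<times> {1, 2::nat}) = {4..n}" unfolding degs[symmetric] by force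
    then have "inj_on (\<lambda>(j, i). deg G (v j i)) ({1..r} \<times> {1, 2::nat})"
      by (intro eq_card_imp_inj_on) (use nr in auto)
    then have "inj_on (deg G \<circ> (\<lambda>(j, i). v j i)) ({1..r} \<times> {1, 2::nat})" by (simp add: comp_def case_prod_unfold)
    then show ?thesis by (rule inj_on_imageI2)
  qed
  have vne: "v i a \<noteq> v j b" if "i \<in> {1..r}" "j \<in> {1..r}" "a \<in> {1, 2}" "b \<in> {1, 2}" "i \<noteq> j \<or> a \<noteq> b" for i j a b
    using inj_onD[OF injv, of "(i, a)" "(j, b)"] that by auto
  have notT: "v i 1 \<notin> T j" if "i \<in> {1..r}" "j \<in> {1..r}" "i \<noteq> j" for i j
    using vne[of i j 1 1] vne[of i j 1 2] thirds[of i j] that by (auto simp: T_def)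
  have v3: "v j 3 \<notin> {v i 1, v i 2}" if "i \<in> {1..r}" "j \<in> {1..r}" for i j using thirds that by auto
  have "infinite (UNIV - verts G)" by (rule Diff_infinite_finite[OF finV infinite_UNIV])
  then obtain fresh :: "nat \<Rightarrow> 'a" where fresh: "inj fresh" "range fresh \<subseteq> UNIV - verts G"
    using infinite_countable_subset by blast
  have fr_new: "fresh i \<notin> verts G" for i using fresh(2) by auto
  have fr_eq: "fresh i = fresh j \<longleftrightarrow> i = j" for i j using fresh(1) by (simp add: inj_eq)
  define ds where "ds j = map fresh [m * j..<m * j + m]" for j
  have ds: "length (ds j) = m" "distinct (ds j)" "set (ds j) = fresh ` {m * j..<m * j + m}" "ds j \<noteq> []"
    "last (ds j) = fresh (m * j + m - 1)" for j
    using fresh(1) m(1) by (auto simp: ds_def distinct_map inj_on_def inj_def last_map_upt)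
  \<comment> \<open>Index shift: in \<open>HH k\<close> the triangles 2, ..., k + 1 have been split,
    so it is \<open>H (k + 1)\<close> of the algorithm. Triangle \<open>j\<close> uses the
    \<open>m\<close> fresh vertices numbered from \<open>m * j\<close>.\<close>
  define HH where "HH = rec_nat G (\<lambda>k g. split_about g (v (k + 2) 1) (v (k + 2) 2) (v (k + 2) 3) (ds (k + 2)))"
  have HH: "HH 0 = G" "HH (Suc k) = split_about (HH k) (v (k + 2) 1) (v (k + 2) 2) (v (k + 2) 3) (ds (k + 2))" for k
    by (simp_all add: HH_def)
  define w where "w k j = (if 2 \<le> j \<and> j \<le> k + 1 then last (ds j) else v j 3)" for k j :: nat
  define Tk where "Tk k j = {v j 1, v j 2, w k j}" for k j
  have inv: "simple_graph (HH k) \<and> k_connected 3 (HH k) \<and> verts (HH k) = verts G \<union> fresh ` {2 * m..<m * (k + 2)} \<and>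
      edges G \<subseteq> edges (HH k) \<and> faces_realized (HH k) (Tk k ` {1..r}) \<and>
      (\<forall>j\<in>{1..r}. \<forall>i\<in>{1, 2}. deg (HH k) (v j i) = deg G (v j i) + (if 2 \<le> j \<and> j \<le> k + 1 then m else 0))"
    if "k + 1 \<le> r" for k
    using that
  proof (induction k)
    case 0
    have "Tk 0 j = T j" for j by (auto simp: Tk_def T_def w_def)
    then show ?case using G fr0 by (auto simp: HH)
  next
    case (Suc k)
    let ?j = "k + 2"
    have j: "?j \<in> {1..r}" using Suc.prems by auto
    have IH: "simple_graph (HH k)" "k_connected 3 (HH k)" "verts (HH k) = verts G \<union> fresh ` {2 * m..<m * (k + 2)}"
      "edges G \<subseteq> edges (HH k)" "faces_realized (HH k) (Tk k ` {1..r})"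
      "\<And>j i. j \<in> {1..r} \<Longrightarrow> i \<in> {1, 2} \<Longrightarrow> deg (HH k) (v j i) = deg G (v j i) + (if 2 \<le> j \<and> j \<le> k + 1 then m else 0)"
      using Suc.IH Suc.prems by auto
    have Tj: "Tk k ?j = T ?j" by (simp add: Tk_def T_def w_def)
    have c3: "card {v ?j 1, v ?j 2, v ?j 3} = 3" using TV(4)[OF j] by (simp add: T_def)
    have sub: "{v ?j 1, v ?j 2, v ?j 3} \<subseteq> verts (HH k)" using TV(1-3)[OF j] IH(3) by auto
    have dis: "set (ds ?j) \<inter> verts (HH k) = {}" unfolding ds IH(3) using fr_new fr_eq by (auto simp: algebra_simps)
    note pr = split_about_props[OF IH(1) c3 sub ds(2) dis, folded HH(2)]
    have un: "{2 * m..<m * (Suc k + 2)} = {2 * m..<m * (k + 2)} \<union> {m * (k + 2)..<m * (k + 2) + m}"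
      by (auto simp: algebra_simps)
    have fr: "faces_realized (HH (Suc k)) (Tk k ` {1..r} - {T ?j} \<union> {{v ?j 1, v ?j 2, last (ds ?j)}})"
      unfolding HH(2) T_def by (rule split_about_faces[OF IH(5) _ ds(2) dis ds(4)]) (use j Tj T_def in auto)
    have "Tk (Suc k) j \<in> Tk k ` {1..r} - {T ?j} \<union> {{v ?j 1, v ?j 2, last (ds ?j)}}" if jr: "j \<in> {1..r}" for j
    proof (cases "j = ?j")
      case True
      then show ?thesis by (simp add: Tk_def w_def)
    next
      case False
      then have eq: "Tk (Suc k) j = Tk k j" by (auto simp: Tk_def w_def)
      have "v j 1 \<in> Tk k j" by (simp add: Tk_def)
      then have "Tk k j \<noteq> T ?j" using notT[OF jr j False] by metis
      then show ?thesis using eq jr by auto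
    qed
    then have fr: "faces_realized (HH (Suc k)) (Tk (Suc k) ` {1..r})" by (intro faces_realized_mono[OF fr] image_subsetI)
    have dg: "deg (HH (Suc k)) (v j i) = deg G (v j i) + (if 2 \<le> j \<and> j \<le> Suc k + 1 then m else 0)"
      if ji: "j \<in> {1..r}" "i \<in> {1, 2}" for j i
    proof -
      have "v j i \<in> verts (HH k)" using TV(1,2)[OF ji(1)] ji(2) IH(3) by auto
      moreover have "v j i \<noteq> v ?j 3" using v3[OF ji(1) j] ji(2) by auto
      ultimately have "deg (HH (Suc k)) (v j i) = deg (HH k) (v j i) + (if v j i \<in> {v ?j 1, v ?j 2} then m else 0)"
        using pr(5) ds(1) by simp
      moreover have "v j i \<in> {v ?j 1, v ?j 2} \<longleftrightarrow> j = ?j"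
        using vne[OF ji(1) j ji(2)] ji(2) by blast
      ultimately show ?thesis using IH(6)[OF ji] by auto
    qed
    show ?case
    proof (intro conjI)
      show "simple_graph (HH (Suc k))" "k_connected 3 (HH (Suc k))" using pr(1,4) IH(2) by auto
      show "verts (HH (Suc k)) = verts G \<union> fresh ` {2 * m..<m * (Suc k + 2)}"
        unfolding pr(2) IH(3) ds un image_Un by blast
      show "edges G \<subseteq> edges (HH (Suc k))" using pr(3) IH(4) by blast
    qed (use fr dg in blast)+
  qed
  define g where "g = HH (r - 1)"
  \<comment> \<open>The splittings use the numbers from 2m to B - 1; a vertex \<open>i\<close> of
    the copy outside the gluing triangle gets the number B + i.\<close>
  define B where "B = m * (r + 1)"
  have r1': "r - 1 + 1 \<le> r" using r1 by simp
  have gp: "simple_graph g" "k_connected 3 g" "verts g = verts G \<union> fresh ` {2 * m..<B}"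
      "edges G \<subseteq> edges g" "faces_realized g (Tk (r - 1) ` {1..r})"
      "\<And>j i. j \<in> {1..r} \<Longrightarrow> i \<in> {1, 2} \<Longrightarrow> deg g (v j i) = deg G (v j i) + (if 2 \<le> j then m else 0)"
    using inv[OF r1'] r1 unfolding g_def B_def by auto
  define f where "f i = (if i = 0 then v 1 1 else if i = 1 then v 1 2 else if i = 2 then v 1 3 else fresh (B + i))" for i :: nat
  have f0: "f 0 = v 1 1" "f 1 = v 1 2" "f 2 = v 1 3" "f (Suc 0) = v 1 2" by (simp_all add: f_def)
  have f3: "f i = fresh (B + i)" if "3 \<le> i" for i using that by (simp add: f_def)
  have one: "1 \<in> {1..r}" using r1 by simp
  have v1: "v 1 1 \<noteq> v 1 2" "v 1 1 \<noteq> v 1 3" "v 1 2 \<noteq> v 1 3"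
    using TV(4)[OF one] by (auto simp: T_def card_insert_if split: if_splits)
  have three: "{..<3::nat} = {0, 1, 2}" by auto
  have fold: "f i \<in> verts G \<longleftrightarrow> i < 3" for i
    using TV(1-3)[OF one] fr_new by (auto simp: f_def)
  have injf: "inj f"
  proof (rule injI)
    fix i j assume eq: "f i = f j"
    then have "i < 3 \<longleftrightarrow> j < 3" using fold by metis
    then show "i = j" using eq v1 fr_eq by (auto simp: f_def split: if_splits)
  qed
  let ?N = "3 + length ts"
  have f_old: "f ` {..<3} \<subseteq> verts g" using fold gp(3) by blast
  have f_new: "f ` {3..<?N} \<inter> verts g = {}"
  proof -
    have "f i \<notin> verts g" if "3 \<le> i" for i using f3[OF that] fr_new fr_eq gp(3) by auto
    then show ?thesis by auto
  qed
  have injf': "inj_on f {..<?N}" using injf by (rule inj_on_subset) simp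
  define G' where "G' = stack f 3 g ts"
  note sp = stack_props[OF gp(1) increasing_base facts(1) injf' f_old f_new, folded G'_def]
  have verts': "verts G' = verts g \<union> f ` {3..<?N}" by (simp add: G'_def verts_stack)
  have img0: "triple_image f ` {(0, 1, 2)} = {T 1}" by (simp add: triple_image_def T_def f0)
  define \<G> where "\<G> = Tk (r - 1) ` {2..r}"
  have T1: "Tk (r - 1) 1 = T 1" by (simp add: Tk_def T_def w_def)
  have "faces_realized G' (\<G> \<union> triple_image f ` stack_faces 3 {(0, 1, 2)} ts)"
    unfolding G'_def
  proof (rule stack_faces_realized[OF _ increasing_base facts(1) injf' f_old f_new])
    show "faces_realized g (\<G> \<union> triple_image f ` {(0, 1, 2)})"
      unfolding img0 \<G>_def T1[symmetric]
      by (rule faces_realized_mono[OF gp(5)]) (use one in \<open>intro Un_least image_mono; auto\<close>)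
    have "Tk (r - 1) j \<noteq> T 1" if "j \<in> {2..r}" for j
    proof -
      have "v j 1 \<in> Tk (r - 1) j" by (simp add: Tk_def)
      moreover have "v j 1 \<notin> T 1" by (rule notT) (use that in auto)
      ultimately show ?thesis by metis
    qed
    then have "T 1 \<notin> \<G>" unfolding \<G>_def by blast
    then show "\<G> \<inter> triple_image f ` {(0, 1, 2)} = {}" unfolding img0 by blast
  qed
  then obtain p' \<gamma>' where emb': "sphere_embedding G' p' \<gamma>'"
    "\<forall>U \<in> \<G> \<union> triple_image f ` stack_faces 3 {(0, 1, 2)} ts. triangular_face G' p' \<gamma>' U"
    unfolding faces_realized_def by (elim conjE exE)
  note emb' = emb'(1) bspec[OF emb'(2)]
  have poly': "three_polytope G'"
    unfolding three_polytope_def planar_def using sp(1) sp(2)[OF gp(2)] emb'(1)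
    by (intro conjI exI[of _ p'] exI[of _ \<gamma>'])
  have deg_new: "deg G' (f i) = valence ts i" if "3 \<le> i" "i < ?N" for i
    using sp(3)[OF that(2)] that by (simp add: valence_def)
  \<comment> \<open>Two of the m + 2 edges at 0 and at 1 are sides of the gluing triangle, so gluing
    adds \<open>m\<close> edges at each.\<close>
  have occ01: "occ 0 ts = m" "occ 1 ts = m" using facts(6,7) by (simp_all add: valence_def)
  have deg_old: "deg G' (v j i) = deg G (v j i) + m" if ji: "j \<in> {1..r}" "i \<in> {1, 2}" for j i
  proof (cases "j = 1")
    case True
    have "i = 1 \<or> i = 2" using ji(2) by simp
    then show ?thesis
      using sp(3)[of 0] sp(3)[of 1] f0 gp(6)[OF one] occ01 True by auto
  next
    case False
    have "v j i \<noteq> f k" for k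
    proof
      assume eq: "v j i = f k"
      have "v j i \<in> verts G" using TV(1,2)[OF ji(1)] ji(2) by auto
      then have "k < 3" using eq fold by simp
      then have "f k \<in> {v 1 1, v 1 2, v 1 3}" by (auto simp: f_def)
      then show False using eq vne[OF ji(1) one ji(2)] False v3[OF ji(1) one] ji(2) by auto
    qed
    then have "deg G' (v j i) = deg g (v j i)" by (intro sp(4)) auto
    then show ?thesis using gp(6)[OF ji] False ji(1) by auto
  qed
  \<comment> \<open>The first triangle keeps its edge and takes its third vertex from
    \<open>t\<close>; the triangles 2, ..., r receive the last vertex of their splitting; then those
    of \<open>ps\<close> follow.\<close>
  define v' where "v' j i = (if j = 1 then f (corner t i) else if j \<le> r then (if i = 1 then v j 1 else if i = 2 then v j 2 else last (ds j))
      else f (corner (ps ! (j - r - 1)) i))" for j i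
  have rL: "(n + m - 3) div 2 = r + L" using nr mL by simp
  have v'1: "v' 1 1 = v 1 1" "v' 1 2 = v 1 2" "v' 1 3 = f z" by (simp_all add: v'_def t f0)
  have v'old: "v' j i = v j i" if "j \<in> {1..r}" "i \<in> {1, 2}" for j i
    using that by (auto simp: v'_def t f0)
  have v'mid: "v' j 3 = last (ds j)" if "j \<in> {2..r}" for j using that by (auto simp: v'_def)
  have v'new: "v' j i = f (corner (ps ! (j - r - 1)) i)" "ps ! (j - r - 1) \<in> set ps" if "j \<in> {r + 1..r + L}" for j i
    using that r1 by (auto simp: v'_def L_def)
  have cases_j: "j = 1 \<or> j \<in> {2..r} \<or> j \<in> {r + 1..r + L}" if "j \<in> {1..r + L}" for j using that by auto
  have inc: "increasing ?N (stack_faces 3 {(0, 1, 2)} ts)"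
    by (rule increasing_stack[OF increasing_base facts(1)])
  have sb: "3 \<le> i" "i < ?N" if "i \<in> spec_verts ps" for i
    using facts(9)[OF that] spec_verts_bound[OF inc _ that] facts(3) by auto
  have face': "triangular_face G' p' \<gamma>' {v' j 1, v' j 2, v' j 3}" if "j \<in> {1..r + L}" for j
    using cases_j[OF that]
  proof (elim disjE)
    assume j: "j = 1"
    have e: "v' 1 i = f (corner t i)" for i by (simp add: v'_def)
    have "triple_image f t \<in> \<G> \<union> triple_image f ` stack_faces 3 {(0, 1, 2)} ts" using facts(3) by auto
    then show ?thesis unfolding j e corner_image by (rule emb'(2))
  next
    assume j: "j \<in> {2..r}"
    then have "{v' j 1, v' j 2, v' j 3} = Tk (r - 1) j" using v'old[of j] v'mid[OF j] by (auto simp: Tk_def w_def)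
    moreover have "Tk (r - 1) j \<in> \<G> \<union> triple_image f ` stack_faces 3 {(0, 1, 2)} ts" using j by (auto simp: \<G>_def)
    ultimately show ?thesis using emb'(2) by simp
  next
    assume j: "j \<in> {r + 1..r + L}"
    have "triple_image f (ps ! (j - r - 1)) \<in> \<G> \<union> triple_image f ` stack_faces 3 {(0, 1, 2)} ts"
      using facts(3) v'new(2)[OF j] by auto
    then show ?thesis unfolding v'new(1)[OF j] corner_image by (rule emb'(2))
  qed
  have degs': "(\<lambda>j. deg G' (v' j 1)) ` {1..r + L} \<union> (\<lambda>j. deg G' (v' j 2)) ` {1..r + L} = {4..n + m}"
  proof -
    have split: "{1..r + L} = {1..r} \<union> {r + 1..r + L}" by auto
    have old: "(\<lambda>j. deg G' (v' j i)) ` {1..r} = (\<lambda>d. d + m) ` (\<lambda>j. deg G (v j i)) ` {1..r}" if "i \<in> {1, 2}" for i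
      unfolding image_image by (rule image_cong) (use v'old deg_old that in auto)
    have idx: "(\<lambda>j. ps ! (j - r - 1)) ` {r + 1..r + L} = set ps"
    proof -
      have "{r + 1..r + L} = (\<lambda>i. i + (r + 1)) ` {..<L}"
      proof (intro set_eqI iffI)
        fix j assume "j \<in> {r + 1..r + L}"
        then have "j - (r + 1) < L" "j = j - (r + 1) + (r + 1)" by auto
        then show "j \<in> (\<lambda>i. i + (r + 1)) ` {..<L}" by blast
      qed auto
      then show ?thesis by (auto simp: image_image set_conv_nth L_def)
    qed
    have new: "(\<lambda>j. deg G' (v' j i)) ` {r + 1..r + L} = (\<lambda>u. valence ts (corner u i)) ` set ps" if "i \<in> {1, 2}" for i
    proof -
      have "(\<lambda>j. deg G' (v' j i)) ` {r + 1..r + L} = (\<lambda>u. valence ts (corner u i)) ` (\<lambda>j. ps ! (j - r - 1)) ` {r + 1..r + L}"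
        unfolding image_image
      proof (rule image_cong)
        fix j assume j: "j \<in> {r + 1..r + L}"
        have "corner (ps ! (j - r - 1)) i \<in> spec_verts ps" using corner_in(1,2)[OF v'new(2)[OF j]] that by auto
        then show "deg G' (v' j i) = valence ts (corner (ps ! (j - r - 1)) i)"
          unfolding v'new(1)[OF j] by (intro deg_new sb)
      qed simp
      then show ?thesis unfolding idx .
    qed
    have "(\<lambda>j. deg G' (v' j 1)) ` {1..r + L} \<union> (\<lambda>j. deg G' (v' j 2)) ` {1..r + L} =
        (\<lambda>d. d + m) ` {4..n} \<union> valence ts ` ((\<lambda>u. corner u 1) ` set ps \<union> (\<lambda>u. corner u 2) ` set ps)"
      unfolding split image_Un degs[symmetric] using old[of 1] old[of 2] new[of 1] new[of 2] by (auto simp: image_image)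
    also have "\<dots> = (\<lambda>d. d + m) ` {4..n} \<union> {4..m + 3}" unfolding corner_spec_verts facts(14) ..
    also have "(\<lambda>d. d + m) ` {4..n} = {4 + m..n + m}" by (rule image_add_atLeastAtMost')
    also have "{4 + m..n + m} \<union> {4..m + 3} = {4..n + m}" using n(1) by auto
    finally show ?thesis .
  qed
  \<comment> \<open>Every third vertex is now new, numbered below \<open>B\<close> or the image of a
    third vertex of the blueprint. First and second vertices are old or images of prescribed ones,
    so a coincidence would already occur in the blueprint.\<close>
  have third_fresh: "\<exists>i. v' j 3 = fresh i \<and> (i < B \<or> (\<exists>k \<in> thirds (t # ps). 3 \<le> k \<and> i = B + k))" if "j \<in> {1..r + L}" for j
    using cases_j[OF that]
  proof (elim disjE)
    assume "j = 1"
    moreover have "z \<in> thirds (t # ps)" by (simp add: t)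
    ultimately show ?thesis using v'1(3) f3[of z] z by auto
  next
    assume j: "j \<in> {2..r}"
    then have "m * j + m \<le> B" unfolding B_def using mult_le_mono2[of "j + 1" "r + 1" m] by simp
    then have "m * j + m - 1 < B" using m(1) by linarith
    then show ?thesis using v'mid[OF j] ds(5) by auto
  next
    assume j: "j \<in> {r + 1..r + L}"
    have c: "corner (ps ! (j - r - 1)) 3 \<in> thirds ps" by (rule corner_in(3)[OF v'new(2)[OF j]])
    then have "corner (ps ! (j - r - 1)) 3 \<notin> {0, 1, 2}" using facts(10,11) t by auto
    then have "3 \<le> corner (ps ! (j - r - 1)) 3" by auto
    then show ?thesis using c v'new(1)[OF j, of 3] f3 t by auto
  qed
  have first_cases: "v' i a \<in> verts G \<or> (\<exists>k\<in>spec_verts (t # ps). v' i a = fresh (B + k))"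
    if "i \<in> {1..r + L}" "a \<in> {1, 2}" for i a
  proof (cases "i \<le> r")
    case True
    then have i: "i \<in> {1..r}" using that by auto
    then show ?thesis using v'old[OF i that(2)] TV(1,2)[OF i] that(2) by auto
  next
    case False
    then have i: "i \<in> {r + 1..r + L}" using that by auto
    have "corner (ps ! (i - r - 1)) a \<in> spec_verts ps" using corner_in(1,2)[OF v'new(2)[OF i]] that by auto
    then show ?thesis using v'new(1)[OF i, of a] f3 sb(1) t by auto
  qed
  have third_ne: "v' j 3 \<noteq> v' i a" if ij: "i \<in> {1..r + L}" "j \<in> {1..r + L}" "a \<in> {1, 2}" for i j a
  proof
    assume eq: "v' j 3 = v' i a"
    obtain k where k: "v' j 3 = fresh k" "k < B \<or> (\<exists>k' \<in> thirds (t # ps). 3 \<le> k' \<and> k = B + k')"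
      using third_fresh[OF ij(2)] by blast
    have ek: "v' i a = fresh k" using eq k(1) by simp
    then have "v' i a \<notin> verts G" using fr_new by simp
    then obtain k' where k': "k' \<in> spec_verts (t # ps)" "v' i a = fresh (B + k')"
      using first_cases[OF ij(1,3)] by blast
    have "k = B + k'" using ek k'(2) fr_eq by simp
    then have "k' \<in> thirds (t # ps)" using k(2) by auto
    then show False using k'(1) facts(11) by blast
  qed
  have QT': "Q_triangles (n + m) G' v'"
    unfolding Q_triangles_def rL
  proof (intro conjI)
    show "\<exists>p \<gamma>. sphere_embedding G' p \<gamma> \<and> (\<forall>j\<in>{1..r + L}. triangular_face G' p \<gamma> {v' j 1, v' j 2, v' j 3})"
      using emb'(1) face' by (intro exI[of _ p'] exI[of _ \<gamma>'] conjI ballI)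
    show "(\<lambda>j. deg G' (v' j 1)) ` {1..r + L} \<union> (\<lambda>j. deg G' (v' j 2)) ` {1..r + L} = {4..n + m}" by (rule degs')
    show "\<forall>i\<in>{1..r + L}. \<forall>j\<in>{1..r + L}. v' j 3 \<noteq> v' i 1 \<and> v' j 3 \<noteq> v' i 2" using third_ne by simp
  qed
  have PQ': "property_Q (n + m) G'"
  proof -
    have len: "0 < length ts" using facts(2) by simp
    have "deg G' (f (2 + length ts)) = 3"
      using deg_new[of "2 + length ts"] occ_fresh[OF increasing_base facts(1), of "2 + length ts"] len
      by (simp add: valence_def)
    moreover have "2 + length ts \<in> {3..<?N}" using len unfolding atLeastLessThan_iff by linarith
    then have "f (2 + length ts) \<in> verts G'" unfolding verts' by (intro UnI2 imageI)
    ultimately show ?thesis using QT' unfolding property_Q_def by (intro conjI bexI[of _ "f (2 + length ts)"] exI[of _ v'])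
  qed
  have sub: "subgraph G G'"
    unfolding subgraph_def using verts' gp(3,4) by (auto simp: G'_def edges_stack)
  have card': "card (verts G') = card (verts G) + m * (r - 1) + length ts"
  proof -
    have "card (f ` {3..<?N}) = length ts" by (subst card_image) (use injf in \<open>auto intro: inj_on_subset\<close>)
    moreover have "card (fresh ` {2 * m..<B}) = m * (r - 1)"
      using r1 by (subst card_image) (use fresh(1) in \<open>auto intro: inj_on_subset simp: B_def algebra_simps diff_mult_distrib2\<close>)
    moreover have "card (verts g) = card (verts G) + card (fresh ` {2 * m..<B})"
      unfolding gp(3) by (rule card_Un_disjoint) (use finV fr_new in auto)
    moreover have "card (verts G') = card (verts g) + card (f ` {3..<?N})"
      unfolding verts' by (rule card_Un_disjoint) (use f_new finV gp(3) in auto)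
    ultimately show ?thesis by simp
  qed
  have step: "algorithm_step m (stacked_graph ts) n v G G'"
    unfolding algorithm_step_def r_def[symmetric]
  proof (intro conjI exI[of _ "\<lambda>j. HH (j - 1)"] ballI)
    show "property_Q n G" "Q_triangles n G v" by fact+
    show "HH (1 - 1) = G" by (simp add: HH)
    fix j assume j: "j \<in> {2..r}"
    define k where "k = j - 2"
    have k: "j = k + 2" "j - 1 = Suc k" "j - 1 - 1 = k" using j by (auto simp: k_def)
    have "k + 1 \<le> r" using j k by auto
    then have dis: "set (ds j) \<inter> verts (HH k) = {}" unfolding ds using inv[of k] fr_new fr_eq k by (auto simp: algebra_simps)
    have "HH (j - 1) = split_about (HH k) (v j 1) (v j 2) (v j 3) (ds j)"
      unfolding k(2) HH(2) by (simp only: k(1))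
    then show "h_split m (v j 1) (v j 2) (v j 3) (HH (j - 1 - 1)) (HH (j - 1))"
      unfolding h_split_def k(3) using ds(1,2) dis by (intro exI[of _ "ds j"] conjI)
  next
    have dgs: "deg (stacked_graph ts) 0 = m + 2" "deg (stacked_graph ts) 1 = m + 2"
      using stacked_graph_props(2)[OF bp] facts(6,7) by auto
    obtain p0 \<gamma>0 where "sphere_embedding (stacked_graph ts) p0 \<gamma>0" "\<forall>U\<in>{{0, 1, 2}}. triangular_face (stacked_graph ts) p0 \<gamma>0 U"
      using stacked_graph_base_face[OF bp] unfolding faces_realized_def by (elim conjE exE)
    then have "\<exists>p \<gamma>. sphere_embedding (stacked_graph ts) p \<gamma> \<and> triangular_face (stacked_graph ts) p \<gamma> {0, 1, 2}"
      by (intro exI[of _ p0] exI[of _ \<gamma>0]) simp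
    moreover have "\<exists>f. inj_on f (verts (stacked_graph ts)) \<and> f 0 = v 1 1 \<and> f 1 = v 1 2 \<and> f 2 = v 1 3 \<and>
        f ` verts (stacked_graph ts) \<inter> verts g = {v 1 1, v 1 2, v 1 3} \<and>
        G' = \<lparr>verts = verts g \<union> verts (graph_image f (stacked_graph ts)),
              edges = edges g \<union> edges (graph_image f (stacked_graph ts))\<rparr>"
    proof (intro exI[of _ f] conjI)
      have V: "verts (stacked_graph ts) = {..<3} \<union> {3..<?N}" unfolding verts_stacked_graph[OF bp] by auto
      have f3im: "f ` {..<3} = {v 1 1, v 1 2, v 1 3}" by (auto simp: three f0)
      show "inj_on f (verts (stacked_graph ts))" using injf by (rule inj_on_subset) simp
      show "f 0 = v 1 1" "f 1 = v 1 2" "f 2 = v 1 3" by (rule f0)+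
      show "f ` verts (stacked_graph ts) \<inter> verts g = {v 1 1, v 1 2, v 1 3}"
        using f_old f_new unfolding V image_Un f3im by blast
      \<comment> \<open>The sides of the gluing triangle are already edges of \<open>g\<close>, so
        the copy contributes just the edges of the stack.\<close>
      have tri: "{v 1 1, v 1 2} \<in> edges g" "{v 1 2, v 1 3} \<in> edges g" "{v 1 1, v 1 3} \<in> edges g"
      proof -
        have "sides (T 1) \<subseteq> edges g" using faces_realizedD(3)[OF gp(5)] T1 one by (metis image_eqI)
        then show "{v 1 1, v 1 2} \<in> edges g" "{v 1 2, v 1 3} \<in> edges g" "{v 1 1, v 1 3} \<in> edges g"
          unfolding T_def using v1 by (simp_all add: sides_triple)
      qed
      have "edges (graph_image f (stacked_graph ts)) =
          {{v 1 1, v 1 2}, {v 1 2, v 1 3}, {v 1 1, v 1 3}} \<union> stack_edges f 3 ts"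
        unfolding graph_image_def stacked_graph_def edges_stack sgraph.simps image_Un stack_edges_image[of f 3 ts]
        by (simp add: triangle_graph_def f0)
      then have "edges G' = edges g \<union> edges (graph_image f (stacked_graph ts))"
        using tri unfolding G'_def edges_stack by auto
      moreover have "verts G' = verts g \<union> verts (graph_image f (stacked_graph ts))"
        using f_old unfolding verts' graph_image_def sgraph.simps V image_Un by auto
      ultimately show "G' = \<lparr>verts = verts g \<union> verts (graph_image f (stacked_graph ts)),
              edges = edges g \<union> edges (graph_image f (stacked_graph ts))\<rparr>" by simp
    qed
    ultimately have "replace_triangle (stacked_graph ts) 0 1 2 (v 1 1) (v 1 2) (v 1 3) g G'"
      unfolding replace_triangle_def by (rule conjI)
    then show "\<exists>y1 y2 y3. deg (stacked_graph ts) y1 = m + 2 \<and> deg (stacked_graph ts) y2 = m + 2 \<and>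
        replace_triangle (stacked_graph ts) y1 y2 y3 (v 1 1) (v 1 2) (v 1 3) (HH (r - 1)) G'"
      using dgs unfolding g_def by (intro exI[of _ 0] exI[of _ 1] exI[of _ 2] conjI)
  qed
  show ?thesis
    using step poly' PQ' QT' sub card' unfolding r_def by (intro exI[of _ G'] exI[of _ v'] conjI)
qed

section \<open>The asymptotic bound\<close>

text \<open>For n = l + mk the left side equals n^2/4 - 11n/4 + 5n/(2m) plus the constant
  \<open>C\<close>, which is at most \<epsilon>n as soon as k is at least C / (\<epsilon>m).\<close>

lemma quadratic_bound:
  fixes a b c :: real and N :: "nat \<Rightarrow> real" and l m :: nat
  assumes m: "0 < m" and N: "\<And>k. N k = c + real m ^ 2 * real k ^ 2 / 4 + real k * (real m * real l / 2 - 11 * real m / 4 + 5 / 2)"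
    and \<epsilon>: "0 < \<epsilon>"
  shows "\<forall>\<^sub>F k in sequentially. \<forall>n. n = l + m * k \<longrightarrow>
    N k \<le> (real n)\<^sup>2 / 4 - 11 * real n / 4 + (5 / (2 * real m) + \<epsilon>) * real n"
proof -
  define b where "b = 5 / (2 * real m)"
  define C where "C = c - (real l)\<^sup>2 / 4 + 11 * real l / 4 - b * real l"
  obtain K :: nat where K: "C / (\<epsilon> * real m) \<le> real K" using real_arch_simple by blast
  show ?thesis
    unfolding eventually_sequentially
  proof (intro exI[of _ K] allI impI)
    fix k n assume k: "K \<le> k" and n: "n = l + m * k"
    have "C / (\<epsilon> * real m) \<le> real k" using K k by linarith
    then have "C \<le> \<epsilon> * real m * real k" using m \<epsilon> by (simp add: field_simps)
    also have "\<dots> \<le> \<epsilon> * real n" using \<epsilon> by (simp add: n algebra_simps)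
    finally have C: "C \<le> \<epsilon> * real n" .
    have "b * real m = 5 / 2" using m by (simp add: b_def)
    then have "b * real n = b * real l + 5 / 2 * real k" by (simp add: n algebra_simps)
    then have "N k = (real n)\<^sup>2 / 4 - 11 * real n / 4 + b * real n + C"
      unfolding N C_def n by (simp add: power2_eq_square field_simps)
    then show "N k \<le> (real n)\<^sup>2 / 4 - 11 * real n / 4 + (5 / (2 * real m) + \<epsilon>) * real n"
      using C unfolding b_def by (simp add: algebra_simps)
  qed
qed

theorem theorem4:
  fixes m :: nat
  assumes "m \<ge> 14" and "m mod 4 = 2"
  shows "\<exists>(s :: nat sgraph) x. auxiliary_graph m s x \<and>
    (\<forall>l (G0 :: 'a::infinite sgraph) v0.
       5 \<le> l \<and> odd l \<and> three_polytope G0 \<and> property_Q l G0 \<and> Q_triangles l G0 v0 \<longrightarrow>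
       (\<exists>(t :: nat \<Rightarrow> 'a sgraph) v.
          t l = G0 \<and> v l = v0 \<and>
          (\<forall>k\<ge>1. three_polytope (t (l + m * k)) \<and> property_Q (l + m * k) (t (l + m * k))) \<and>
          (\<forall>\<epsilon>>0. \<forall>\<^sub>F k in sequentially. \<forall>n. n = l + m * k \<longrightarrow>
             real (card (verts (t n))) \<le>
               (real n)\<^sup>2 / 4 - 11 * real n / 4 + (5 / (2 * real m) + \<epsilon>) * real n) \<and>
          (\<forall>k\<ge>1. isomorphic_to_subgraph (t (l + m * (k - 1))) (t (l + m * k))) \<and>
          (\<forall>N\<ge>1. algorithm_run m s l N v t)))"
proof -
  have m: "0 < m" "even m" "17 \<le> m + 3" "(m + 3) mod 4 = 1" using assms by presburger+
  obtain ts t ps where bp: "blueprint (m + 3) ts t ps" using exists_blueprint[OF m(3,4)] by blast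
  let ?s = "stacked_graph ts" and ?x = "\<lambda>j. corner ((t # ps) ! (j - 1))"
  have aux: "auxiliary_graph m ?s ?x" by (rule blueprint_auxiliary_graph[OF bp m(2)])
  \<comment> \<open>\<open>length ts\<close> counts the vertices of \<open>s\<close> outside the
    gluing triangle: (q^2 - 7q + 34)/4 - 3 with q = m + 3.\<close>
  have len: "4 * real (length ts) = real m ^ 2 - real m + 10"
    using arg_cong[OF blueprint_facts(15)[OF bp], of real] by (simp add: power2_eq_square algebra_simps)
  show ?thesis
  proof (intro exI[of _ ?s] exI[of _ ?x] conjI allI impI)
    show "auxiliary_graph m ?s ?x" by (rule aux)
    fix l and G0 :: "'a sgraph" and v0
    assume l: "5 \<le> l \<and> odd l \<and> three_polytope G0 \<and> property_Q l G0 \<and> Q_triangles l G0 v0"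
    \<comment> \<open>Dependent choice yields some initial state; the last clause makes it the given
      one. Graph and triangles form one state because each step chooses both.\<close>
    define good where "good k S \<longleftrightarrow> three_polytope (fst S) \<and> property_Q (l + m * k) (fst S) \<and>
        Q_triangles (l + m * k) (fst S) (snd S) \<and> (k = 0 \<longrightarrow> S = (G0, v0))" for k and S :: "'a sgraph \<times> (nat \<Rightarrow> nat \<Rightarrow> 'a)"
    define succ_state where "succ_state k S S' \<longleftrightarrow> algorithm_step m ?s (l + m * k) (snd S) (fst S) (fst S') \<and> subgraph (fst S) (fst S') \<and>
        card (verts (fst S')) = card (verts (fst S)) + m * ((l + m * k - 3) div 2 - 1) + length ts"
      for k and S S' :: "'a sgraph \<times> (nat \<Rightarrow> nat \<Rightarrow> 'a)"
    have "\<exists>S. \<forall>k. good k (S k) \<and> succ_state k (S k) (S (Suc k))"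
    proof (rule dependent_nat_choice)
      show "\<exists>S. good 0 S" using l by (intro exI[of _ "(G0, v0)"]) (simp add: good_def)
    next
      fix S k assume S: "good k S"
      have "5 \<le> l + m * k" "odd (l + m * k)" using l m(2) by auto
      from algorithm_step_exists[OF bp m(1,2) this, of "fst S" "snd S"] S
      obtain G' v' where "algorithm_step m ?s (l + m * k) (snd S) (fst S) G'" "three_polytope G'" "property_Q (l + m * k + m) G'"
        "Q_triangles (l + m * k + m) G' v'" "subgraph (fst S) G'"
        "card (verts G') = card (verts (fst S)) + m * ((l + m * k - 3) div 2 - 1) + length ts"
        unfolding good_def by meson
      then show "\<exists>S'. good (Suc k) S' \<and> succ_state k S S'"
        by (intro exI[of _ "(G', v')"]) (simp add: good_def succ_state_def algebra_simps)
    qed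
    then obtain S where S: "\<And>k. good k (S k)" "\<And>k. succ_state k (S k) (S (Suc k))" by blast
    \<comment> \<open>The states are numbered by k, the sequence of the theorem by n; at n = l + mk
      the quotient is k.\<close>
    define tt where "tt n = fst (S ((n - l) div m))" for n
    define vv where "vv n = snd (S ((n - l) div m))" for n
    have tk: "tt (l + m * k) = fst (S k)" "vv (l + m * k) = snd (S k)" for k
      using m(1) by (simp_all add: tt_def vv_def)
    have S0: "S 0 = (G0, v0)" using S(1)[of 0] by (simp add: good_def)
    have prev: "succ_state (k - 1) (S (k - 1)) (S k)" if "1 \<le> k" for k
      using S(2)[of "k - 1"] that by simp
    \<comment> \<open>From n = l + mk to n + m the graph gains m(n - 5)/2 vertices by splittings and
      (m^2 - m + 10)/4 by the copy; summation gives the formula.\<close>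
    have card: "real (card (verts (fst (S k)))) = real (card (verts G0)) + real m ^ 2 * real k ^ 2 / 4
        + real k * (real m * real l / 2 - 11 * real m / 4 + 5 / 2)" for k
    proof (induction k)
      case 0
      show ?case by (simp add: S0)
    next
      case (Suc k)
      have "odd (l + m * k)" "5 \<le> l + m * k" using l m(2) by auto
      moreover have "2 * ((n - 3) div 2 - 1) + 5 = n" if "odd n" "5 \<le> n" for n :: nat
        using that by presburger
      moreover define h where "h = (l + m * k - 3) div 2 - 1"
      ultimately have "2 * h + 5 = l + m * k" by blast
      then have "real (2 * h + 5) = real (l + m * k)" by (rule arg_cong)
      then have e: "real h = (real l + real m * real k - 5) / 2" by simp
      have "real (card (verts (fst (S (Suc k))))) = real (card (verts (fst (S k)))) +
          real m * ((real l + real m * real k - 5) / 2) + (real m ^ 2 - real m + 10) / 4"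
        using S(2)[of k] len unfolding succ_state_def e[symmetric] h_def[symmetric] by simp
      then show ?case unfolding Suc by (simp add: field_simps power2_eq_square)
    qed
    show "\<exists>(t :: nat \<Rightarrow> 'a sgraph) v.
          t l = G0 \<and> v l = v0 \<and>
          (\<forall>k\<ge>1. three_polytope (t (l + m * k)) \<and> property_Q (l + m * k) (t (l + m * k))) \<and>
          (\<forall>\<epsilon>>0. \<forall>\<^sub>F k in sequentially. \<forall>n. n = l + m * k \<longrightarrow>
             real (card (verts (t n))) \<le>
               (real n)\<^sup>2 / 4 - 11 * real n / 4 + (5 / (2 * real m) + \<epsilon>) * real n) \<and>
          (\<forall>k\<ge>1. isomorphic_to_subgraph (t (l + m * (k - 1))) (t (l + m * k))) \<and>
          (\<forall>N\<ge>1. algorithm_run m ?s l N v t)"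
    proof (intro exI[of _ tt] exI[of _ vv] conjI allI impI)
      show "tt l = G0" "vv l = v0" using tk[of 0] S0 by simp_all
      fix k :: nat assume k: "1 \<le> k"
      show "three_polytope (tt (l + m * k))" "property_Q (l + m * k) (tt (l + m * k))"
        using S(1)[of k] by (simp_all add: good_def tk)
      have "subgraph (graph_image id (fst (S (k - 1)))) (fst (S k))"
        using prev[OF k] by (simp add: succ_state_def graph_image_def subgraph_def)
      then show "isomorphic_to_subgraph (tt (l + m * (k - 1))) (tt (l + m * k))"
        unfolding isomorphic_to_subgraph_def tk by (intro exI[of _ id]) simp
    next
      fix \<epsilon> :: real assume \<epsilon>: "0 < \<epsilon>"
      have "\<forall>\<^sub>F k in sequentially. \<forall>n. n = l + m * k \<longrightarrow>
          real (card (verts (fst (S k)))) \<le> (real n)\<^sup>2 / 4 - 11 * real n / 4 + (5 / (2 * real m) + \<epsilon>) * real n"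
        by (rule quadratic_bound[OF m(1) card \<epsilon>])
      then show "\<forall>\<^sub>F k in sequentially. \<forall>n. n = l + m * k \<longrightarrow>
          real (card (verts (tt n))) \<le> (real n)\<^sup>2 / 4 - 11 * real n / 4 + (5 / (2 * real m) + \<epsilon>) * real n"
        by (rule eventually_mono) (simp add: tk)
    next
      fix N :: nat
      show "algorithm_run m ?s l N vv tt"
        unfolding algorithm_run_def
      proof
        fix k assume "k \<in> {1..N}"
        then have "succ_state (k - 1) (S (k - 1)) (S k)" by (intro prev) simp
        then show "algorithm_step m ?s (l + m * (k - 1)) (vv (l + m * (k - 1))) (tt (l + m * (k - 1))) (tt (l + m * k))"
          unfolding tk by (simp add: succ_state_def)
      qed
    qed
  qed
qed

end
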